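(* Let $s\in\mathbb{R}$, $q\in(0,\infty]$ and $1\le w\le p<\infty$. Then there exists a constant $C$ (independent of $f$) such that for every Lebesgue measurable function $f:\mathbb{R}^N\to\mathbb{R}$, $$\|f\|_{B^{s\frac wp}_{p,q}(\mathbb{R}^N)}\le C\,\|f\|_{B^{s}_{w,w\frac qp}(\mathbb{R}^N)}^{\frac wp}\,\|f\|_{\mathrm{bmo}(\mathbb{R}^N)}^{1-\frac wp},$$ where $w\frac qp:=\infty$ if $q=\infty$.
   Context: $\mathcal{L}^N$ is Lebesgue measure, $\mathcal{S}$ the Schwartz space, $\mathcal{S}'$ the tempered distributions, $\mathcal{F}$ the Fourier transform. Let $\{\varphi_j\}_{j=0}^\infty\subset\mathcal{S}(\mathbb{R}^N)$ be a fixed dyadic resolution of unity, i.e. $\operatorname{supp}\varphi_0\subset\{|x|\le2\}$, $\operatorname{supp}\varphi_j\subset\{2^{j-1}\le|x|\le2^{j+1}\}$ for $j\ge1$; for every multi-index $\alpha$ there is $c_\alpha>0$ with $2^{j|\alpha|}|D^\alpha\varphi_j(x)|\le c_\alpha$ for all $j\ge0$ and all $x$; and $\sum_{j\ge0}\varphi_j(x)=1$ for every $x$. For $s\in\mathbb{R}$, $0<p\le\infty$ and $f\in\mathcal{S}'(\mathbb{R}^N)$, $$\|f\|_{B^s_{p,q}}:=\Big(\sum_{j=0}^\infty2^{jsq}\|\mathcal{F}^{-1}\varphi_j\mathcal{F}f\|_{L^p}^q\Big)^{1/q}\ (0<q<\infty),\qquad \|f\|_{B^s_{p,\infty}}:=\sup_{j\ge0}2^{js}\|\mathcal{F}^{-1}\varphi_j\mathcal{F}f\|_{L^p}.$$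 The local space $\mathrm{bmo}(\mathbb{R}^N)$ consists of all $f\in L^1_{\mathrm{loc}}(\mathbb{R}^N)$ with $$\|f\|_{\mathrm{bmo}}:=\sup_{\mathcal{L}^N(Q)\le1}\frac{1}{\mathcal{L}^N(Q)}\int_Q|f-f_Q|\,dx+\sup_{\mathcal{L}^N(Q)>1}\frac{1}{\mathcal{L}^N(Q)}\int_Q|f|\,dx<\infty,$$ where $Q$ ranges over cubes with sides parallel to the axes and $f_Q:=\frac{1}{\mathcal{L}^N(Q)}\int_Qf$. A quasi-norm is understood to be $+\infty$ when $f$ does not belong to the corresponding space, and the inequality is in $[0,\infty]$. *)

theory Defs
  imports "HOL-Analysis.Analysis" "HOL-Probability.Essential_Supremum"
begin

text \<open>Powers on \<open>[0,\<infinity>]\<close> with exponent \<open>a \<ge> 0\<close>; in particular \<open>0\<^sup>0 = \<infinity>\<^sup>0 = 1\<close>.\<close>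

definition epowr :: "ennreal \<Rightarrow> real \<Rightarrow> ennreal" where
  "epowr x a = (if a = 0 then 1 else if x = \<infinity> then \<infinity> else ennreal (enn2real x powr a))"

definition partial_deriv ::
    "'n \<Rightarrow> (real^'n \<Rightarrow> 'b::real_normed_vector) \<Rightarrow> real^'n \<Rightarrow> 'b" where
  "partial_deriv i f x = vector_derivative (\<lambda>t. f (x + t *\<^sub>R axis i 1)) (at 0)"

text \<open>
  A multi-index is given as the list of the coordinate directions in which one differentiates;
  its order \<open>|\<alpha>|\<close> is the length of the list. On smooth functions the order of the
  entries is irrelevant, so these are exactly the derivatives \<open>D\<^sup>\<alpha>\<close>.
\<close>

fun Dpart :: "'n list \<Rightarrow> (real^'n \<Rightarrow> 'b::real_normed_vector) \<Rightarrow> real^'n \<Rightarrow> 'b" where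
  "Dpart [] f = f"
| "Dpart (i # \<alpha>) f = partial_deriv i (Dpart \<alpha> f)"

definition smooth :: "(real^'n \<Rightarrow> 'b::real_normed_vector) \<Rightarrow> bool" where
  "smooth f \<longleftrightarrow> (\<forall>\<alpha>. Dpart \<alpha> f differentiable_on UNIV)"

definition supp :: "('a::topological_space \<Rightarrow> 'b::zero) \<Rightarrow> 'a set" where
  "supp f = closure {x. f x \<noteq> 0}"

definition test_functions :: "(real^'n \<Rightarrow> complex) set" where
  "test_functions = {\<psi>. smooth \<psi> \<and> compact (supp \<psi>)}"

definition schwartz :: "(real^'n \<Rightarrow> complex) set" where
  "schwartz = {\<psi>. smooth \<psi> \<and>
     (\<forall>k \<alpha>. bounded (range (\<lambda>x. (1 + norm x) ^ k *\<^sub>R Dpart \<alpha> \<psi> x)))}"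

text \<open>Convergence in the topology of the seminorms \<open>sup\<^sub>x (1 + |x|)\<^sup>k |D\<^sup>\<alpha> \<psi>(x)|\<close>.\<close>

definition schwartz_tendsto :: "(nat \<Rightarrow> real^'n \<Rightarrow> complex) \<Rightarrow> (real^'n \<Rightarrow> complex) \<Rightarrow> bool" where
  "schwartz_tendsto \<Psi> \<psi> \<longleftrightarrow>
     (\<forall>k \<alpha>. uniform_limit UNIV (\<lambda>n x. (1 + norm x) ^ k *\<^sub>R Dpart \<alpha> (\<Psi> n) x)
               (\<lambda>x. (1 + norm x) ^ k *\<^sub>R Dpart \<alpha> \<psi> x) sequentially)"

text \<open>
  Only the values on \<^const>\<open>schwartz\<close> are meaningful. The Schwartz space is metrizable, so
  sequential continuity is continuity.
\<close>

type_synonym 'n distr = "(real^'n \<Rightarrow> complex) \<Rightarrow> complex"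

definition tempered :: "'n::finite distr \<Rightarrow> bool" where
  "tempered u \<longleftrightarrow>
     (\<forall>\<psi>\<in>schwartz. \<forall>\<eta>\<in>schwartz. u (\<lambda>x. \<psi> x + \<eta> x) = u \<psi> + u \<eta>) \<and>
     (\<forall>c. \<forall>\<psi>\<in>schwartz. u (\<lambda>x. c * \<psi> x) = c * u \<psi>) \<and>
     (\<forall>\<Psi> \<psi>. range \<Psi> \<subseteq> schwartz \<longrightarrow> \<psi> \<in> schwartz \<longrightarrow> schwartz_tendsto \<Psi> \<psi> \<longrightarrow>
        (\<lambda>n. u (\<Psi> n)) \<longlonglongrightarrow> u \<psi>)"

definition locally_integrable ::
    "(real^'n \<Rightarrow> 'b::{banach, second_countable_topology}) \<Rightarrow> bool" where
  "locally_integrable f \<longleftrightarrow> (\<forall>K. compact K \<longrightarrow> set_integrable lebesgue K f)"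

text \<open>
  The distribution \<open>u\<close> is the function \<open>g\<close>. The identity is only required on test functions:
  they are dense in the Schwartz space, and for a general locally integrable \<open>g\<close> that defines a
  tempered distribution the integral need not converge absolutely for every Schwartz function.
\<close>

definition represents :: "(real^'n::finite \<Rightarrow> complex) \<Rightarrow> 'n distr \<Rightarrow> bool" where
  "represents g u \<longleftrightarrow> locally_integrable g \<and>
     (\<forall>\<psi>\<in>test_functions. u \<psi> = (LINT x|lebesgue. g x * \<psi> x))"

definition fourier :: "(real^'n::finite \<Rightarrow> complex) \<Rightarrow> real^'n \<Rightarrow> complex" where
  "fourier \<psi> \<xi> = complex_of_real ((2 * pi) powr (- real CARD('n) / 2)) *
     (LINT x|lborel. exp (- \<i> * complex_of_real (x \<bullet> \<xi>)) * \<psi> x)"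

definition inv_fourier :: "(real^'n::finite \<Rightarrow> complex) \<Rightarrow> real^'n \<Rightarrow> complex" where
  "inv_fourier \<psi> x = complex_of_real ((2 * pi) powr (- real CARD('n) / 2)) *
     (LINT \<xi>|lborel. exp (\<i> * complex_of_real (x \<bullet> \<xi>)) * \<psi> \<xi>)"

definition distr_fourier :: "'n::finite distr \<Rightarrow> 'n distr" where
  "distr_fourier u = (\<lambda>\<psi>. u (fourier \<psi>))"

definition distr_inv_fourier :: "'n::finite distr \<Rightarrow> 'n distr" where
  "distr_inv_fourier u = (\<lambda>\<psi>. u (inv_fourier \<psi>))"

definition distr_mult :: "(real^'n::finite \<Rightarrow> complex) \<Rightarrow> 'n distr \<Rightarrow> 'n distr" where
  "distr_mult \<phi> u = (\<lambda>\<psi>. u (\<lambda>x. \<phi> x * \<psi> x))"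

definition dyadic_resolution :: "(nat \<Rightarrow> real^'n::finite \<Rightarrow> complex) \<Rightarrow> bool" where
  "dyadic_resolution \<phi> \<longleftrightarrow>
     (\<forall>j. \<phi> j \<in> schwartz) \<and>
     supp (\<phi> 0) \<subseteq> {x. norm x \<le> 2} \<and>
     (\<forall>j\<ge>1. supp (\<phi> j) \<subseteq> {x. 2 powr (real j - 1) \<le> norm x \<and> norm x \<le> 2 powr (real j + 1)}) \<and>
     (\<forall>\<alpha>. \<exists>c>0. \<forall>j x. 2 ^ (j * length \<alpha>) * norm (Dpart \<alpha> (\<phi> j) x) \<le> c) \<and>
     (\<forall>x. (\<lambda>j. \<phi> j x) sums 1)"

definition Lp_norm :: "ennreal \<Rightarrow> (real^'n::finite \<Rightarrow> complex) \<Rightarrow> ennreal" where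
  "Lp_norm p g =
     (if p = \<infinity> then esssup lebesgue (\<lambda>x. ennreal (norm (g x)))
      else epowr (\<integral>\<^sup>+x. ennreal (norm (g x) powr enn2real p) \<partial>lebesgue) (1 / enn2real p))"

text \<open>
  The representing function is unique up to null sets, so the infimum is over at most one value;
  it is \<open>\<infinity>\<close> if the distribution is not a function.
\<close>

definition distr_Lp_norm :: "ennreal \<Rightarrow> 'n::finite distr \<Rightarrow> ennreal" where
  "distr_Lp_norm p u = (INF g\<in>{g. represents g u}. Lp_norm p g)"

definition distr_besov_norm ::
    "(nat \<Rightarrow> real^'n::finite \<Rightarrow> complex) \<Rightarrow> real \<Rightarrow> ennreal \<Rightarrow> ennreal \<Rightarrow> 'n distr \<Rightarrow> ennreal" where
  "distr_besov_norm \<phi> s p q u =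
     (let a = (\<lambda>j. distr_Lp_norm p (distr_inv_fourier (distr_mult (\<phi> j) (distr_fourier u))))
      in if q = \<infinity> then (SUP j. ennreal (2 powr (real j * s)) * a j)
         else epowr (\<Sum>j. ennreal (2 powr (real j * s * enn2real q)) * epowr (a j) (enn2real q))
                (1 / enn2real q))"

text \<open>
  A tempered distribution represented by \<open>f\<close> is unique as a functional on the Schwartz space, so
  again the infimum is over at most one value; it is \<open>\<infinity>\<close> if \<open>f\<close> is not a tempered distribution.
\<close>

definition besov_norm ::
    "(nat \<Rightarrow> real^'n::finite \<Rightarrow> complex) \<Rightarrow> real \<Rightarrow> ennreal \<Rightarrow> ennreal \<Rightarrow> (real^'n \<Rightarrow> real) \<Rightarrow> ennreal" where
  "besov_norm \<phi> s p q f =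
     (INF u\<in>{u. tempered u \<and> represents (\<lambda>x. complex_of_real (f x)) u}. distr_besov_norm \<phi> s p q u)"

definition cube :: "(real^'n) set \<Rightarrow> bool" where
  "cube Q \<longleftrightarrow> (\<exists>a l. l > 0 \<and> Q = cbox a (\<chi> i. a $ i + l))"

definition average :: "(real^'n::finite) set \<Rightarrow> (real^'n \<Rightarrow> real) \<Rightarrow> real" where
  "average Q f = 1 / measure lebesgue Q * (LINT x:Q|lebesgue. f x)"

definition bmo_norm :: "(real^'n::finite \<Rightarrow> real) \<Rightarrow> ennreal" where
  "bmo_norm f =
     (if locally_integrable f then
        (SUP Q\<in>{Q. cube Q \<and> measure lebesgue Q \<le> 1}. ennreal (average Q (\<lambda>x. \<bar>f x - average Q f\<bar>))) +
        (SUP Q\<in>{Q. cube Q \<and> measure lebesgue Q > 1}. ennreal (average Q (\<lambda>x. \<bar>f x\<bar>)))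
      else \<infinity>)"

end

theory Submission
  imports Defs "HOL-Probability.Characteristic_Functions"
begin

text \<open>
  The \<open>j\<close>-th dyadic block of \<open>f\<close> is the convolution of \<open>f\<close> with a multiple of \<open>L\<^sub>j = \<F>\<phi>\<^sub>j\<close>, where
  \<open>|L\<^sub>j(z)| \<le> C 2\<^bsup>jN\<^esup> (1 + 2\<^sup>j|z|)\<^bsup>-N-1\<^esup>\<close> and \<open>L\<^sub>j\<close> has mean zero for \<open>j \<ge> 1\<close>. Subtracting from \<open>f\<close> its average
  over the cube of side \<open>2\<^bsup>-j\<^esup>\<close> around a point and summing over its dyadic dilates, along which the averages
  of \<open>f\<close> grow at most linearly, shows that all blocks are bounded by a multiple of the \<open>bmo\<close> norm;
  for \<open>j = 0\<close> the averages of \<open>|f|\<close> over large cubes take the place of the cancellation.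
  Interpolation between \<open>L\<^sup>w\<close> and \<open>L\<^sup>\<infinity>\<close> of each block gives the inequality.

  No general Fourier inversion is needed: the block is computed by duality, and \<open>\<phi>\<^sub>0\<close>, which equals \<open>1\<close>
  near the origin, serves as cutoff and as mollifier.
\<close>


section \<open>Partial derivatives and smooth functions\<close>


text \<open>By the definitions, block j acts on a test function \<psi> as
  \<open>u (fourier (\<lambda>x. \<phi> j x * inv_fourier \<psi> x))\<close>. The argument is a
  Schwartz function, in general without compact support, while \<open>represents\<close> describes u
  by an integral on test functions only. Cutoffs and the sequential continuity of u bridge this gap,
  and the integral against f converges absolutely because finite \<open>bmo\<close> norm makes f
  integrable against (1 + |x|)^(-N-1). The exponent N + 1 leaves, against volumes of order 2^(kN)
  and averages growing like k + 1, the convergent series of (k + 1) 2^(-k).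

  The norm of a block is an infimum over representing functions, so the explicit convolution
  determines it only once representing functions are known to agree almost everywhere.

  In [0,\<infinity>] one has 0 * \<infinity> = 0, so the right-hand side may vanish with one factor
  infinite. If \<open>bmo_norm f = 0\<close>, then f = 0 almost everywhere and f does define a
  tempered distribution; if the Besov norm on the right is 0 and
  \<open>bmo_norm f = \<infinity>\<close>, all blocks vanish almost everywhere.\<close>

lemma partial_deriv_has_derivative:
  fixes f :: "real^'n::finite \<Rightarrow> 'b::real_normed_vector"
  assumes "(f has_derivative f') (at x)"
  shows "partial_deriv i f x = f' (axis i 1)"
proof -
  have lin: "linear f'" using assms has_derivative_linear by blast
  have 1: "((\<lambda>t::real. x + t *\<^sub>R axis i 1) has_derivative (\<lambda>t. t *\<^sub>R axis i 1)) (at 0)"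
    by (auto intro!: derivative_eq_intros)
  have "(f has_derivative f') (at (x + (0::real) *\<^sub>R axis i 1))" using assms by simp
  from has_derivative_compose[OF 1 this]
  have "((\<lambda>t. f (x + t *\<^sub>R axis i 1)) has_vector_derivative f' (axis i 1)) (at 0)"
    unfolding has_vector_derivative_def by (simp add: linear_scale[OF lin])
  thus ?thesis unfolding partial_deriv_def by (rule vector_derivative_at)
qed

lemma Dpart_append: "Dpart (\<alpha> @ \<beta>) f = Dpart \<alpha> (Dpart \<beta> f)"
  by (induction \<alpha>) auto

lemma smooth_differentiable: "smooth f \<Longrightarrow> f differentiable (at x)"
  unfolding smooth_def differentiable_on_def by (metis Dpart.simps(1) UNIV_I)

lemma smooth_Dpart: "smooth f \<Longrightarrow> smooth (Dpart \<alpha> f)"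
  unfolding smooth_def by (metis Dpart_append)

lemma smooth_partial_deriv: "smooth f \<Longrightarrow> smooth (partial_deriv i f)"
  using smooth_Dpart[of f "[i]"] by simp

lemma smooth_continuous_on:
  fixes f :: "real^'n::finite \<Rightarrow> 'b::real_normed_vector"
  shows "smooth f \<Longrightarrow> continuous_on A f"
  by (meson continuous_at_imp_continuous_on differentiable_imp_continuous_within smooth_differentiable)

text \<open>
  Smoothness is proved coinductively: a set of differentiable functions that is closed under
  partial derivatives consists of smooth functions. Families instead of single functions give
  bounds that are uniform in the index.
\<close>

definition deriv_closed :: "('a \<Rightarrow> real^'n \<Rightarrow> 'b::real_normed_vector) set \<Rightarrow> bool" where
  "deriv_closed A \<longleftrightarrow> (\<forall>f\<in>A. (\<forall>n x. f n differentiable (at x)) \<and>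
     (\<forall>i. (\<lambda>n. partial_deriv i (f n)) \<in> A))"

lemma deriv_closed_Dpart:
  assumes "deriv_closed A" "f \<in> A"
  shows "(\<lambda>n. Dpart \<alpha> (f n)) \<in> A"
  using assms by (induction \<alpha>) (auto simp: deriv_closed_def)

lemma deriv_closed_smooth:
  assumes "deriv_closed A" "f \<in> A"
  shows "smooth (f n)"
proof -
  have "Dpart \<alpha> (f n) differentiable (at x)" for \<alpha> x
    using bspec[OF assms(1)[unfolded deriv_closed_def] deriv_closed_Dpart[OF assms, of \<alpha>]] by blast
  then show ?thesis unfolding smooth_def differentiable_on_def by blast
qed

text \<open>The product rule turns one product into a sum of two, so finite sums of products are
  what stays closed under derivatives. Induction over this set replaces the Leibniz formula for
  \<open>Dpart \<alpha>\<close> with its coefficients.\<close>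

inductive_set sum_of_products ::
    "('a \<Rightarrow> real^'n \<Rightarrow> 'b::real_normed_algebra) set \<Rightarrow> ('a \<Rightarrow> real^'n \<Rightarrow> 'b) set \<Rightarrow> ('a \<Rightarrow> real^'n \<Rightarrow> 'b) set"
  for A B where
  prod: "f \<in> A \<Longrightarrow> g \<in> B \<Longrightarrow> (\<lambda>n x. f n x * g n x) \<in> sum_of_products A B"
| add: "f \<in> sum_of_products A B \<Longrightarrow> g \<in> sum_of_products A B \<Longrightarrow>
    (\<lambda>n x. f n x + g n x) \<in> sum_of_products A B"

lemma partial_deriv_mult:
  fixes f g :: "real^'n::finite \<Rightarrow> 'b::real_normed_algebra"
  assumes "f differentiable (at x)" "g differentiable (at x)"
  shows "partial_deriv i (\<lambda>x. f x * g x) x = partial_deriv i f x * g x + f x * partial_deriv i g x"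
proof -
  obtain f' g' where d: "(f has_derivative f') (at x)" "(g has_derivative g') (at x)"
    using assms unfolding differentiable_def by blast
  show ?thesis
    using partial_deriv_has_derivative[OF d(1)] partial_deriv_has_derivative[OF d(2)]
      partial_deriv_has_derivative[OF has_derivative_mult[OF d]] by (simp add: add.commute)
qed

lemma partial_deriv_add:
  fixes f g :: "real^'n::finite \<Rightarrow> 'b::real_normed_vector"
  assumes "f differentiable (at x)" "g differentiable (at x)"
  shows "partial_deriv i (\<lambda>x. f x + g x) x = partial_deriv i f x + partial_deriv i g x"
proof -
  obtain f' g' where d: "(f has_derivative f') (at x)" "(g has_derivative g') (at x)"
    using assms unfolding differentiable_def by blast
  show ?thesis
    using partial_deriv_has_derivative[OF d(1)] partial_deriv_has_derivative[OF d(2)]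
      partial_deriv_has_derivative[OF has_derivative_add[OF d]] by simp
qed

lemma deriv_closed_sum_of_products:
  fixes A B :: "('a \<Rightarrow> real^'n::finite \<Rightarrow> 'b::real_normed_algebra) set"
  assumes A: "deriv_closed A" and B: "deriv_closed B"
  shows "deriv_closed (sum_of_products A B)"
proof -
  have "(\<forall>n x. h n differentiable (at x)) \<and> (\<forall>i. (\<lambda>n. partial_deriv i (h n)) \<in> sum_of_products A B)"
    if "h \<in> sum_of_products A B" for h
    using that
  proof induction
    case (prod f g)
    have d: "f n differentiable (at x)" "g n differentiable (at x)" for n x
      using prod A B unfolding deriv_closed_def by auto
    have "(\<lambda>n. partial_deriv i (\<lambda>x. f n x * g n x)) =
       (\<lambda>n x. partial_deriv i (f n) x * g n x + f n x * partial_deriv i (g n) x)" for i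
      by (intro ext partial_deriv_mult d)
    moreover have "(\<lambda>n. partial_deriv i (f n)) \<in> A" "(\<lambda>n. partial_deriv i (g n)) \<in> B" for i
      using prod A B unfolding deriv_closed_def by auto
    ultimately show ?case using prod d
      by (auto intro!: differentiable_mult sum_of_products.intros)
  next
    case (add f g)
    then have "(\<lambda>n. partial_deriv i (\<lambda>x. f n x + g n x)) =
       (\<lambda>n x. partial_deriv i (f n) x + partial_deriv i (g n) x)" for i
      by (intro ext partial_deriv_add) auto
    then show ?case using add by (auto intro!: differentiable_add sum_of_products.intros)
  qed
  then show ?thesis unfolding deriv_closed_def by blast
qed

text \<open>Families indexed by \<open>unit\<close> are single functions, so the results on families
  specialise to plain smoothness.\<close>

lemma deriv_closed_smooth_set: "deriv_closed {f::unit \<Rightarrow> real^'n::finite \<Rightarrow> 'b::real_normed_vector. smooth (f ())}"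
  unfolding deriv_closed_def by (auto intro: smooth_differentiable smooth_partial_deriv)

lemma smooth_mult:
  fixes f g :: "real^'n::finite \<Rightarrow> 'b::real_normed_algebra"
  assumes "smooth f" "smooth g"
  shows "smooth (\<lambda>x. f x * g x)"
proof -
  have "(\<lambda>(_::unit) x. f x * g x) \<in> sum_of_products {f. smooth (f ())} {f. smooth (f ())}"
    using assms by (intro sum_of_products.intros) auto
  from deriv_closed_smooth[OF deriv_closed_sum_of_products[OF deriv_closed_smooth_set deriv_closed_smooth_set] this]
  show ?thesis .
qed

lemma smooth_bounded_linear:
  fixes f :: "real^'n::finite \<Rightarrow> 'b::real_normed_vector" and h :: "'b \<Rightarrow> 'c::real_normed_vector"
  assumes "bounded_linear h" "smooth f"
  shows "smooth (\<lambda>x. h (f x))" "partial_deriv i (\<lambda>x. h (f x)) = (\<lambda>x. h (partial_deriv i f x))"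
proof -
  have D: "((\<lambda>x. h (g x)) has_derivative (\<lambda>v. h (g' v))) (at x)" if "(g has_derivative g') (at x)"
    for g :: "real^'n \<Rightarrow> 'b" and g' x using bounded_linear.has_derivative[OF assms(1) that] .
  have P: "partial_deriv i (\<lambda>x. h (g x)) = (\<lambda>x. h (partial_deriv i g x))" if "smooth g" for g :: "real^'n \<Rightarrow> 'b" and i
  proof
    fix x
    obtain g' where g': "(g has_derivative g') (at x)"
      using smooth_differentiable[OF \<open>smooth g\<close>] unfolding differentiable_def by blast
    from partial_deriv_has_derivative[OF g'] partial_deriv_has_derivative[OF D[OF g']]
    show "partial_deriv i (\<lambda>x. h (g x)) x = h (partial_deriv i g x)" by simp
  qed
  let ?A = "{\<lambda>(_::unit) x. h (g x) | g :: real^'n \<Rightarrow> 'b. smooth g}"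
  have "(\<lambda>x. h (g x)) differentiable at x" if "smooth g" for g :: "real^'n \<Rightarrow> 'b" and x
    using smooth_differentiable[OF that, of x] D unfolding differentiable_def by blast
  then have "deriv_closed ?A"
    unfolding deriv_closed_def using P by (auto intro: smooth_partial_deriv)
  from deriv_closed_smooth[OF this, of "\<lambda>_ x. h (f x)"] show "smooth (\<lambda>x. h (f x))" using assms(2) by auto
  show "partial_deriv i (\<lambda>x. h (f x)) = (\<lambda>x. h (partial_deriv i f x))" using P assms(2) by blast
qed

lemma partial_deriv_const: "partial_deriv i (\<lambda>_. c) = (\<lambda>_. 0)"
  unfolding partial_deriv_def by (auto intro!: ext vector_derivative_at)

lemma smooth_const: "smooth (\<lambda>_::real^'n::finite. c::'b::real_normed_vector)"
proof -
  have "deriv_closed {\<lambda>(_::unit) (_::real^'n). d | d::'b. True}"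
    unfolding deriv_closed_def by (auto simp: partial_deriv_const)
  from deriv_closed_smooth[OF this, of "\<lambda>_ _. c"] show ?thesis by auto
qed

lemma partial_deriv_coordinate:
  "partial_deriv k (\<lambda>x::real^'n::finite. complex_of_real (x $ i)) = (\<lambda>_. if i = k then 1 else 0)"
proof
  fix x :: "real^'n"
  have "((\<lambda>x::real^'n. complex_of_real (x $ i)) has_derivative (\<lambda>x. complex_of_real (x $ i))) (at x)"
    by (intro bounded_linear_imp_has_derivative bounded_linear_compose[OF bounded_linear_of_real] bounded_linear_vec_nth)
  from partial_deriv_has_derivative[OF this]
  show "partial_deriv k (\<lambda>x. complex_of_real (x $ i)) x = (if i = k then 1 else 0)"
    by (auto simp: axis_def)
qed

lemma smooth_coordinate: "smooth (\<lambda>x::real^'n::finite. complex_of_real (x $ i))"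
proof -
  let ?A = "insert (\<lambda>_. \<lambda>x::real^'n. complex_of_real (x $ i)) {\<lambda>(_::unit) _. d | d. True}"
  have "(\<lambda>x::real^'n. complex_of_real (x $ i)) differentiable (at x)" for x
    unfolding differentiable_def
    by (rule exI[where x = "\<lambda>x. complex_of_real (x $ i)"], intro bounded_linear_imp_has_derivative bounded_linear_compose[OF bounded_linear_of_real] bounded_linear_vec_nth)
  then have "deriv_closed ?A"
    unfolding deriv_closed_def by (auto simp: partial_deriv_const partial_deriv_coordinate)
  from deriv_closed_smooth[OF this, of "\<lambda>_ x. complex_of_real (x $ i)"] show ?thesis by auto
qed

lemma smooth_add:
  fixes f g :: "real^'n::finite \<Rightarrow> 'b::real_normed_vector"
  assumes "smooth f" "smooth g"
  shows "smooth (\<lambda>x. f x + g x)"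
proof -
  have "partial_deriv i (\<lambda>x. a x + b x) = (\<lambda>x. partial_deriv i a x + partial_deriv i b x)"
    if "smooth a" "smooth b" for a b :: "real^'n \<Rightarrow> 'b" and i
    using that by (intro ext partial_deriv_add smooth_differentiable)
  note pd = this
  have "deriv_closed {\<lambda>(_::unit) x. a x + b x | a b :: real^'n \<Rightarrow> 'b. smooth a \<and> smooth b}"
    unfolding deriv_closed_def
  proof safe
    fix a b :: "real^'n \<Rightarrow> 'b" and i
    assume ab: "smooth a" "smooth b"
    show "(\<lambda>x. a x + b x) differentiable (at x)" for x
      by (intro differentiable_add smooth_differentiable ab)
    show "\<exists>a' b'. (\<lambda>_. partial_deriv i (\<lambda>x. a x + b x)) = (\<lambda>_ x. a' x + b' x) \<and> smooth a' \<and> smooth b'"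
      using pd[OF ab] smooth_partial_deriv[OF ab(1), of i] smooth_partial_deriv[OF ab(2), of i] by auto
  qed
  from deriv_closed_smooth[OF this, of "\<lambda>_ x. f x + g x"] show ?thesis using assms by auto
qed

lemma partial_deriv_affine:
  fixes f :: "real^'n::finite \<Rightarrow> 'b::real_normed_vector"
  assumes "smooth f"
  shows "(\<lambda>x. f (b + a *\<^sub>R x)) differentiable (at x)"
    and "partial_deriv i (\<lambda>x. f (b + a *\<^sub>R x)) = (\<lambda>x. a *\<^sub>R partial_deriv i f (b + a *\<^sub>R x))"
proof -
  have D: "((\<lambda>x. f (b + a *\<^sub>R x)) has_derivative (\<lambda>v. f' (a *\<^sub>R v))) (at x)"
    if "(f has_derivative f') (at (b + a *\<^sub>R x))" for f' x
    by (rule has_derivative_compose[where f = "\<lambda>x. b + a *\<^sub>R x", OF _ that]) (auto intro!: derivative_eq_intros)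
  show "(\<lambda>x. f (b + a *\<^sub>R x)) differentiable (at x)"
    using smooth_differentiable[OF assms] D unfolding differentiable_def by blast
  show "partial_deriv i (\<lambda>x. f (b + a *\<^sub>R x)) = (\<lambda>x. a *\<^sub>R partial_deriv i f (b + a *\<^sub>R x))"
  proof
    fix x
    obtain f' where f': "(f has_derivative f') (at (b + a *\<^sub>R x))"
      using smooth_differentiable[OF assms] unfolding differentiable_def by blast
    show "partial_deriv i (\<lambda>x. f (b + a *\<^sub>R x)) x = a *\<^sub>R partial_deriv i f (b + a *\<^sub>R x)"
      using partial_deriv_has_derivative[OF f'] partial_deriv_has_derivative[OF D[OF f']]
        linear_scale[OF has_derivative_linear[OF f']] by simp
  qed
qed

lemma smooth_scaleR:
  fixes f :: "real^'n::finite \<Rightarrow> 'b::real_normed_vector"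
  shows "smooth f \<Longrightarrow> smooth (\<lambda>x. c *\<^sub>R f x)"
    and "smooth f \<Longrightarrow> partial_deriv i (\<lambda>x. c *\<^sub>R f x) = (\<lambda>x. c *\<^sub>R partial_deriv i f x)"
  using smooth_bounded_linear[OF bounded_linear_scaleR_right[of c]] by auto

lemma Dpart_affine:
  fixes f :: "real^'n::finite \<Rightarrow> 'b::real_normed_vector"
  assumes "smooth f"
  shows "Dpart \<alpha> (\<lambda>x. f (b + a *\<^sub>R x)) = (\<lambda>x. a ^ length \<alpha> *\<^sub>R Dpart \<alpha> f (b + a *\<^sub>R x))"
proof (induction \<alpha>)
  case (Cons i \<alpha>)
  have s: "smooth (\<lambda>x. a ^ length \<alpha> *\<^sub>R Dpart \<alpha> f x)"
    using smooth_scaleR smooth_Dpart assms by blast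
  show ?case
    using partial_deriv_affine(2)[OF s, of i b a] Cons smooth_scaleR(2)[OF smooth_Dpart[OF assms]]
    by (simp add: mult_ac)
qed simp

text \<open>Every derivative is a multiple of an affine substitution in a derivative of f. This one
  statement serves the dilated cutoffs, the reflection relating \<open>inv_fourier\<close> to
  \<open>fourier\<close>, and the reflected dilates used for mollification.\<close>

lemma smooth_affine:
  fixes f :: "real^'n::finite \<Rightarrow> 'b::real_normed_vector"
  assumes "smooth f"
  shows "smooth (\<lambda>x. f (b + a *\<^sub>R x))"
proof -
  have "smooth (\<lambda>x. a ^ length \<alpha> *\<^sub>R Dpart \<alpha> f x)" for \<alpha>
    using smooth_scaleR smooth_Dpart assms by blast
  from partial_deriv_affine(1)[OF this] show ?thesis
    unfolding smooth_def Dpart_affine[OF assms] differentiable_on_def by auto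
qed


section \<open>Test functions and Schwartz functions\<close>


text \<open>Compactness of \<open>supp\<close> amounts to boundedness of the set of nonzeros, since
  the support is closed and the space finite-dimensional. In this form membership passes directly to
  products, dilates and translates.\<close>

lemma test_functions_iff:
  fixes \<psi> :: "real^'n::finite \<Rightarrow> complex"
  shows "\<psi> \<in> test_functions \<longleftrightarrow> smooth \<psi> \<and> (\<exists>R. \<forall>x. norm x > R \<longrightarrow> \<psi> x = 0)"
proof -
  have "compact (supp \<psi>) \<longleftrightarrow> bounded {x. \<psi> x \<noteq> 0}"
    unfolding supp_def compact_eq_bounded_closed
    by (meson bounded_closure bounded_subset closed_closure closure_subset)
  also have "\<dots> \<longleftrightarrow> (\<exists>R. \<forall>x. norm x > R \<longrightarrow> \<psi> x = 0)"
    unfolding bounded_iff by (metis (mono_tags, lifting) linorder_not_le mem_Collect_eq)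
  finally have "compact (supp \<psi>) \<longleftrightarrow> (\<exists>R. \<forall>x. norm x > R \<longrightarrow> \<psi> x = 0)" .
  then show ?thesis unfolding test_functions_def by blast
qed

lemma test_functionsE:
  fixes \<psi> :: "real^'n::finite \<Rightarrow> complex"
  assumes "\<psi> \<in> test_functions"
  obtains R where "R > 0" "\<And>x. norm x > R \<Longrightarrow> \<psi> x = 0"
proof -
  obtain R where "\<And>x. norm x > R \<Longrightarrow> \<psi> x = 0" using assms test_functions_iff by blast
  then show ?thesis using that[of "max R 1"] by auto
qed

lemma test_functions_smooth: "\<psi> \<in> test_functions \<Longrightarrow> smooth \<psi>"
  by (simp add: test_functions_def)

lemma test_functions_mult:
  fixes \<psi> :: "real^'n::finite \<Rightarrow> complex"
  assumes "\<psi> \<in> test_functions" "smooth g"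
  shows "(\<lambda>x. \<psi> x * g x) \<in> test_functions" "(\<lambda>x. g x * \<psi> x) \<in> test_functions"
  using assms smooth_mult[of \<psi> g] smooth_mult[of g \<psi>] unfolding test_functions_iff by fastforce+

lemma partial_deriv_eq_0:
  fixes f :: "real^'n::finite \<Rightarrow> 'b::real_normed_vector"
  assumes "open U" "x \<in> U" "\<And>y. y \<in> U \<Longrightarrow> f y = 0"
  shows "partial_deriv i f x = 0"
proof -
  have "(f has_derivative (\<lambda>_. 0)) (at x)"
    by (rule has_derivative_transform_within_open[OF has_derivative_const[of 0] assms(1,2)]) (use assms in auto)
  from partial_deriv_has_derivative[OF this] show ?thesis by simp
qed

lemma Dpart_eq_0:
  fixes f :: "real^'n::finite \<Rightarrow> 'b::real_normed_vector"
  assumes "open U" "x \<in> U" "\<And>y. y \<in> U \<Longrightarrow> f y = 0"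
  shows "Dpart \<alpha> f x = 0"
  using assms by (induction \<alpha> arbitrary: x) (auto intro: partial_deriv_eq_0)

lemma test_functions_Dpart:
  fixes \<psi> :: "real^'n::finite \<Rightarrow> complex"
  assumes "\<psi> \<in> test_functions"
  shows "Dpart \<alpha> \<psi> \<in> test_functions"
proof -
  obtain R where R: "\<And>x. norm x > R \<Longrightarrow> \<psi> x = 0" using assms test_functions_iff by blast
  have "open {x::real^'n. norm x > R}" by (intro open_Collect_less continuous_intros)
  from Dpart_eq_0[OF this] R have "\<forall>x. norm x > R \<longrightarrow> Dpart \<alpha> \<psi> x = 0" by auto
  then show ?thesis using assms smooth_Dpart unfolding test_functions_iff by blast
qed

lemma test_functions_partial_deriv:
  fixes \<psi> :: "real^'n::finite \<Rightarrow> complex"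
  shows "\<psi> \<in> test_functions \<Longrightarrow> partial_deriv i \<psi> \<in> test_functions"
  using test_functions_Dpart[of \<psi> "[i]"] by simp

lemma test_functions_bounded:
  fixes \<psi> :: "real^'n::finite \<Rightarrow> complex"
  assumes "\<psi> \<in> test_functions" "continuous_on UNIV g"
  shows "\<exists>B>0. \<forall>x. norm (g x *\<^sub>R \<psi> x) \<le> B"
proof -
  obtain R where R: "R > 0" "\<And>x. norm x > R \<Longrightarrow> \<psi> x = 0" using assms test_functionsE by blast
  have "compact ((\<lambda>x. g x *\<^sub>R \<psi> x) ` cball 0 R)"
    using smooth_continuous_on[OF test_functions_smooth[OF assms(1)]] continuous_on_subset[OF assms(2)]
    by (intro compact_continuous_image continuous_intros) auto
  then obtain B where "B > 0" "\<forall>y \<in> (\<lambda>x. g x *\<^sub>R \<psi> x) ` cball 0 R. norm y \<le> B"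
    using compact_imp_bounded bounded_pos by metis
  then have "norm (g x *\<^sub>R \<psi> x) \<le> B" for x using R(2)[of x] by (cases "norm x \<le> R") auto
  then show ?thesis using \<open>B > 0\<close> by blast
qed

lemma integrable_test_function:
  fixes \<psi> :: "real^'n::finite \<Rightarrow> complex" and g :: "real^'n \<Rightarrow> complex"
  assumes "\<psi> \<in> test_functions" "continuous_on UNIV g"
  shows "integrable lborel (\<lambda>x. g x * \<psi> x)"
proof -
  obtain R where R: "R > 0" "\<And>x. norm x > R \<Longrightarrow> \<psi> x = 0" using assms test_functionsE by blast
  have "integrable lborel (\<lambda>x. indicator (cball 0 R) x *\<^sub>R (g x * \<psi> x))"
    using smooth_continuous_on[OF test_functions_smooth[OF assms(1)]] continuous_on_subset[OF assms(2)]
    by (intro borel_integrable_compact continuous_intros) auto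
  moreover have "indicator (cball 0 R) x *\<^sub>R (g x * \<psi> x) = g x * \<psi> x" for x
    using R(2)[of x] by (auto simp: indicator_def)
  ultimately show ?thesis by simp
qed

lemma test_functions_subset_schwartz: "\<psi> \<in> test_functions \<Longrightarrow> \<psi> \<in> schwartz"
  for \<psi> :: "real^'n::finite \<Rightarrow> complex"
proof -
  assume \<psi>: "\<psi> \<in> test_functions"
  have "bounded (range (\<lambda>x. (1 + norm x) ^ k *\<^sub>R Dpart \<alpha> \<psi> x))" for k \<alpha>
  proof -
    have "continuous_on UNIV (\<lambda>x::real^'n. (1 + norm x) ^ k)" by (intro continuous_intros)
    from test_functions_bounded[OF test_functions_Dpart[OF \<psi>, of \<alpha>] this]
    show ?thesis unfolding bounded_iff by auto
  qed
  then show ?thesis using \<psi> unfolding schwartz_def test_functions_def by auto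
qed

lemma schwartz_smooth: "\<psi> \<in> schwartz \<Longrightarrow> smooth \<psi>"
  by (simp add: schwartz_def)

lemma schwartz_partial_deriv:
  assumes "\<psi> \<in> schwartz" shows "partial_deriv i \<psi> \<in> schwartz"
proof -
  have "Dpart \<alpha> (partial_deriv i \<psi>) = Dpart (\<alpha> @ [i]) \<psi>" for \<alpha> by (simp add: Dpart_append)
  then show ?thesis using assms smooth_partial_deriv unfolding schwartz_def by auto
qed

lemma schwartz_bound:
  fixes \<psi> :: "real^'n::finite \<Rightarrow> complex"
  assumes "\<psi> \<in> schwartz" obtains B where "B > 0" "\<And>x. (1 + norm x) ^ k * norm (\<psi> x) \<le> B"
proof -
  have "bounded (range (\<lambda>x. (1 + norm x) ^ k *\<^sub>R Dpart [] \<psi> x))" using assms unfolding schwartz_def by blast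
  then obtain B where "B > 0" "\<And>x. norm ((1 + norm x) ^ k *\<^sub>R \<psi> x) \<le> B"
    unfolding bounded_pos by auto
  then show ?thesis using that[of B] by simp
qed

section \<open>Approximation of Schwartz functions by cutoffs\<close>

lemma Dpart_add:
  fixes f g :: "real^'n::finite \<Rightarrow> 'b::real_normed_vector"
  assumes "smooth f" "smooth g"
  shows "Dpart \<alpha> (\<lambda>x. f x + g x) = (\<lambda>x. Dpart \<alpha> f x + Dpart \<alpha> g x)"
  using assms
  by (induction \<alpha>) (auto intro!: ext partial_deriv_add smooth_differentiable smooth_Dpart)

text \<open>The intended \<eta> is \<kappa> - 1 for a cutoff \<kappa> equal to 1 near the origin.
  Vanishing on the unit ball gives |\<eta>(y)| \<le> K |y|, hence |\<eta>(x/n)| \<le> K |x| / n: one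
  power of the weight buys the factor 1/n. Derivatives falling on the dilate bring further powers of
  1/n and keep this structure.\<close>

lemma cutoff_error_bound:
  fixes \<eta> \<psi> :: "real^'n::finite \<Rightarrow> complex"
  assumes \<eta>: "smooth \<eta>" "\<And>\<alpha>. bounded (range (Dpart \<alpha> \<eta>))" "\<And>x. norm x < 1 \<Longrightarrow> \<eta> x = 0"
    and \<psi>: "\<psi> \<in> schwartz"
  shows "\<exists>C. \<forall>n x. (1 + norm x) ^ k *
    norm (Dpart \<alpha> (\<lambda>x. \<eta> ((1 / Suc n) *\<^sub>R x) * \<psi> x) x) \<le> C / Suc n"
proof -
  \<comment> \<open>Vanishing on the ball is part of the class, so that derivatives of \<eta> obey
    the same linear bound as \<eta> itself.\<close>
  define E where "E = {\<eta>::real^'n \<Rightarrow> complex. smooth \<eta> \<and> (\<forall>\<alpha>. bounded (range (Dpart \<alpha> \<eta>))) \<and>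
    (\<forall>x. norm x < 1 \<longrightarrow> \<eta> x = 0)}"
  have E_pd: "partial_deriv i \<eta> \<in> E" if "\<eta> \<in> E" for \<eta> i
  proof -
    have "Dpart \<alpha> (partial_deriv i \<eta>) = Dpart (\<alpha> @ [i]) \<eta>" for \<alpha> by (simp add: Dpart_append)
    moreover have "partial_deriv i \<eta> x = 0" if "norm x < 1" for x
      using \<open>\<eta> \<in> E\<close> that by (intro partial_deriv_eq_0[of "ball 0 1"]) (auto simp: E_def)
    ultimately show ?thesis using that smooth_partial_deriv unfolding E_def by auto
  qed
  \<comment> \<open>The exponent m counts the derivatives that fell on the dilate; the estimate
    below uses (1 / Suc n) ^ m \<le> 1.\<close>
  define A where "A = {\<lambda>n x. (1 / Suc n) ^ m *\<^sub>R \<eta> ((1 / Suc n) *\<^sub>R x) | m \<eta>. \<eta> \<in> E}"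
  define B where "B = {\<lambda>(n::nat). \<psi> | \<psi>. \<psi> \<in> (schwartz :: (real^'n \<Rightarrow> complex) set)}"
  have A: "deriv_closed A"
    unfolding deriv_closed_def
  proof safe
    fix f i n x assume "f \<in> A"
    then obtain m \<eta> where f: "f = (\<lambda>n x. (1 / Suc n) ^ m *\<^sub>R \<eta> ((1 / Suc n) *\<^sub>R x))" and "\<eta> \<in> E"
      unfolding A_def by blast
    then have s: "smooth \<eta>" "smooth (\<lambda>x. \<eta> ((1 / Suc n) *\<^sub>R x))" for n
      using smooth_affine[of \<eta> 0] by (auto simp: E_def)
    show "f n differentiable (at x)"
      unfolding f by (intro smooth_differentiable smooth_scaleR s)
    have "(\<lambda>n. partial_deriv i (f n)) = (\<lambda>n x. (1 / Suc n) ^ Suc m *\<^sub>R partial_deriv i \<eta> ((1 / Suc n) *\<^sub>R x))"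
      unfolding f using partial_deriv_affine(2)[OF s(1), of i 0] smooth_scaleR(2)[OF s(2)]
      by (auto simp: mult.commute)
    then show "(\<lambda>n. partial_deriv i (f n)) \<in> A" unfolding A_def using E_pd[OF \<open>\<eta> \<in> E\<close>] by blast
  qed
  have B: "deriv_closed B"
    unfolding deriv_closed_def B_def
    by (auto intro: smooth_differentiable schwartz_smooth schwartz_partial_deriv)
  have bound: "\<exists>C. \<forall>n x. (1 + norm x) ^ k * norm (h n x) \<le> C / Suc n" if "h \<in> sum_of_products A B" for h
    using that
  proof induction
    case (prod f g)
    obtain m \<eta> where f: "f = (\<lambda>n x. (1 / Suc n) ^ m *\<^sub>R \<eta> ((1 / Suc n) *\<^sub>R x))" and \<eta>: "\<eta> \<in> E"
      using prod(1) unfolding A_def by blast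
    obtain \<psi> where g: "g = (\<lambda>n. \<psi>)" and \<psi>: "\<psi> \<in> schwartz" using prod(2) unfolding B_def by blast
    have "bounded (range (Dpart [] \<eta>))" using \<eta> unfolding E_def by blast
    then obtain K where K: "K > 0" "\<And>x. norm (\<eta> x) \<le> K" unfolding bounded_pos by auto
    have K': "norm (\<eta> x) \<le> K * norm x" for x
    proof (cases "norm x < 1")
      case True then show ?thesis using \<eta> K by (auto simp: E_def)
    next
      case False then have "K * 1 \<le> K * norm x" using K by (intro mult_left_mono) auto
      then show ?thesis using K(2)[of x] by linarith
    qed
    \<comment> \<open>Exponent \<open>Suc k\<close>: the additional power of 1 + |x| pays for the
      |x| / Suc n coming from the cutoff.\<close>
    obtain D where D: "D > 0" "\<And>x. (1 + norm x) ^ Suc k * norm (\<psi> x) \<le> D" using schwartz_bound[OF \<psi>] by blast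
    have "(1 + norm x) ^ k * norm (f n x * g n x) \<le> (K * D) / Suc n" for n x
    proof -
      have "norm (f n x) \<le> norm (\<eta> ((1 / Suc n) *\<^sub>R x))"
        unfolding f by (auto intro!: mult_left_le_one_le power_le_one)
      also have "\<dots> \<le> K * (norm x / Suc n)" using K'[of "(1 / Suc n) *\<^sub>R x"] by simp
      finally have 1: "norm (f n x) \<le> K * (norm x / Suc n)" .
      have "(1 + norm x) ^ k * norm (f n x * g n x) = (1 + norm x) ^ k * norm (\<psi> x) * norm (f n x)"
        by (simp add: g norm_mult)
      also have "\<dots> \<le> (1 + norm x) ^ k * norm (\<psi> x) * (K * ((1 + norm x) / Suc n))"
        using K by (intro mult_left_mono order_trans[OF 1] divide_right_mono) auto
      also have "\<dots> = K / Suc n * ((1 + norm x) ^ Suc k * norm (\<psi> x))" by simp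
      also have "\<dots> \<le> K / Suc n * D" using D K by (intro mult_left_mono) auto
      finally show ?thesis by simp
    qed
    then show ?case by blast
  next
    case (add f g)
    then obtain C1 C2 where C: "\<forall>n x. (1 + norm x) ^ k * norm (f n x) \<le> C1 / Suc n"
      "\<forall>n x. (1 + norm x) ^ k * norm (g n x) \<le> C2 / Suc n" by blast
    have "(1 + norm x) ^ k * norm (f n x + g n x) \<le> (C1 + C2) / Suc n" for n x
    proof -
      have "(1 + norm x) ^ k * norm (f n x + g n x) \<le> (1 + norm x) ^ k * (norm (f n x) + norm (g n x))"
        by (intro mult_left_mono norm_triangle_ineq) auto
      also have "\<dots> \<le> C1 / Suc n + C2 / Suc n" using C by (auto simp: distrib_left intro!: add_mono)
      finally show ?thesis by (simp add: add_divide_distrib)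
    qed
    then show ?case by blast
  qed
  have "(\<lambda>n x. (1 / Suc n) ^ 0 *\<^sub>R \<eta> ((1 / Suc n) *\<^sub>R x)) \<in> A"
    unfolding A_def using \<eta> by (intro CollectI exI conjI) (rule refl, simp add: E_def)
  moreover have "(\<lambda>n. \<psi>) \<in> B" unfolding B_def using \<psi> by blast
  ultimately have "(\<lambda>n x. (1 / Suc n) ^ 0 *\<^sub>R \<eta> ((1 / Suc n) *\<^sub>R x) * \<psi> x) \<in> sum_of_products A B"
    by (rule sum_of_products.prod)
  from bound[OF deriv_closed_Dpart[OF deriv_closed_sum_of_products[OF A B] this], of \<alpha>]
  show ?thesis by simp
qed

text \<open>The difference is (\<kappa>(x/n) - 1) \<psi>(x), whose seminorms are O(1/n). This is the
  density of test functions through which information on test functions reaches all Schwartz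
  functions.\<close>

lemma cutoff_schwartz_tendsto:
  fixes \<kappa> \<psi> :: "real^'n::finite \<Rightarrow> complex"
  assumes \<kappa>: "\<kappa> \<in> test_functions" "\<And>x. norm x < 1 \<Longrightarrow> \<kappa> x = 1" and \<psi>: "\<psi> \<in> schwartz"
  shows "schwartz_tendsto (\<lambda>n x. \<kappa> ((1 / Suc n) *\<^sub>R x) * \<psi> x) \<psi>"
  unfolding schwartz_tendsto_def
proof (intro allI)
  fix k \<alpha>
  \<comment> \<open>Written as a sum with the constant -1, so that \<open>smooth_add\<close> and
    \<open>Dpart_add\<close> apply.\<close>
  define \<eta> where "\<eta> = (\<lambda>x. \<kappa> x + (-1))"
  have s: "smooth \<kappa>" using \<kappa> test_functions_smooth by blast
  have \<eta>s: "smooth \<eta>" unfolding \<eta>_def by (intro smooth_add smooth_const s)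
  have Dm: "Dpart \<alpha> (\<lambda>_::real^'n. -1::complex) = (\<lambda>_. if \<alpha> = [] then -1 else 0)" for \<alpha>
    by (induction \<alpha>) (auto simp: partial_deriv_const)
  have "bounded (range (Dpart \<alpha> \<eta>))" for \<alpha>
  proof -
    obtain B where B: "\<forall>x. norm (Dpart \<alpha> \<kappa> x) \<le> B"
      using test_functions_bounded[OF test_functions_Dpart[OF \<kappa>(1), of \<alpha>], of "\<lambda>_. 1"] by auto
    have "norm (Dpart \<alpha> \<eta> x) \<le> B + 1" for x
    proof -
      have "Dpart \<alpha> \<eta> x = Dpart \<alpha> \<kappa> x + Dpart \<alpha> (\<lambda>_. -1) x"
        unfolding \<eta>_def Dpart_add[OF s smooth_const] ..
      also have "norm \<dots> \<le> B + 1"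
        unfolding Dm using B by (intro order_trans[OF norm_triangle_ineq] add_mono) auto
      finally show ?thesis .
    qed
    then show ?thesis unfolding bounded_iff by auto
  qed
  from cutoff_error_bound[OF \<eta>s this _ \<psi>, of k \<alpha>]
  obtain C where C: "\<And>n x. (1 + norm x) ^ k * norm (Dpart \<alpha> (\<lambda>x. \<eta> ((1 / Suc n) *\<^sub>R x) * \<psi> x) x) \<le> C / Suc n"
    using \<kappa>(2) unfolding \<eta>_def by auto
  have \<eta>n: "smooth (\<lambda>x. \<eta> ((1 / Suc n) *\<^sub>R x) * \<psi> x)" for n
    using smooth_mult[OF smooth_affine[OF \<eta>s, of 0 "1 / Suc n"] schwartz_smooth[OF \<psi>]] by simp
  have D: "Dpart \<alpha> (\<lambda>x. \<kappa> ((1 / Suc n) *\<^sub>R x) * \<psi> x) x - Dpart \<alpha> \<psi> x =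
      Dpart \<alpha> (\<lambda>x. \<eta> ((1 / Suc n) *\<^sub>R x) * \<psi> x) x" for n x
  proof -
    have "(\<lambda>x. \<kappa> ((1 / Suc n) *\<^sub>R x) * \<psi> x) = (\<lambda>x. \<eta> ((1 / Suc n) *\<^sub>R x) * \<psi> x + \<psi> x)"
      by (auto simp: \<eta>_def algebra_simps)
    then show ?thesis using Dpart_add[OF \<eta>n schwartz_smooth[OF \<psi>]] by simp
  qed
  show "uniform_limit UNIV (\<lambda>n x. (1 + norm x) ^ k *\<^sub>R Dpart \<alpha> (\<lambda>x. \<kappa> ((1 / Suc n) *\<^sub>R x) * \<psi> x) x)
               (\<lambda>x. (1 + norm x) ^ k *\<^sub>R Dpart \<alpha> \<psi> x) sequentially"
    unfolding uniform_limit_sequentially_iff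
  proof (intro allI impI)
    fix e :: real assume "e > 0"
    obtain M :: nat where M: "C / e < M" using reals_Archimedean2 by blast
    have "dist ((1 + norm x) ^ k *\<^sub>R Dpart \<alpha> (\<lambda>x. \<kappa> ((1 / Suc n) *\<^sub>R x) * \<psi> x) x)
        ((1 + norm x) ^ k *\<^sub>R Dpart \<alpha> \<psi> x) < e" if "n \<ge> M" for n x
    proof -
      have "dist ((1 + norm x) ^ k *\<^sub>R Dpart \<alpha> (\<lambda>x. \<kappa> ((1 / Suc n) *\<^sub>R x) * \<psi> x) x)
        ((1 + norm x) ^ k *\<^sub>R Dpart \<alpha> \<psi> x) \<le> C / Suc n"
        using C[of x n] D[of n x] by (simp add: dist_norm flip: scaleR_diff_right)
      also have "\<dots> < e"
      proof -
        have "C / e < Suc n" using M that by linarith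
        then show ?thesis using \<open>e > 0\<close> by (simp add: field_simps)
      qed
      finally show ?thesis .
    qed
    then show "\<exists>N. \<forall>n\<ge>N. \<forall>x\<in>UNIV. dist ((1 + norm x) ^ k *\<^sub>R Dpart \<alpha> (\<lambda>x. \<kappa> ((1 / Suc n) *\<^sub>R x) * \<psi> x) x)
        ((1 + norm x) ^ k *\<^sub>R Dpart \<alpha> \<psi> x) < e" by blast
  qed
qed


section \<open>Fourier transform of test functions\<close>


lemma lborel_integral_affine:
  fixes f :: "'a::euclidean_space \<Rightarrow> 'b::{banach, second_countable_topology}"
  assumes "c \<noteq> 0" "f \<in> borel_measurable borel"
  shows "(LINT x|lborel. f x) = \<bar>c\<bar> ^ DIM('a) *\<^sub>R (LINT x|lborel. f (t + c *\<^sub>R x))"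
    and "integrable lborel f \<Longrightarrow> integrable lborel (\<lambda>x. f (t + c *\<^sub>R x))"
proof -
  show "(LINT x|lborel. f x) = \<bar>c\<bar> ^ DIM('a) *\<^sub>R (LINT x|lborel. f (t + c *\<^sub>R x))"
    using assms by (subst lborel_affine[OF assms(1), of t]) (simp add: integral_density integral_distr)
  assume "integrable lborel f"
  then have "integrable (density (distr lborel borel (\<lambda>x. t + c *\<^sub>R x)) (\<lambda>x. ennreal (\<bar>c\<bar> ^ DIM('a)))) f"
    using lborel_affine[OF assms(1), of t] by simp
  then have "integrable lborel (\<lambda>x. \<bar>c\<bar> ^ DIM('a) *\<^sub>R f (t + c *\<^sub>R x))"
    using assms by (simp add: integrable_density integrable_distr_eq)
  then have "integrable lborel (\<lambda>x. (1 / \<bar>c\<bar> ^ DIM('a)) *\<^sub>R \<bar>c\<bar> ^ DIM('a) *\<^sub>R f (t + c *\<^sub>R x))"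
    by (rule integrable_scaleR_right)
  then show "integrable lborel (\<lambda>x. f (t + c *\<^sub>R x))" using assms by simp
qed

text \<open>Translation invariance makes the integral of every difference quotient vanish, and
  dominated convergence carries this to the derivative. The mean value inequality supplies the
  uniform bound on the quotients.\<close>

lemma integral_partial_deriv_eq_0:
  fixes g :: "real^'n::finite \<Rightarrow> complex"
  assumes g: "g \<in> test_functions"
  shows "(LINT x|lborel. partial_deriv i g x) = 0"
proof -
  let ?e = "axis i 1 :: real^'n"
  obtain R where R: "R > 0" "\<And>x. norm x > R \<Longrightarrow> g x = 0" using test_functionsE[OF g] by blast
  define t where "t n = 1 / real (Suc n)" for n
  define d where "d n x = (1 / t n) *\<^sub>R (g (x + t n *\<^sub>R ?e) - g x)" for n x
  have t: "t n > 0" "t n \<le> 1" for n unfolding t_def by auto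
  have hvd: "((\<lambda>s. g (x + s *\<^sub>R ?e)) has_vector_derivative partial_deriv i g (x + s *\<^sub>R ?e)) (at s)" for x s
  proof -
    obtain g' where g': "(g has_derivative g') (at (x + s *\<^sub>R ?e))"
      using smooth_differentiable[OF test_functions_smooth[OF g]] unfolding differentiable_def by blast
    have "((\<lambda>s. g (x + s *\<^sub>R ?e)) has_derivative (\<lambda>r. g' (r *\<^sub>R ?e))) (at s)"
      by (rule has_derivative_compose[where f = "\<lambda>s. x + s *\<^sub>R ?e", OF _ g']) (auto intro!: derivative_eq_intros)
    then show ?thesis
      unfolding has_vector_derivative_def partial_deriv_has_derivative[OF g']
      by (simp add: linear_scale[OF has_derivative_linear[OF g']])
  qed
  obtain B where B: "B > 0" "\<And>x. norm (partial_deriv i g x) \<le> B"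
    using test_functions_bounded[OF test_functions_partial_deriv[OF g], of "\<lambda>_. 1"] by auto
  have lim: "(\<lambda>n. d n x) \<longlonglongrightarrow> partial_deriv i g x" for x
  proof -
    have "((\<lambda>s. (1 / s) *\<^sub>R (g (x + s *\<^sub>R ?e) - g x)) \<longlongrightarrow> partial_deriv i g x) (at 0)"
    proof -
      have "((\<lambda>s. norm (g (x + s *\<^sub>R ?e) - g x - s *\<^sub>R partial_deriv i g x) / norm s) \<longlongrightarrow> 0) (at 0)"
        using hvd[of x 0] by (simp add: has_vector_derivative_def has_derivative_at)
      then have "((\<lambda>s. norm ((1 / s) *\<^sub>R (g (x + s *\<^sub>R ?e) - g x) - partial_deriv i g x)) \<longlongrightarrow> 0) (at 0)"
      proof (rule Lim_transform_eventually)
        have "norm (g (x + s *\<^sub>R ?e) - g x - s *\<^sub>R partial_deriv i g x) / norm s =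
          norm ((1 / s) *\<^sub>R (g (x + s *\<^sub>R ?e) - g x) - partial_deriv i g x)" if "s \<noteq> 0" for s
        proof -
          have "(1 / s) *\<^sub>R (g (x + s *\<^sub>R ?e) - g x) - partial_deriv i g x =
            (1 / s) *\<^sub>R (g (x + s *\<^sub>R ?e) - g x - s *\<^sub>R partial_deriv i g x)"
            using that by (simp add: scaleR_diff_right)
          then show ?thesis by simp
        qed
        then show "\<forall>\<^sub>F s in at 0. norm (g (x + s *\<^sub>R ?e) - g x - s *\<^sub>R partial_deriv i g x) / norm s =
          norm ((1 / s) *\<^sub>R (g (x + s *\<^sub>R ?e) - g x) - partial_deriv i g x)"
          by (auto simp: eventually_at_filter)
      qed
      then show ?thesis by (rule LIM_zero_cancel[OF tendsto_norm_zero_cancel])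
    qed
    moreover have "filterlim t (at 0) sequentially"
      unfolding filterlim_at t_def using LIMSEQ_Suc[OF lim_1_over_n] by auto
    ultimately show ?thesis unfolding d_def by (rule filterlim_compose)
  qed
  \<comment> \<open>Since t n \<le> 1, all quotients vanish outside the ball of radius R + 1 and
    share one integrable majorant.\<close>
  have bnd: "norm (d n x) \<le> B * indicator (cball 0 (R + 1)) x" for n x
  proof (cases "norm x \<le> R + 1")
    case True
    have "norm (g (x + t n *\<^sub>R ?e) - g (x + 0 *\<^sub>R ?e)) \<le> B * norm (t n - 0)"
      by (rule differentiable_bound[where S = UNIV and f' = "\<lambda>s r. r *\<^sub>R partial_deriv i g (x + s *\<^sub>R ?e)"])
        (use hvd B in \<open>auto simp: has_vector_derivative_def mult.commute[of B] intro!: onorm_bound mult_left_mono\<close>)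
    then show ?thesis using t[of n] True by (simp add: d_def pos_divide_le_eq)
  next
    case False
    have "norm x \<le> norm (x + t n *\<^sub>R ?e) + norm (t n *\<^sub>R ?e)" by (metis add_diff_cancel_right' norm_triangle_ineq4)
    then have "norm (x + t n *\<^sub>R ?e) > R" using False t[of n] by (auto simp: norm_axis_1)
    then show ?thesis using False R by (simp add: d_def)
  qed
  have gm: "g \<in> borel_measurable lborel"
    using smooth_continuous_on[OF test_functions_smooth[OF g]] borel_measurable_continuous_onI by auto
  have gi: "integrable lborel g" using integrable_test_function[OF g, of "\<lambda>_. 1"] by simp
  have "(\<lambda>n. LINT x|lborel. d n x) \<longlonglongrightarrow> (LINT x|lborel. partial_deriv i g x)"
  proof (rule integral_dominated_convergence[where w = "\<lambda>x. B * indicator (cball 0 (R + 1)) x"])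
    show "partial_deriv i g \<in> borel_measurable lborel"
      using smooth_continuous_on[OF smooth_partial_deriv[OF test_functions_smooth[OF g]]] borel_measurable_continuous_onI by auto
    show "d n \<in> borel_measurable lborel" for n unfolding d_def using gm by measurable
    show "integrable lborel (\<lambda>x. B * indicator (cball (0::real^'n) (R + 1)) x)"
      using emeasure_lborel_cball_finite[of "0::real^'n" "R + 1"]
      by (intro integrable_mult_right integrable_real_indicator) auto
  qed (use lim bnd in auto)
  moreover have "(LINT x|lborel. d n x) = 0" for n
  proof -
    have "integrable lborel (\<lambda>x. g (x + t n *\<^sub>R ?e))" "(LINT x|lborel. g (x + t n *\<^sub>R ?e)) = (LINT x|lborel. g x)"
      using lborel_integral_affine[of 1 g "t n *\<^sub>R ?e"] gi gm by (simp_all add: add.commute)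
    then show ?thesis unfolding d_def using gi by simp
  qed
  ultimately show ?thesis using LIMSEQ_unique[OF _ tendsto_const] by fastforce
qed

section \<open>Differentiability and decay of the Fourier transform\<close>

lemma continuous_on_fourier_kernel:
  "continuous_on UNIV (\<lambda>x::real^'n::finite. exp (- \<i> * complex_of_real (x \<bullet> \<xi>)))"
  by (intro continuous_intros)

lemma norm_fourier_kernel [simp]: "norm (exp (- \<i> * complex_of_real t)) = 1"
  by (simp add: norm_exp_eq_Re)

lemma integrable_fourier_kernel:
  fixes \<psi> :: "real^'n::finite \<Rightarrow> complex"
  assumes "\<psi> \<in> test_functions"
  shows "integrable lborel (\<lambda>x. exp (- \<i> * complex_of_real (x \<bullet> \<xi>)) * \<psi> x)"
  by (rule integrable_test_function[OF assms continuous_on_fourier_kernel])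

lemma coordinate_test_function:
  fixes \<psi> :: "real^'n::finite \<Rightarrow> complex"
  assumes "\<psi> \<in> test_functions"
  shows "(\<lambda>x. - \<i> * (complex_of_real (x $ i) * \<psi> x)) \<in> test_functions"
  using test_functions_mult(2)[OF test_functions_mult(2)[OF assms smooth_coordinate[of i]] smooth_const[of "- \<i>"]] by simp

text \<open>The Taylor bound |e^(it) - 1 - it| \<le> t^2 / 2, integrated against \<psi>, gives a
  remainder of size K |h|^2 and thereby the full derivative, not only its partial
  derivatives.\<close>

lemma fourier_has_derivative:
  fixes \<psi> :: "real^'n::finite \<Rightarrow> complex"
  assumes \<psi>: "\<psi> \<in> test_functions"
  shows "(fourier \<psi> has_derivative
     (\<lambda>h. \<Sum>i\<in>UNIV. complex_of_real (h $ i) * fourier (\<lambda>x. - \<i> * (complex_of_real (x $ i) * \<psi> x)) \<xi>)) (at \<xi>)"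
    (is "(_ has_derivative ?D) _")
proof -
  define c where "c = complex_of_real ((2 * pi) powr (- real CARD('n) / 2))"
  define e where "e \<xi> x = exp (- \<i> * complex_of_real (x \<bullet> \<xi>))" for \<xi> x :: "real^'n"
  have F: "fourier \<psi> \<xi> = c * (LINT x|lborel. e \<xi> x * \<psi> x)" for \<psi> \<xi>
    unfolding fourier_def c_def e_def ..
  \<comment> \<open>Half the second moment of |\<psi>| times the normalising constant; compact
    support makes it a genuine integral.\<close>
  define K where "K = norm c * (LINT x|lborel. norm (complex_of_real ((norm x)\<^sup>2 / 2) * \<psi> x))"
  have D: "?D h = c * (LINT x|lborel. - \<i> * complex_of_real (x \<bullet> h) * (e \<xi> x * \<psi> x))" for h
  proof -
    have "?D h = c * (\<Sum>i\<in>UNIV. LINT x|lborel. complex_of_real (h $ i) * (e \<xi> x * (- \<i> * (complex_of_real (x $ i) * \<psi> x))))"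
      by (simp add: F sum_distrib_left mult.left_commute[of c])
    also have "(\<Sum>i\<in>UNIV. LINT x|lborel. complex_of_real (h $ i) * (e \<xi> x * (- \<i> * (complex_of_real (x $ i) * \<psi> x)))) =
      (LINT x|lborel. (\<Sum>i\<in>UNIV. complex_of_real (h $ i) * (e \<xi> x * (- \<i> * (complex_of_real (x $ i) * \<psi> x)))))"
      using integrable_fourier_kernel[OF coordinate_test_function[OF \<psi>], of \<xi>]
      by (intro Bochner_Integration.integral_sum[symmetric] integrable_mult_right) (auto simp: e_def)
    also have "\<dots> = (LINT x|lborel. - \<i> * complex_of_real (x \<bullet> h) * (e \<xi> x * \<psi> x))"
      by (intro Bochner_Integration.integral_cong refl)
        (simp add: inner_vec_def sum_distrib_left sum_distrib_right mult_ac)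
    finally show ?thesis .
  qed
  have i2: "integrable lborel (\<lambda>x. - \<i> * complex_of_real (x \<bullet> h) * (e \<xi> x * \<psi> x))" for h
    using integrable_test_function[OF \<psi>, of "\<lambda>x. - \<i> * complex_of_real (x \<bullet> h) * e \<xi> x"]
    unfolding e_def by (simp add: mult.assoc continuous_intros)
  have iK: "integrable lborel (\<lambda>x. norm (complex_of_real ((norm x)\<^sup>2 / 2) * \<psi> x))"
    by (intro integrable_norm integrable_test_function[OF \<psi>] continuous_intros) auto
  have main: "norm (fourier \<psi> (\<xi> + h) - fourier \<psi> \<xi> - ?D h) \<le> K * (norm h)\<^sup>2" for h
  proof -
    have "fourier \<psi> (\<xi> + h) - fourier \<psi> \<xi> - ?D h =
      c * (LINT x|lborel. e (\<xi> + h) x * \<psi> x - e \<xi> x * \<psi> x - (- \<i> * complex_of_real (x \<bullet> h) * (e \<xi> x * \<psi> x)))"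
      unfolding D unfolding F
      using i2[of h] integrable_fourier_kernel[OF \<psi>, of "\<xi> + h"] integrable_fourier_kernel[OF \<psi>, of \<xi>]
      by (simp add: e_def right_diff_distrib distrib_left)
    also have "norm \<dots> \<le> norm c * (LINT x|lborel. norm (complex_of_real ((norm x)\<^sup>2 / 2) * \<psi> x) * (norm h)\<^sup>2)"
      unfolding norm_mult[of c]
    proof (rule mult_left_mono[OF Bochner_Integration.integral_norm_bound_integral norm_ge_zero])
      show "integrable lborel (\<lambda>x. e (\<xi> + h) x * \<psi> x - e \<xi> x * \<psi> x - (- \<i> * complex_of_real (x \<bullet> h) * (e \<xi> x * \<psi> x)))"
        using i2 integrable_fourier_kernel[OF \<psi>] unfolding e_def by (intro Bochner_Integration.integrable_diff) auto
      show "integrable lborel (\<lambda>x. norm (complex_of_real ((norm x)\<^sup>2 / 2) * \<psi> x) * (norm h)\<^sup>2)"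
        by (intro integrable_mult_left iK)
      fix x :: "real^'n"
      have ee: "e (\<xi> + h) x = e \<xi> x * exp (\<i> * complex_of_real (- (x \<bullet> h)))"
        unfolding e_def by (simp add: inner_add_right exp_add[symmetric] algebra_simps)
      have "e (\<xi> + h) x * \<psi> x - e \<xi> x * \<psi> x - (- \<i> * complex_of_real (x \<bullet> h) * (e \<xi> x * \<psi> x)) =
        e \<xi> x * \<psi> x * (exp (\<i> * complex_of_real (- (x \<bullet> h))) - (\<Sum>k\<le>1. (\<i> * complex_of_real (- (x \<bullet> h))) ^ k / fact k))"
        unfolding ee by (simp add: algebra_simps)
      also have "norm \<dots> \<le> norm (\<psi> x) * (\<bar>- (x \<bullet> h)\<bar> ^ Suc 1 / fact (Suc 1))"
        unfolding norm_mult using iexp_approx1[of "- (x \<bullet> h)" 1]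
        by (intro mult_mono) (auto simp: e_def)
      also have "\<dots> \<le> norm (\<psi> x) * ((norm x * norm h) ^ Suc 1 / fact (Suc 1))"
        by (intro mult_left_mono divide_right_mono power_mono) (auto simp: Cauchy_Schwarz_ineq2)
      also have "\<dots> = norm (complex_of_real ((norm x)\<^sup>2 / 2) * \<psi> x) * (norm h)\<^sup>2"
        by (simp add: norm_mult norm_divide norm_power power_mult_distrib power2_eq_square)
      finally show "norm (e (\<xi> + h) x * \<psi> x - e \<xi> x * \<psi> x - (- \<i> * complex_of_real (x \<bullet> h) * (e \<xi> x * \<psi> x)))
        \<le> norm (complex_of_real ((norm x)\<^sup>2 / 2) * \<psi> x) * (norm h)\<^sup>2" .
    qed
    also have "\<dots> = K * (norm h)\<^sup>2" by (simp add: K_def)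
    finally show ?thesis .
  qed
  have bl: "bounded_linear ?D"
    by (intro bounded_linear_sum bounded_linear_mult_const bounded_linear_compose[OF bounded_linear_of_real] bounded_linear_vec_nth)
  show ?thesis
  proof (rule has_derivativeI_sandwich[OF zero_less_one bl, where H = "\<lambda>y. K * norm (y - \<xi>)"])
    show "((\<lambda>y. K * norm (y - \<xi>)) \<longlongrightarrow> 0) (at \<xi>)"
      by (auto intro!: tendsto_eq_intros)
  next
    fix y :: "real^'n" assume "y \<noteq> \<xi>"
    then show "norm (fourier \<psi> y - fourier \<psi> \<xi> - ?D (y - \<xi>)) / norm (y - \<xi>) \<le> K * norm (y - \<xi>)"
      using main[of "y - \<xi>"] by (simp add: divide_le_eq power2_eq_square mult.assoc)
  qed
qed

lemma partial_deriv_fourier: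
  fixes \<psi> :: "real^'n::finite \<Rightarrow> complex"
  assumes \<psi>: "\<psi> \<in> test_functions"
  shows "partial_deriv i (fourier \<psi>) = fourier (\<lambda>x. - \<i> * (complex_of_real (x $ i) * \<psi> x))"
proof
  fix \<xi> :: "real^'n"
  have "complex_of_real ((axis i 1 :: real^'n) $ k) * z = (if k = i then z else 0)" for k z
    by (simp add: axis_def)
  then show "partial_deriv i (fourier \<psi>) \<xi> = fourier (\<lambda>x. - \<i> * (complex_of_real (x $ i) * \<psi> x)) \<xi>"
    unfolding partial_deriv_has_derivative[OF fourier_has_derivative[OF \<psi>]] by simp
qed

text \<open>Multiplication by -i x_i stays within the test functions, so the transforms of all test
  functions form one class closed under derivatives. Smoothness of \<open>fourier \<psi>\<close>
  follows without a separate argument for higher orders.\<close>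

lemma deriv_closed_fourier:
  "deriv_closed {\<lambda>(_::unit). fourier \<psi> | \<psi>. \<psi> \<in> (test_functions :: (real^'n::finite \<Rightarrow> complex) set)}"
  unfolding deriv_closed_def
proof safe
  fix \<psi> :: "real^'n \<Rightarrow> complex" and i x
  assume \<psi>: "\<psi> \<in> test_functions"
  show "fourier \<psi> differentiable (at x)" using fourier_has_derivative[OF \<psi>] unfolding differentiable_def by blast
  show "\<exists>\<psi>'. (\<lambda>_. partial_deriv i (fourier \<psi>)) = (\<lambda>_. fourier \<psi>') \<and> \<psi>' \<in> test_functions"
    using partial_deriv_fourier[OF \<psi>] coordinate_test_function[OF \<psi>] by blast
qed

lemma smooth_fourier:
  fixes \<psi> :: "real^'n::finite \<Rightarrow> complex"
  assumes "\<psi> \<in> test_functions" shows "smooth (fourier \<psi>)"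
  using deriv_closed_smooth[OF deriv_closed_fourier, of "\<lambda>_. fourier \<psi>"] assms by blast

text \<open>Integration by parts: the exponential times \<psi> is a test function, so its partial
  derivative integrates to 0, and the product rule separates the two terms.\<close>

lemma fourier_partial_deriv:
  fixes \<psi> :: "real^'n::finite \<Rightarrow> complex"
  assumes \<psi>: "\<psi> \<in> test_functions"
  shows "fourier (partial_deriv i \<psi>) \<xi> = \<i> * complex_of_real (\<xi> $ i) * fourier \<psi> \<xi>"
proof -
  let ?e = "\<lambda>x::real^'n. exp (- \<i> * complex_of_real (x \<bullet> \<xi>))"
  have de: "(?e has_derivative (\<lambda>h. - \<i> * complex_of_real (h \<bullet> \<xi>) * ?e x)) (at x)" for x
  proof -
    have b: "bounded_linear (\<lambda>h. - \<i> * complex_of_real (h \<bullet> \<xi>))"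
      by (intro bounded_linear_const_mult bounded_linear_compose[OF bounded_linear_of_real] bounded_linear_inner_left)
    show ?thesis
      using has_derivative_compose[OF bounded_linear_imp_has_derivative[OF b] DERIV_exp[unfolded has_field_derivative_def]]
      by (simp add: mult.commute)
  qed
  have pe: "partial_deriv i ?e = (\<lambda>x. - \<i> * complex_of_real (\<xi> $ i) * ?e x)"
    using partial_deriv_has_derivative[OF de] by (auto simp: inner_axis')
  have cl: "(\<lambda>x. a * ?e x) differentiable (at x)" for a x
    using de by (intro differentiable_mult differentiable_const) (auto simp: differentiable_def)
  have pa: "partial_deriv j (\<lambda>x. a * ?e x) = (\<lambda>x. (a * (- \<i> * complex_of_real (\<xi> $ j))) * ?e x)" for a j
  proof
    fix x
    have "((\<lambda>x. a * ?e x) has_derivative (\<lambda>h. a * (- \<i> * complex_of_real (h \<bullet> \<xi>) * ?e x))) (at x)"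
      by (intro has_derivative_mult_right de)
    from partial_deriv_has_derivative[OF this]
    show "partial_deriv j (\<lambda>x. a * ?e x) x = (a * (- \<i> * complex_of_real (\<xi> $ j))) * ?e x"
      by (simp add: inner_axis')
  qed
  \<comment> \<open>Scalar multiples of the exponential are closed under differentiation, which
    yields its smoothness.\<close>
  have "deriv_closed {\<lambda>(_::unit) x. a * ?e x | a. True}"
    unfolding deriv_closed_def using cl pa by blast
  then have "smooth (\<lambda>x. 1 * ?e x)"
    by (rule deriv_closed_smooth[where f = "\<lambda>_ x. 1 * ?e x"]) blast
  then have se: "smooth ?e" by simp
  have eq: "partial_deriv i (\<lambda>x. ?e x * \<psi> x) x =
     - \<i> * complex_of_real (\<xi> $ i) * (?e x * \<psi> x) + ?e x * partial_deriv i \<psi> x" for x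
    using partial_deriv_mult[OF smooth_differentiable[OF se] smooth_differentiable[OF test_functions_smooth[OF \<psi>]], of i]
    unfolding pe by (simp only: mult.assoc)
  have "0 = (LINT x|lborel. - \<i> * complex_of_real (\<xi> $ i) * (?e x * \<psi> x) + ?e x * partial_deriv i \<psi> x)"
    using integral_partial_deriv_eq_0[OF test_functions_mult(2)[OF \<psi> se], of i] unfolding eq by simp
  also have "\<dots> = - \<i> * complex_of_real (\<xi> $ i) * (LINT x|lborel. ?e x * \<psi> x) + (LINT x|lborel. ?e x * partial_deriv i \<psi> x)"
    using integrable_fourier_kernel[OF \<psi>] integrable_fourier_kernel[OF test_functions_partial_deriv[OF \<psi>]]
    by (subst Bochner_Integration.integral_add) auto
  finally have "(LINT x|lborel. ?e x * partial_deriv i \<psi> x) = \<i> * complex_of_real (\<xi> $ i) * (LINT x|lborel. ?e x * \<psi> x)"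
    by simp
  then show ?thesis unfolding fourier_def by (simp add: mult_ac)
qed

text \<open>
  Each coordinate of \<open>z\<close> is traded for a derivative, so \<open>C\<close> depends on \<open>\<psi>\<close> only through the bounds \<open>c\<close>.
\<close>

lemma fourier_decay:
  fixes c :: "'n::finite list \<Rightarrow> real"
  shows "\<exists>C\<ge>0. \<forall>\<psi>\<in>test_functions. \<forall>r\<ge>0. \<forall>V\<ge>0.
    (\<forall>\<alpha> z. r ^ length \<alpha> * norm (fourier (Dpart \<alpha> \<psi>) z) \<le> c \<alpha> * V) \<longrightarrow>
    (\<forall>z. (1 + r * norm z) ^ k * r ^ length \<beta> * norm (fourier (Dpart \<beta> \<psi>) z) \<le> C * V)"
proof (induction k arbitrary: \<beta>)
  case 0
  show ?case
  proof (intro exI[of _ "max (c \<beta>) 0"] conjI ballI allI impI)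
    fix \<psi> :: "real^'n \<Rightarrow> complex" and r V :: real and z
    assume "0 \<le> V" and *: "\<forall>\<alpha> z. r ^ length \<alpha> * norm (fourier (Dpart \<alpha> \<psi>) z) \<le> c \<alpha> * V"
    from spec[OF spec[OF *], of \<beta> z]
    have "r ^ length \<beta> * norm (fourier (Dpart \<beta> \<psi>) z) \<le> max (c \<beta>) 0 * V"
      using \<open>0 \<le> V\<close> by (meson max.cobounded1 mult_right_mono order_trans)
    then show "(1 + r * norm z) ^ 0 * r ^ length \<beta> * norm (fourier (Dpart \<beta> \<psi>) z) \<le> max (c \<beta>) 0 * V" by simp
  qed auto
next
  case (Suc k)
  let ?P = "\<lambda>k \<beta> C. C \<ge> 0 \<and> (\<forall>\<psi>\<in>test_functions. \<forall>r\<ge>0. \<forall>V\<ge>0.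
    (\<forall>\<alpha> z. r ^ length \<alpha> * norm (fourier (Dpart \<alpha> \<psi>) z) \<le> c \<alpha> * V) \<longrightarrow>
    (\<forall>z. (1 + r * norm z) ^ k * r ^ length \<beta> * norm (fourier (Dpart \<beta> \<psi>) z) \<le> C * V))"
  \<comment> \<open>The step for \<beta> calls the hypothesis at every \<open>i # \<beta>\<close>,
    so constants are chosen for all lists of directions at once.\<close>
  have "\<forall>\<beta>. \<exists>C. ?P k \<beta> C" using Suc.IH by blast
  then obtain C where C: "\<And>\<beta>. ?P k \<beta> (C \<beta>)" by metis
  show ?case
  proof (intro exI[of _ "C \<beta> + (\<Sum>i\<in>UNIV. C (i # \<beta>))"] conjI ballI allI impI)
    show "0 \<le> C \<beta> + (\<Sum>i\<in>UNIV. C (i # \<beta>))" using C by (intro add_nonneg_nonneg sum_nonneg) auto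
    fix \<psi> :: "real^'n \<Rightarrow> complex" and r V :: real and z
    assume A: "\<psi> \<in> test_functions" "0 \<le> r" "0 \<le> V"
      "\<forall>\<alpha> z. r ^ length \<alpha> * norm (fourier (Dpart \<alpha> \<psi>) z) \<le> c \<alpha> * V"
    let ?F = "\<lambda>\<beta>. norm (fourier (Dpart \<beta> \<psi>) z)"
    have b: "(1 + r * norm z) ^ k * r ^ length \<beta> * ?F \<beta> \<le> C \<beta> * V" for \<beta> using C A by blast
    have "norm z \<le> (\<Sum>i\<in>UNIV. \<bar>z $ i\<bar>)" by (rule norm_le_l1_cart)
    then have "1 + r * norm z \<le> 1 + (\<Sum>i\<in>UNIV. r * \<bar>z $ i\<bar>)"
      using A(2) by (simp add: mult_left_mono flip: sum_distrib_left)
    then have "(1 + r * norm z) ^ Suc k * r ^ length \<beta> * ?F \<beta> \<le>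
      ((1 + r * norm z) ^ k * r ^ length \<beta> * ?F \<beta>) * (1 + (\<Sum>i\<in>UNIV. r * \<bar>z $ i\<bar>))"
      using A(2) by (subst power_Suc, simp only: mult.assoc mult.commute[of "1 + r * norm z"])
        (intro mult_left_mono, auto)
    also have "\<dots> = (1 + r * norm z) ^ k * r ^ length \<beta> * ?F \<beta> +
      (\<Sum>i\<in>UNIV. (1 + r * norm z) ^ k * r ^ length (i # \<beta>) * ?F (i # \<beta>))"
      using fourier_partial_deriv[OF test_functions_Dpart[OF A(1)]]
      by (simp add: norm_mult distrib_left sum_distrib_left mult_ac)
    also have "\<dots> \<le> C \<beta> * V + (\<Sum>i\<in>UNIV. C (i # \<beta>) * V)" by (intro add_mono sum_mono b)
    finally show "(1 + r * norm z) ^ Suc k * r ^ length \<beta> * ?F \<beta> \<le> (C \<beta> + (\<Sum>i\<in>UNIV. C (i # \<beta>))) * V"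
      by (simp add: distrib_right sum_distrib_right)
  qed
qed

lemma norm_fourier_le:
  fixes \<psi> :: "real^'n::finite \<Rightarrow> complex"
  assumes "\<psi> \<in> test_functions"
  shows "norm (fourier \<psi> z) \<le> (2 * pi) powr (- real CARD('n) / 2) * (LINT x|lborel. norm (\<psi> x))"
proof -
  have "norm (LINT x|lborel. exp (- \<i> * complex_of_real (x \<bullet> z)) * \<psi> x) \<le>
    (LINT x|lborel. norm (exp (- \<i> * complex_of_real (x \<bullet> z)) * \<psi> x))"
    by (rule integral_norm_bound)
  then show ?thesis unfolding fourier_def by (simp add: norm_mult mult_left_mono)
qed

text \<open>Each derivative of \<open>fourier \<psi>\<close> is itself the transform of a test
  function, so the seminorms reduce to those without derivatives; these come from
  \<open>fourier_decay\<close> with r = V = 1.\<close>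

lemma fourier_schwartz:
  fixes \<psi> :: "real^'n::finite \<Rightarrow> complex"
  assumes \<psi>: "\<psi> \<in> test_functions"
  shows "fourier \<psi> \<in> schwartz"
proof -
  have "bounded (range (\<lambda>x. (1 + norm x) ^ k *\<^sub>R fourier \<psi> x))" if "\<psi> \<in> test_functions" for k and \<psi> :: "real^'n \<Rightarrow> complex"
  proof -
    define c where "c \<alpha> = (2 * pi) powr (- real CARD('n) / 2) * (LINT x|lborel. norm (Dpart \<alpha> \<psi> x))" for \<alpha>
    have "1 ^ length \<alpha> * norm (fourier (Dpart \<alpha> \<psi>) z) \<le> c \<alpha> * 1" for \<alpha> z
      using norm_fourier_le[OF test_functions_Dpart[OF that]] by (simp add: c_def)
    then obtain C where "\<forall>z. (1 + 1 * norm z) ^ k * 1 ^ length ([]::'n list) * norm (fourier (Dpart [] \<psi>) z) \<le> C * 1"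
      using fourier_decay[of c k "[]"] \<open>\<psi> \<in> test_functions\<close> zero_le_one by blast
    then show ?thesis unfolding bounded_iff by auto
  qed
  moreover have "\<exists>\<eta>\<in>test_functions. Dpart \<alpha> (fourier \<psi>) = fourier \<eta>" for \<alpha>
    using deriv_closed_Dpart[OF deriv_closed_fourier, of "\<lambda>_. fourier \<psi>" \<alpha>] \<psi> by (auto simp: fun_eq_iff)
  ultimately have "bounded (range (\<lambda>x. (1 + norm x) ^ k *\<^sub>R Dpart \<alpha> (fourier \<psi>) x))" for k \<alpha> by metis
  then show ?thesis using smooth_fourier[OF \<psi>] unfolding schwartz_def by blast
qed

lemma inv_fourier_eq: "inv_fourier \<psi> x = fourier \<psi> (- x)"
  unfolding fourier_def inv_fourier_def by (simp add: inner_commute)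

lemma smooth_inv_fourier:
  fixes \<psi> :: "real^'n::finite \<Rightarrow> complex"
  assumes "\<psi> \<in> test_functions" shows "smooth (inv_fourier \<psi>)"
proof -
  have "inv_fourier \<psi> = (\<lambda>x. fourier \<psi> (0 + (- 1) *\<^sub>R x))" by (auto simp: inv_fourier_eq)
  then show ?thesis using smooth_affine[OF smooth_fourier[OF assms], of 0 "- 1"] by simp
qed


section \<open>Decaying kernels\<close>


definition centered_cube :: "real^'n \<Rightarrow> real \<Rightarrow> (real^'n) set" where
  "centered_cube y r = cbox (\<chi> i. y $ i - r / 2) (\<chi> i. y $ i + r / 2)"

lemma cube_centered_cube: "r > 0 \<Longrightarrow> cube (centered_cube y r)"
  unfolding cube_def centered_cube_def
  by (rule exI[of _ "\<chi> i. y $ i - r / 2"], rule exI[of _ r]) (simp add: algebra_simps)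

lemma measure_cbox_side:
  fixes a :: "real^'n::finite"
  assumes "l \<ge> 0"
  shows "measure lborel (cbox a (\<chi> i. a $ i + l)) = l ^ CARD('n)"
proof -
  have "cbox a (\<chi> i. a $ i + l) \<noteq> {}" using assms by (simp add: interval_ne_empty_cart)
  then show ?thesis using content_cbox_cart[of a "\<chi> i. a $ i + l"] by simp
qed

lemma measure_centered_cube:
  fixes y :: "real^'n::finite"
  assumes "r \<ge> 0"
  shows "measure lborel (centered_cube y r) = r ^ CARD('n)"
proof -
  have "centered_cube y r = cbox (\<chi> i. y $ i - r / 2) (\<chi> i. (\<chi> i. y $ i - r / 2) $ i + r)"
    unfolding centered_cube_def by (simp add: algebra_simps)
  then show ?thesis using measure_cbox_side[OF assms] by metis
qed

lemma emeasure_centered_cube: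
  fixes y :: "real^'n::finite"
  assumes "r \<ge> 0"
  shows "emeasure lborel (centered_cube y r) = ennreal (r ^ CARD('n))"
  using measure_centered_cube[OF assms, of y] emeasure_eq_ennreal_measure[of lborel "centered_cube y r"]
  by (simp add: centered_cube_def emeasure_lborel_cbox_eq)

lemma norm_gt_outside_centered_cube:
  fixes x y :: "real^'n::finite"
  assumes "x \<notin> centered_cube y r"
  shows "norm (x - y) > r / 2"
proof -
  obtain i where "\<not> (y $ i - r / 2 \<le> x $ i \<and> x $ i \<le> y $ i + r / 2)"
    using assms unfolding centered_cube_def by (auto simp: mem_box_cart)
  then have "\<bar>x $ i - y $ i\<bar> > r / 2" by linarith
  then have "\<bar>(x - y) $ i\<bar> > r / 2" by simp
  then show ?thesis using component_le_norm_cart[of "x - y" i] by linarith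
qed

text \<open>Take the least k such that x lies in the k-th dilate of the cube. Missing the previous
  dilate forces |x - y| > 2^k r / 4, hence the factor 4^m; the single term with index k already
  dominates the weight.\<close>

lemma decay_weight_le_dyadic_cubes:
  fixes x y :: "real^'n::finite"
  assumes "r > 0"
  shows "ennreal (1 / (1 + norm (x - y) / r) ^ m) \<le>
    (\<Sum>k. ennreal (4 ^ m / (2 ^ k) ^ m) * indicator (centered_cube y (2 ^ k * r)) x)"
proof -
  obtain k0 where "norm (x - y) / r < 2 ^ k0" using real_arch_pow[of 2] by auto
  then have "norm (x - y) < 2 ^ k0 * r" using assms by (simp add: field_simps)
  then have "x \<in> centered_cube y (2 ^ Suc k0 * r)"
    using norm_gt_outside_centered_cube[of x y "2 ^ Suc k0 * r"] by fastforce
  define k where "k = (LEAST k. x \<in> centered_cube y (2 ^ k * r))"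
  have k: "x \<in> centered_cube y (2 ^ k * r)" unfolding k_def by (rule LeastI) fact
  have kl: "x \<notin> centered_cube y (2 ^ j * r)" if "j < k" for j
    using that not_less_Least unfolding k_def by blast
  \<comment> \<open>For k = 0 there is no previous cube, and the summand 1 carries the
    bound.\<close>
  have n0: "1 + norm (x - y) / r \<ge> 2 ^ k / 4"
  proof (cases k)
    case 0
    have "norm (x - y) / r \<ge> 0" using assms by simp
    then have "1 / 4 \<le> 1 + norm (x - y) / r" by linarith
    then show ?thesis using 0 by simp
  next
    case (Suc j)
    then have "norm (x - y) > 2 ^ j * r / 2" using norm_gt_outside_centered_cube[OF kl[of j]] by simp
    then have "norm (x - y) / r > 2 ^ j / 2" using assms by (simp add: field_simps)
    then show ?thesis using Suc by simp
  qed
  have "1 / (1 + norm (x - y) / r) ^ m \<le> 1 / (2 ^ k / 4) ^ m"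
  proof -
    have "1 + norm (x - y) / r > 0" using assms by (intro add_pos_nonneg) auto
    then show ?thesis using n0 by (intro divide_left_mono power_mono mult_pos_pos zero_less_power) auto
  qed
  also have "\<dots> = 4 ^ m / (2 ^ k) ^ m" by (simp add: power_divide)
  finally have "ennreal (1 / (1 + norm (x - y) / r) ^ m) \<le>
    ennreal (4 ^ m / (2 ^ k) ^ m) * indicator (centered_cube y (2 ^ k * r)) x"
    using k by (simp add: ennreal_leI)
  also have "\<dots> \<le> (\<Sum>k. ennreal (4 ^ m / (2 ^ k) ^ m) * indicator (centered_cube y (2 ^ k * r)) x)"
    using sum_le_suminf[OF summableI, of "{k}" "\<lambda>k. ennreal (4 ^ m / (2 ^ k) ^ m) * indicator (centered_cube y (2 ^ k * r)) x"]
    by (simp del: sum_mult_indicator)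
  finally show ?thesis .
qed

text \<open>In dimension d the exponent d + 1 beats the volume (2^k r)^d by 2^(-k), which leaves
  room for averages growing linearly in k: the series of (k + 1) 2^(-k) has sum 4. Together with
  4^(d+1) from the dyadic majorant this is the constant 4^(d+2).\<close>

lemma nn_integral_decay_weight:
  fixes h :: "real^'n::finite \<Rightarrow> ennreal" and y :: "real^'n"
  assumes [measurable]: "h \<in> borel_measurable borel" and r: "r > 0" and A: "A \<ge> 0"
    and h: "\<And>k. (\<integral>\<^sup>+x. h x * indicator (centered_cube y (2 ^ k * r)) x \<partial>lborel) \<le>
      ennreal (A * real (Suc k) * (2 ^ k * r) ^ CARD('n))"
  shows "(\<integral>\<^sup>+x. h x * ennreal (1 / (1 + norm (x - y) / r) ^ (CARD('n) + 1)) \<partial>lborel) \<le>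
    ennreal (4 ^ (CARD('n) + 2) * A * r ^ CARD('n))"
proof -
  define n where "n = CARD('n)"
  define Q where "Q k = centered_cube y (2 ^ k * r)" for k :: nat
  have [measurable]: "Q k \<in> sets borel" for k unfolding Q_def centered_cube_def by simp
  define B where "B = 4 ^ (n + 1) * A * r ^ n"
  have B0: "B \<ge> 0" unfolding B_def using r A by simp
  have "(\<integral>\<^sup>+x. h x * ennreal (1 / (1 + norm (x - y) / r) ^ (n + 1)) \<partial>lborel) \<le>
    (\<integral>\<^sup>+x. (\<Sum>k. ennreal (4 ^ (n + 1) / (2 ^ k) ^ (n + 1)) * (h x * indicator (Q k) x)) \<partial>lborel)"
  proof (intro nn_integral_mono)
    fix x
    have "h x * ennreal (1 / (1 + norm (x - y) / r) ^ (n + 1)) \<le>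
      h x * (\<Sum>k. ennreal (4 ^ (n + 1) / (2 ^ k) ^ (n + 1)) * indicator (Q k) x)"
      unfolding Q_def by (intro mult_left_mono decay_weight_le_dyadic_cubes r) auto
    also have "\<dots> = (\<Sum>k. ennreal (4 ^ (n + 1) / (2 ^ k) ^ (n + 1)) * (h x * indicator (Q k) x))"
      by (subst ennreal_suminf_cmult[symmetric]) (simp add: mult.left_commute)
    finally show "h x * ennreal (1 / (1 + norm (x - y) / r) ^ (n + 1)) \<le>
      (\<Sum>k. ennreal (4 ^ (n + 1) / (2 ^ k) ^ (n + 1)) * (h x * indicator (Q k) x))" .
  qed
  also have "\<dots> = (\<Sum>k. \<integral>\<^sup>+x. ennreal (4 ^ (n + 1) / (2 ^ k) ^ (n + 1)) * (h x * indicator (Q k) x) \<partial>lborel)"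
    by (rule nn_integral_suminf) measurable
  also have "\<dots> = (\<Sum>k. ennreal (4 ^ (n + 1) / (2 ^ k) ^ (n + 1)) * (\<integral>\<^sup>+x. h x * indicator (Q k) x \<partial>lborel))"
    by (intro suminf_cong nn_integral_cmult) measurable
  also have "\<dots> \<le> (\<Sum>k. ennreal (B * (real (Suc k) * (1 / 2) ^ k)))"
  proof (intro suminf_le summableI)
    fix k
    have "ennreal (4 ^ (n + 1) / (2 ^ k) ^ (n + 1)) * (\<integral>\<^sup>+x. h x * indicator (Q k) x \<partial>lborel) \<le>
      ennreal (4 ^ (n + 1) / (2 ^ k) ^ (n + 1)) * ennreal (A * real (Suc k) * (2 ^ k * r) ^ n)"
      using h[of k] by (intro mult_left_mono) (auto simp: Q_def n_def)
    also have "\<dots> = ennreal (4 ^ (n + 1) / (2 ^ k) ^ (n + 1) * (A * real (Suc k) * (2 ^ k * r) ^ n))"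
      using A r by (subst ennreal_mult) auto
    also have "4 ^ (n + 1) / (2 ^ k) ^ (n + 1) * (A * real (Suc k) * (2 ^ k * r) ^ n) = B * (real (Suc k) * (1 / 2) ^ k)"
      by (simp add: B_def power_mult_distrib power_divide field_simps)
    finally show "ennreal (4 ^ (n + 1) / (2 ^ k) ^ (n + 1)) * (\<integral>\<^sup>+x. h x * indicator (Q k) x \<partial>lborel) \<le>
      ennreal (B * (real (Suc k) * (1 / 2) ^ k))" .
  qed
  also have "\<dots> = ennreal (B * 4)"
  proof -
    have "(\<lambda>k. real (Suc k) * (1 / 2) ^ k) sums (1 / (1 - 1 / 2)\<^sup>2)"
      using geometric_deriv_sums[of "1 / 2 :: real"] by simp
    then have "(\<lambda>k. B * (real (Suc k) * (1 / 2) ^ k)) sums (B * 4)"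
      using sums_mult by (fastforce simp: power2_eq_square)
    then show ?thesis using B0 by (intro suminf_ennreal_eq) auto
  qed
  finally show ?thesis by (simp add: B_def n_def mult_ac)
qed

lemma nn_integral_decay_weight_1:
  fixes y :: "real^'n::finite"
  assumes r: "r > 0"
  shows "(\<integral>\<^sup>+x. ennreal (1 / (1 + norm (x - y) / r) ^ (CARD('n) + 1)) \<partial>lborel) \<le>
    ennreal (4 ^ (CARD('n) + 2) * r ^ CARD('n))"
proof -
  have "(\<integral>\<^sup>+x. 1 * indicator (centered_cube y (2 ^ k * r)) x \<partial>lborel) \<le> ennreal (1 * real (Suc k) * (2 ^ k * r) ^ CARD('n))" for k
  proof -
    have "(\<integral>\<^sup>+x. 1 * indicator (centered_cube y (2 ^ k * r)) x \<partial>lborel) = ennreal ((2 ^ k * r) ^ CARD('n))"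
      using emeasure_centered_cube[of "2 ^ k * r" y] r by (simp add: centered_cube_def)
    also have "\<dots> \<le> ennreal (1 * real (Suc k) * (2 ^ k * r) ^ CARD('n))"
    proof (rule ennreal_leI)
      have "1 * (2 ^ k * r) ^ CARD('n) \<le> real (Suc k) * (2 ^ k * r) ^ CARD('n)" using r by (intro mult_right_mono) auto
      then show "(2 ^ k * r) ^ CARD('n) \<le> 1 * real (Suc k) * (2 ^ k * r) ^ CARD('n)" by simp
    qed
    finally show ?thesis .
  qed
  from nn_integral_decay_weight[OF _ r zero_le_one this, simplified] show ?thesis by simp
qed

lemma integrable_decay:
  fixes f :: "real^'n::finite \<Rightarrow> complex"
  assumes [measurable]: "f \<in> borel_measurable borel" and r: "r > 0"
    and b: "\<And>x. (1 + r * norm x) ^ (CARD('n) + 1) * norm (f x) \<le> B"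
  shows "integrable lborel f"
proof (rule integrableI_bounded)
  have "B \<ge> 0" using order_trans[OF _ b[of 0]] by simp
  have "(\<integral>\<^sup>+x. ennreal (norm (f x)) \<partial>lborel) \<le>
    (\<integral>\<^sup>+x. ennreal B * ennreal (1 / (1 + norm (x - (0::real^'n)) / (1 / r)) ^ (CARD('n) + 1)) \<partial>lborel)"
  proof (intro nn_integral_mono)
    fix x :: "real^'n"
    have "(1 + r * norm x) ^ (CARD('n) + 1) > 0" using r by (intro zero_less_power add_pos_nonneg) auto
    then have "norm (f x) \<le> B * (1 / (1 + r * norm x) ^ (CARD('n) + 1))"
      using b[of x] by (simp only: times_divide_eq_right mult_1_right pos_le_divide_eq mult.commute)
    then show "ennreal (norm (f x)) \<le> ennreal B * ennreal (1 / (1 + norm (x - 0) / (1 / r)) ^ (CARD('n) + 1))"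
      using \<open>B \<ge> 0\<close> r by (subst ennreal_mult[symmetric]) (auto intro!: ennreal_leI simp: mult.commute)
  qed
  also have "\<dots> = ennreal B * (\<integral>\<^sup>+x. ennreal (1 / (1 + norm (x - (0::real^'n)) / (1 / r)) ^ (CARD('n) + 1)) \<partial>lborel)"
    by (intro nn_integral_cmult) measurable
  also have "\<dots> \<le> ennreal B * ennreal (4 ^ (CARD('n) + 2) * (1 / r) ^ CARD('n))"
    using r by (intro mult_left_mono nn_integral_decay_weight_1) auto
  also have "\<dots> < \<infinity>" by (simp add: ennreal_mult_less_top)
  finally show "(\<integral>\<^sup>+x. ennreal (norm (f x)) \<partial>lborel) < \<infinity>" .
qed measurable

section \<open>Integrability of Schwartz functions and scaled Fourier decay\<close>

lemma schwartz_borel_measurable: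
  fixes \<psi> :: "real^'n::finite \<Rightarrow> complex"
  shows "\<psi> \<in> schwartz \<Longrightarrow> \<psi> \<in> borel_measurable borel"
  using smooth_continuous_on[OF schwartz_smooth] borel_measurable_continuous_onI by blast

lemma schwartz_integrable:
  fixes \<psi> :: "real^'n::finite \<Rightarrow> complex"
  assumes "\<psi> \<in> schwartz"
  shows "integrable lborel \<psi>"
proof -
  obtain B where "\<And>x. (1 + norm x) ^ (CARD('n) + 1) * norm (\<psi> x) \<le> B" using schwartz_bound[OF assms] by blast
  then show ?thesis using integrable_decay[OF schwartz_borel_measurable[OF assms], of 1 B] by simp
qed

text \<open>Under the scale-invariant bounds c, R^|\<alpha>| times the L^1 norm of D^\<alpha> \<psi>
  is at most c \<alpha> times the volume of the ball of radius R. This volume enters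
  \<open>fourier_decay\<close> through V = R^d, d the dimension, so C is common to all R and all
  \<psi>, in particular to all dyadic scales.\<close>

lemma fourier_scaled_decay:
  fixes c :: "'n::finite list \<Rightarrow> real"
  shows "\<exists>C\<ge>0. \<forall>\<psi>\<in>test_functions. \<forall>R\<ge>0. (\<forall>x. norm x > R \<longrightarrow> \<psi> x = 0) \<longrightarrow>
    (\<forall>\<alpha> x. R ^ length \<alpha> * norm (Dpart \<alpha> \<psi> x) \<le> c \<alpha>) \<longrightarrow>
    (\<forall>z. (1 + R * norm z) ^ k * norm (fourier \<psi> z) \<le> C * R ^ CARD('n))"
proof -
  define v where "v = (2 * pi) powr (- real CARD('n) / 2) * unit_ball_vol (real CARD('n))"
  have v: "v \<ge> 0" unfolding v_def by (intro mult_nonneg_nonneg) auto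
  obtain C where C: "C \<ge> 0" "\<forall>\<psi>\<in>test_functions. \<forall>r\<ge>0. \<forall>V\<ge>0.
    (\<forall>\<alpha> z. r ^ length \<alpha> * norm (fourier (Dpart \<alpha> \<psi>) z) \<le> (c \<alpha> * v) * V) \<longrightarrow>
    (\<forall>z. (1 + r * norm z) ^ k * r ^ length ([]::'n list) * norm (fourier (Dpart [] \<psi>) z) \<le> C * V)"
    using fourier_decay[of "\<lambda>\<alpha>. c \<alpha> * v" k "[]"] by blast
  show ?thesis
  proof (intro exI[of _ C] conjI ballI allI impI)
    fix \<psi> :: "real^'n \<Rightarrow> complex" and R z
    assume \<psi>: "\<psi> \<in> test_functions" and R: "0 \<le> R" "\<forall>x. norm x > R \<longrightarrow> \<psi> x = 0"
      and b: "\<forall>\<alpha> x. R ^ length \<alpha> * norm (Dpart \<alpha> \<psi> x) \<le> c \<alpha>"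
    have "R ^ length \<alpha> * norm (fourier (Dpart \<alpha> \<psi>) z) \<le> c \<alpha> * v * R ^ CARD('n)" for \<alpha> z
    proof -
      have "open {x::real^'n. norm x > R}" by (intro open_Collect_less continuous_intros)
      from Dpart_eq_0[OF this, of _ \<psi> \<alpha>] R(2) have z: "norm x > R \<Longrightarrow> Dpart \<alpha> \<psi> x = 0" for x by auto
      have t: "Dpart \<alpha> \<psi> \<in> test_functions" by (intro test_functions_Dpart \<psi>)
      have "R ^ length \<alpha> * (LINT x|lborel. norm (Dpart \<alpha> \<psi> x)) = (LINT x|lborel. R ^ length \<alpha> * norm (Dpart \<alpha> \<psi> x))"
        by simp
      also have "\<dots> \<le> (LINT x|lborel. c \<alpha> * indicator (cball (0::real^'n) R) x)"
      proof (intro integral_mono integrable_mult_right integrable_norm)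
        show "integrable lborel (Dpart \<alpha> \<psi>)" using schwartz_integrable[OF test_functions_subset_schwartz[OF t]] .
        show "integrable lborel (indicator (cball (0::real^'n) R) :: _ \<Rightarrow> real)"
          using emeasure_lborel_cball_finite[of "0::real^'n" R] by (intro integrable_real_indicator) auto
        fix x show "R ^ length \<alpha> * norm (Dpart \<alpha> \<psi> x) \<le> c \<alpha> * indicator (cball 0 R) x"
          using b z[of x] by (auto simp: indicator_def)
      qed
      also have "\<dots> = c \<alpha> * (unit_ball_vol (real CARD('n)) * R ^ CARD('n))"
        using content_cball[OF R(1), of "0::real^'n"] by simp
      finally have 1: "R ^ length \<alpha> * (LINT x|lborel. norm (Dpart \<alpha> \<psi> x)) \<le> c \<alpha> * (unit_ball_vol (real CARD('n)) * R ^ CARD('n))" .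
      have "R ^ length \<alpha> * norm (fourier (Dpart \<alpha> \<psi>) z) \<le>
        R ^ length \<alpha> * ((2 * pi) powr (- real CARD('n) / 2) * (LINT x|lborel. norm (Dpart \<alpha> \<psi> x)))"
        using R(1) by (intro mult_left_mono norm_fourier_le t) auto
      also have "\<dots> = (2 * pi) powr (- real CARD('n) / 2) * (R ^ length \<alpha> * (LINT x|lborel. norm (Dpart \<alpha> \<psi> x)))"
        by (rule mult.left_commute)
      also have "\<dots> \<le> (2 * pi) powr (- real CARD('n) / 2) * (c \<alpha> * (unit_ball_vol (real CARD('n)) * R ^ CARD('n)))"
        by (intro mult_left_mono 1) auto
      finally show ?thesis unfolding v_def by (simp add: mult_ac)
    qed
    then show "(1 + R * norm z) ^ k * norm (fourier \<psi> z) \<le> C * R ^ CARD('n)"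
      using C(2)[rule_format, OF \<psi> R(1), of "R ^ CARD('n)" z] R(1) by simp
  qed (use C in auto)
qed

section \<open>Duality and inversion at the origin\<close>

lemma fourier_duality:
  fixes \<psi> \<kappa> :: "real^'n::finite \<Rightarrow> complex"
  assumes \<psi>: "\<psi> \<in> test_functions" and \<kappa>: "\<kappa> \<in> test_functions"
  shows "(LINT z|lborel. fourier \<psi> z * \<kappa> z) = (LINT x|lborel. \<psi> x * fourier \<kappa> x)"
proof -
  define c where "c = complex_of_real ((2 * pi) powr (- real CARD('n) / 2))"
  let ?e = "\<lambda>x z::real^'n. exp (- \<i> * complex_of_real (x \<bullet> z))"
  have [measurable]: "\<psi> \<in> borel_measurable borel" "\<kappa> \<in> borel_measurable borel"
    using \<psi> \<kappa> schwartz_borel_measurable test_functions_subset_schwartz by blast+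
  have i: "integrable lborel \<psi>" "integrable lborel \<kappa>"
    using \<psi> \<kappa> schwartz_integrable test_functions_subset_schwartz by blast+
  have int: "integrable (lborel \<Otimes>\<^sub>M lborel) (\<lambda>(x, z). ?e x z * \<psi> x * \<kappa> z)"
  proof (rule lborel_pair.Fubini_integrable)
    show "(\<lambda>(x, z). ?e x z * \<psi> x * \<kappa> z) \<in> borel_measurable (lborel \<Otimes>\<^sub>M lborel)" by measurable
    show "integrable lborel (\<lambda>x. LINT z|lborel. norm (case (x, z) of (x, z) \<Rightarrow> ?e x z * \<psi> x * \<kappa> z))"
      using i by (simp add: norm_mult)
    have "integrable lborel (\<lambda>z. ?e x z * \<psi> x * \<kappa> z)" for x
      using integrable_test_function[OF \<kappa>, of "\<lambda>z. ?e x z * \<psi> x"] by (simp add: continuous_intros)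
    then show "AE x in lborel. integrable lborel (\<lambda>z. case (x, z) of (x, z) \<Rightarrow> ?e x z * \<psi> x * \<kappa> z)" by simp
  qed
  have "(LINT z|lborel. fourier \<psi> z * \<kappa> z) = c * (LINT z|lborel. LINT x|lborel. ?e x z * \<psi> x * \<kappa> z)"
    unfolding fourier_def c_def by (simp only: mult.assoc flip: integral_mult_left_zero integral_mult_right_zero)
  also have "(LINT z|lborel. LINT x|lborel. ?e x z * \<psi> x * \<kappa> z) = (LINT x|lborel. LINT z|lborel. ?e x z * \<psi> x * \<kappa> z)"
    using lborel_pair.Fubini_integral[OF int] by simp
  also have "\<dots> = (LINT x|lborel. \<psi> x * (LINT z|lborel. ?e z x * \<kappa> z))"
    by (simp add: mult_ac inner_commute flip: integral_mult_right_zero)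
  also have "c * \<dots> = (LINT x|lborel. \<psi> x * fourier \<kappa> x)"
    unfolding fourier_def c_def by (simp add: mult.left_commute flip: integral_mult_right_zero)
  finally show ?thesis .
qed

text \<open>
  Inversion at the origin, in the only case needed: the dilates \<open>\<kappa>(z/n)\<close> tend to \<open>1\<close> while their
  Fourier transforms tend to \<open>0\<close> uniformly away from the origin.
\<close>

lemma integral_fourier_eq_0:
  fixes \<psi> \<kappa> :: "real^'n::finite \<Rightarrow> complex"
  assumes \<psi>: "\<psi> \<in> test_functions" and \<delta>: "\<delta> > 0" "\<And>x. norm x < \<delta> \<Longrightarrow> \<psi> x = 0"
    and \<kappa>: "\<kappa> \<in> test_functions" "\<kappa> 0 = 1"
  shows "(LINT z|lborel. fourier \<psi> z) = 0"
proof -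
  define \<kappa>' where "\<kappa>' n z = \<kappa> (0 + (1 / Suc n) *\<^sub>R z)" for n z
  define N where "N = CARD('n)"
  obtain R where R: "R > 0" "\<And>x. norm x > R \<Longrightarrow> \<kappa> x = 0" using test_functionsE[OF \<kappa>(1)] by blast
  have s: "smooth \<kappa>" using \<kappa> test_functions_smooth by blast
  have \<kappa>'0: "norm x > R * Suc n \<Longrightarrow> \<kappa>' n x = 0" for n x
    unfolding \<kappa>'_def by (rule R) (simp add: field_simps)
  have t: "\<kappa>' n \<in> test_functions" for n
    unfolding test_functions_iff \<kappa>'_def
    using smooth_affine[OF s] \<kappa>'0[unfolded \<kappa>'_def] by blast
  have "\<exists>c. \<forall>x. norm (Dpart \<alpha> \<kappa> x) \<le> c" for \<alpha>
    using test_functions_bounded[OF test_functions_Dpart[OF \<kappa>(1), of \<alpha>], of "\<lambda>_. 1"] by auto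
  then obtain c where c: "\<And>\<alpha> x. norm (Dpart \<alpha> \<kappa> x) \<le> c \<alpha>" by metis
  obtain C where C: "C \<ge> 0" "\<And>n z. (1 + R * Suc n * norm z) ^ (N + 1) * norm (fourier (\<kappa>' n) z) \<le> C * (R * Suc n) ^ N"
  proof -
    \<comment> \<open>The support radius grows by the factor Suc n while a derivative of order
      |\<alpha>| shrinks by its power, so the bounds do not depend on n.\<close>
    have d: "(R * Suc n) ^ length \<alpha> * norm (Dpart \<alpha> (\<kappa>' n) x) \<le> R ^ length \<alpha> * c \<alpha>" for \<alpha> x n
    proof -
      have "(R * Suc n) ^ length \<alpha> * norm (Dpart \<alpha> (\<kappa>' n) x) = R ^ length \<alpha> * norm (Dpart \<alpha> \<kappa> (0 + (1 / Suc n) *\<^sub>R x))"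
        unfolding \<kappa>'_def Dpart_affine[OF s] by (simp add: power_mult_distrib power_divide)
      also have "\<dots> \<le> R ^ length \<alpha> * c \<alpha>" using R(1) c by (intro mult_left_mono) auto
      finally show ?thesis .
    qed
    obtain C where C: "C \<ge> 0" "\<forall>\<psi>\<in>test_functions. \<forall>r\<ge>0. (\<forall>x. norm x > r \<longrightarrow> \<psi> x = 0) \<longrightarrow>
      (\<forall>\<alpha> x. r ^ length \<alpha> * norm (Dpart \<alpha> \<psi> x) \<le> R ^ length \<alpha> * c \<alpha>) \<longrightarrow>
      (\<forall>z. (1 + r * norm z) ^ (N + 1) * norm (fourier \<psi> z) \<le> C * r ^ N)"
      using fourier_scaled_decay[of "\<lambda>\<alpha>. R ^ length \<alpha> * c \<alpha>" "N + 1"] unfolding N_def by blast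
    have "(1 + R * Suc n * norm z) ^ (N + 1) * norm (fourier (\<kappa>' n) z) \<le> C * (R * Suc n) ^ N" for n z
      using C(2)[rule_format, OF t[of n], of "R * Suc n" z] d[of n] \<kappa>'0[of n] R(1) by auto
    then show ?thesis using that C(1) by blast
  qed
  have \<psi>i: "integrable lborel \<psi>" "integrable lborel (fourier \<psi>)"
    using schwartz_integrable test_functions_subset_schwartz \<psi> fourier_schwartz by blast+
  have [measurable]: "\<kappa>' n \<in> borel_measurable borel" "fourier \<psi> \<in> borel_measurable borel" for n
    using t \<psi> schwartz_borel_measurable test_functions_subset_schwartz fourier_schwartz by blast+
  have "(\<lambda>n. LINT z|lborel. fourier \<psi> z * \<kappa>' n z) \<longlonglongrightarrow> (LINT z|lborel. fourier \<psi> z)"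
  proof (rule integral_dominated_convergence[where w = "\<lambda>z. c [] * norm (fourier \<psi> z)"])
    show "integrable lborel (\<lambda>z. c [] * norm (fourier \<psi> z))" using \<psi>i by auto
    have "(\<lambda>n. \<kappa>' n z) \<longlonglongrightarrow> \<kappa> (0 + 0 *\<^sub>R z)" for z
    proof -
      have "(\<lambda>n. 0 + (1 / real (Suc n)) *\<^sub>R z) \<longlonglongrightarrow> 0 + 0 *\<^sub>R z"
        by (intro tendsto_add tendsto_const tendsto_scaleR LIMSEQ_Suc[OF lim_1_over_n])
      moreover have "isCont \<kappa> x" for x using smooth_continuous_on[OF s, of UNIV] by (auto simp: continuous_on_eq_continuous_at)
      ultimately show ?thesis unfolding \<kappa>'_def using isCont_tendsto_compose by blast
    qed
    then show "AE z in lborel. (\<lambda>n. fourier \<psi> z * \<kappa>' n z) \<longlonglongrightarrow> fourier \<psi> z"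
      using \<kappa>(2) by (intro always_eventually allI) (auto intro!: tendsto_eq_intros)
    show "AE z in lborel. norm (fourier \<psi> z * \<kappa>' n z) \<le> c [] * norm (fourier \<psi> z)" for n
    proof (intro always_eventually allI)
      fix z
      show "norm (fourier \<psi> z * \<kappa>' n z) \<le> c [] * norm (fourier \<psi> z)"
        unfolding norm_mult \<kappa>'_def mult.commute[of "c []"] using c[of "[]"] by (intro mult_left_mono) auto
    qed
  qed measurable
  moreover have "(\<lambda>n. LINT z|lborel. fourier \<psi> z * \<kappa>' n z) \<longlonglongrightarrow> 0"
  proof (rule Lim_null_comparison)
    define D where "D = C / (R * \<delta> ^ (N + 1)) * (LINT x|lborel. norm (\<psi> x))"
    \<comment> \<open>Where \<psi> is nonzero, |x| \<ge> \<delta>. There decay of order d + 1, d the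
      dimension, against a constant of order S^d leaves C / (S \<delta>^(d+1)), which tends to 0
      with 1/n.\<close>
    have b: "norm (\<psi> x * fourier (\<kappa>' n) x) \<le> norm (\<psi> x) * (C / (R * \<delta> ^ (N + 1)) * (1 / Suc n))" for n x
    proof (cases "norm x < \<delta>")
      case False
      define S where "S = R * Suc n"
      have S: "S > 0" unfolding S_def using R by simp
      have "(S * \<delta>) ^ (N + 1) * norm (fourier (\<kappa>' n) x) \<le> (1 + S * norm x) ^ (N + 1) * norm (fourier (\<kappa>' n) x)"
        using False S \<delta>(1) by (intro mult_right_mono power_mono) (auto intro!: add_increasing mult_left_mono)
      also have "\<dots> \<le> C * S ^ N" using C(2)[of n x] unfolding S_def by simp
      finally have "norm (fourier (\<kappa>' n) x) \<le> C * S ^ N / (S * \<delta>) ^ (N + 1)"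
        using S \<delta>(1) by (simp add: field_simps)
      also have "\<dots> = C / (S * \<delta> ^ (N + 1))"
        using S \<delta>(1) by (simp add: power_mult_distrib mult.commute)
      also have "\<dots> = C / (R * \<delta> ^ (N + 1)) * (1 / Suc n)"
        unfolding S_def by (simp add: mult_ac)
      finally show ?thesis unfolding norm_mult by (intro mult_left_mono) auto
    qed (simp add: \<delta>)
    have "norm (LINT z|lborel. fourier \<psi> z * \<kappa>' n z) \<le> D * (1 / Suc n)" for n
    proof -
      have "norm (LINT z|lborel. fourier \<psi> z * \<kappa>' n z) = norm (LINT x|lborel. \<psi> x * fourier (\<kappa>' n) x)"
        by (simp add: fourier_duality[OF \<psi> t])
      also have "\<dots> \<le> (LINT x|lborel. norm (\<psi> x) * (C / (R * \<delta> ^ (N + 1)) * (1 / Suc n)))"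
        using \<psi>i(1) integrable_test_function[OF \<psi> smooth_continuous_on[OF smooth_fourier[OF t[of n]]]]
        by (intro Bochner_Integration.integral_norm_bound_integral b integrable_mult_left integrable_norm) (simp_all add: mult.commute)
      also have "\<dots> = D * (1 / Suc n)" unfolding D_def by simp
      finally show ?thesis .
    qed
    then show "\<forall>\<^sub>F n in sequentially. norm (LINT z|lborel. fourier \<psi> z * \<kappa>' n z) \<le> D * (1 / Suc n)" by simp
    show "(\<lambda>n. D * (1 / Suc n)) \<longlonglongrightarrow> 0"
      using tendsto_mult_right_zero[OF LIMSEQ_Suc[OF lim_1_over_n]] by blast
  qed
  ultimately show ?thesis by (rule LIMSEQ_unique)
qed


section \<open>Uniqueness of representing functions\<close>


text \<open>The sets over which the integral vanishes form a Dynkin system containing the boxes, an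
  intersection-stable generator of the Borel sets; vanishing integrals over all Borel sets force the
  function to be zero almost everywhere.\<close>

lemma AE_eq_0_if_box_integrals_eq_0:
  fixes h :: "'a::euclidean_space \<Rightarrow> 'b::{banach, second_countable_topology}"
  assumes h: "h \<in> borel_measurable borel"
    and int: "\<And>a b. integrable lborel (\<lambda>x. indicator (box a b) x *\<^sub>R h x)"
    and zero: "\<And>a b. (LINT x|lborel. indicator (box a b) x *\<^sub>R h x) = 0"
  shows "AE x in lborel. h x = 0"
proof -
  \<comment> \<open>Cutting h down to bounded boxes makes it integrable, as the passage to
    complements requires; the boxes S n exhaust the space.\<close>
  define S where "S n = box (- (real n *\<^sub>R One)) (real n *\<^sub>R One :: 'a)" for n
  have "AE x in lborel. indicator (S n) x *\<^sub>R h x = 0" for n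
  proof -
    let ?H = "\<lambda>x. indicator (S n) x *\<^sub>R h x"
    have iH: "integrable lborel ?H" unfolding S_def by (rule int)
    have box0: "(LINT x|lborel. indicator (box a b) x *\<^sub>R ?H x) = 0" for a b
      using zero unfolding S_def by (simp add: box_Int_box flip: indicator_inter_arith)
    have sb: "sigma_sets UNIV (range (\<lambda>(a, b). box a b :: 'a set)) = sets borel"
      by (subst borel_eq_box) simp
    have "(LINT x|lborel. indicator A x *\<^sub>R ?H x) = 0" if "A \<in> sigma_sets UNIV (range (\<lambda>(a, b). box a b :: 'a set))" for A
    proof -
      have stable: "Int_stable (range (\<lambda>(a, b). box a b :: 'a set))"
        by (auto simp: Int_stable_def box_Int_box)
      show ?thesis
      proof (rule sigma_sets_induct_disjoint[OF stable _ that])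
        fix A assume compl: "A \<in> sigma_sets UNIV (range (\<lambda>(a, b). box a b :: 'a set))"
          "(LINT x|lborel. indicator A x *\<^sub>R ?H x) = 0"
        have "A \<in> sets borel" using compl(1) sb by simp
        have "(LINT x|lborel. indicator (UNIV - A) x *\<^sub>R ?H x) = (LINT x|lborel. ?H x - indicator A x *\<^sub>R ?H x)"
          by (intro Bochner_Integration.integral_cong) (auto simp: indicator_def)
        also have "\<dots> = (LINT x|lborel. ?H x) - (LINT x|lborel. indicator A x *\<^sub>R ?H x)"
          using \<open>A \<in> sets borel\<close> by (intro Bochner_Integration.integral_diff iH integrable_mult_indicator) auto
        finally show "(LINT x|lborel. indicator (UNIV - A) x *\<^sub>R ?H x) = 0" using compl zero unfolding S_def by simp
      next
        fix A :: "nat \<Rightarrow> 'a set"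
        assume union: "disjoint_family A" "range A \<subseteq> sigma_sets UNIV (range (\<lambda>(a, b). box a b :: 'a set))"
          "\<And>i. (LINT x|lborel. indicator (A i) x *\<^sub>R ?H x) = 0"
        have A: "A i \<in> sets lborel" for i using union(2) sb by auto
        have "set_integrable lborel (\<Union> (range A)) ?H"
          unfolding set_integrable_def using A by (intro integrable_mult_indicator iH) auto
        then have "(LINT x:(\<Union> (range A))|lborel. ?H x) = (\<Sum>i. LINT x:A i|lborel. ?H x)"
          using union(1) A by (intro lebesgue_integral_countable_add) (auto simp: disjoint_family_on_def)
        then show "(LINT x|lborel. indicator (\<Union> (range A)) x *\<^sub>R ?H x) = 0" using union(3) unfolding set_lebesgue_integral_def by simp
      next
        fix A assume "A \<in> range (\<lambda>(a, b). box a b :: 'a set)"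
        then show "(LINT x|lborel. indicator A x *\<^sub>R ?H x) = 0" using box0 by (elim rangeE) (simp only: split_beta)
      qed auto
    qed
    then have "(LINT x:A|lborel. ?H x) = 0" if "A \<in> sets lborel" for A
      using that unfolding set_lebesgue_integral_def sb by simp
    then have "AE x in lborel. ?H x \<in> {0}"
      by (intro sigma_finite_measure.averaging_theorem iH sigma_finite_lborel) auto
    then show ?thesis by simp
  qed
  then have "AE x in lborel. \<forall>n. indicator (S n) x *\<^sub>R h x = 0" by (subst AE_all_countable) blast
  then show ?thesis
  proof (rule eventually_mono)
    fix x assume *: "\<forall>n. indicator (S n) x *\<^sub>R h x = 0"
    obtain n where "x \<in> S n" using UN_box_eq_UNIV unfolding S_def by blast
    then show "h x = 0" using spec[OF *, of n] by simp
  qed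
qed

lemma AE_notin_frontier_box: "AE x in lborel. x \<notin> frontier (box a b :: 'a::euclidean_space set)"
proof -
  have "frontier (box a b) \<in> null_sets lebesgue"
    using negligible_convex_frontier[OF convex_box(2)] negligible_iff_null_sets by blast
  then have "AE x in lebesgue. x \<notin> frontier (box a b)" by (rule AE_not_in)
  then show ?thesis by (simp add: AE_completion_iff)
qed

lemma smooth_cnj:
  fixes f :: "real^'n::finite \<Rightarrow> complex"
  shows "smooth f \<Longrightarrow> smooth (\<lambda>x. cnj (f x))"
  using smooth_bounded_linear(1)[OF bounded_linear_cnj] .

text \<open>The tests are reflected dilates of one bump, centred at the points of a box. Fubini
  turns the vanishing integrals into the integral of h against a mollified indicator, and dilation
  recovers the indicator itself off the frontier of the box, a null set.\<close>

lemma AE_eq_0_if_test_integrals_eq_0_borel: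
  fixes h \<kappa> :: "real^'n::finite \<Rightarrow> complex"
  assumes h[measurable]: "h \<in> borel_measurable borel"
    and li: "\<And>K. compact K \<Longrightarrow> integrable lborel (\<lambda>x. indicator K x *\<^sub>R h x)"
    and zero: "\<And>\<psi>. \<psi> \<in> test_functions \<Longrightarrow> (LINT x|lborel. h x * \<psi> x) = 0"
    and \<kappa>: "\<kappa> \<in> test_functions" "\<kappa> 0 = 1"
  shows "AE x in lborel. h x = 0"
proof (rule AE_eq_0_if_box_integrals_eq_0[OF h])
  fix a b :: "real^'n"
  have box_cbox: "indicator (box a b) x *\<^sub>R h x = indicator (box a b) x *\<^sub>R indicator (cbox a b) x *\<^sub>R h x" for x
    using box_subset_cbox by (auto simp: indicator_def)
  show "integrable lborel (\<lambda>x. indicator (box a b) x *\<^sub>R h x)"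
    unfolding box_cbox by (intro integrable_mult_indicator li) auto
  \<comment> \<open>|\<kappa>|^2 is nonnegative and positive near 0, so its integral is nonzero,
    which \<kappa> itself may fail to satisfy.\<close>
  define \<rho> where "\<rho> x = \<kappa> x * cnj (\<kappa> x)" for x
  have \<rho>: "\<rho> \<in> test_functions"
    unfolding \<rho>_def using \<kappa> by (intro test_functions_mult smooth_cnj test_functions_smooth)
  have [measurable]: "\<rho> \<in> borel_measurable borel" using \<rho> schwartz_borel_measurable test_functions_subset_schwartz by blast
  have i\<rho>: "integrable lborel \<rho>" using \<rho> schwartz_integrable test_functions_subset_schwartz by blast
  have \<rho>n: "\<rho> x = complex_of_real ((norm (\<kappa> x))\<^sup>2)" for x unfolding \<rho>_def by (rule complex_norm_square[symmetric])
  obtain R where R: "R > 0" "\<And>x. norm x > R \<Longrightarrow> \<rho> x = 0" using test_functionsE[OF \<rho>] by blast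
  obtain M where M: "\<And>x. norm (\<rho> x) \<le> M" using test_functions_bounded[OF \<rho>, of "\<lambda>_. 1"] by auto
  have c0: "(LINT x|lborel. \<rho> x) \<noteq> 0"
  proof
    assume "(LINT x|lborel. \<rho> x) = 0"
    then have "(LINT x|lborel. (norm (\<kappa> x))\<^sup>2) = 0" unfolding \<rho>n by (simp only: integral_complex_of_real of_real_eq_0_iff)
    moreover have "integrable lborel (\<lambda>x. (norm (\<kappa> x))\<^sup>2)" using i\<rho> unfolding \<rho>n by (simp only: complex_of_real_integrable_eq)
    ultimately have "AE x in lborel. (norm (\<kappa> x))\<^sup>2 = 0" using integral_nonneg_eq_0_iff_AE[of lborel "\<lambda>x. (norm (\<kappa> x))\<^sup>2"] by simp
    then have "AE x in lebesgue. x \<in> {x. \<kappa> x = 0}" by (simp add: AE_completion_iff)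
    moreover have "closed {x. \<kappa> x = 0}"
      using smooth_continuous_on[OF test_functions_smooth[OF \<kappa>(1)], of UNIV] by (intro closed_Collect_eq continuous_intros)
    ultimately have "0 \<in> {x. \<kappa> x = 0}" by (rule mem_closed_if_AE_lebesgue[rotated])
    then show False using \<kappa>(2) by simp
  qed
  obtain L where L: "\<And>x. x \<in> box a b \<Longrightarrow> norm x \<le> L" using bounded_box[of a b] bounded_iff by blast
  \<comment> \<open>For x in the box and e \<ge> 1, \<rho>(e (x - y)) \<noteq> 0 forces |y| \<le> L
    + R. The truncation therefore leaves the integrals below unchanged while making h globally
    integrable.\<close>
  define H where "H y = indicator (cball 0 (L + R)) y *\<^sub>R h y" for y
  have [measurable]: "cball (0::real^'n) (L + R) \<in> sets borel" by (intro borel_closed) simp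
  have [measurable]: "H \<in> borel_measurable borel" unfolding H_def by measurable
  have iH: "integrable lborel H" unfolding H_def by (intro li) simp
  \<comment> \<open>The substitution x = y + z / e with e = Suc m turns the integral of \<rho>(e (x
    - y)) over the box into e^(-d) G, d the dimension. As m grows, G tends to the indicator times
    the integral of \<rho>.\<close>
  define G where "G m y = (LINT z|lborel. indicator (box a b) (y + (1 / real (Suc m)) *\<^sub>R z) *\<^sub>R \<rho> z)" for m and y
  have [measurable]: "G m \<in> borel_measurable borel" for m unfolding G_def by measurable
  have GH: "(LINT y|lborel. H y * G m y) = 0" for m
  proof -
    define e where "e = real (Suc m)"
    have e: "e \<ge> 1" unfolding e_def by simp
    let ?f = "\<lambda>x y. indicator (box a b) x *\<^sub>R (H y * \<rho> (e *\<^sub>R (x - y)))"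
    have bnd: "norm (?f x y) \<le> indicator (box a b) x * (M * norm (H y))" for x y
      using M[of "e *\<^sub>R (x - y)"] by (auto simp: indicator_def norm_mult mult.commute[of M] intro!: mult_left_mono)
    have bi: "integrable lborel (indicator (box a b) :: _ \<Rightarrow> real)"
      by (intro integrable_real_indicator) (auto simp: emeasure_lborel_box_eq)
    have int: "integrable (lborel \<Otimes>\<^sub>M lborel) (\<lambda>(x, y). ?f x y)"
    proof (rule Bochner_Integration.integrable_bound)
      show "integrable (lborel \<Otimes>\<^sub>M lborel) (\<lambda>(x, y). indicator (box a b) x * (M * norm (H y)))"
      proof (rule lborel_pair.Fubini_integrable)
        show "integrable lborel (\<lambda>x. LINT y|lborel. norm (case (x, y) of (x, y) \<Rightarrow> indicator (box a b) x * (M * norm (H y))))"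
          using bi iH by (simp add: abs_mult)
        show "AE x in lborel. integrable lborel (\<lambda>y. case (x, y) of (x, y) \<Rightarrow> indicator (box a b) x * (M * norm (H y)))"
          using iH by simp
      qed measurable
      show "AE p in lborel \<Otimes>\<^sub>M lborel. norm (case p of (x, y) \<Rightarrow> ?f x y) \<le> norm (case p of (x, y) \<Rightarrow> indicator (box a b) x * (M * norm (H y)))"
        using bnd by (intro always_eventually allI) (force intro: order_trans[OF _ abs_ge_self] simp del: norm_scaleR)
    qed measurable
    have inner0: "(LINT y|lborel. ?f x y) = 0" for x
    proof (cases "x \<in> box a b")
      case True
      define \<psi> where "\<psi> y = \<rho> (e *\<^sub>R x + (- e) *\<^sub>R y)" for y
      have z: "\<psi> y = 0" if "norm y > L + R" for y
      proof -
        have "norm y \<le> norm x + norm (x - y)" by (metis add_diff_cancel_left' norm_minus_commute norm_triangle_sub)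
        then have "norm (x - y) > R" using that L[OF True] by linarith
        also have "norm (x - y) \<le> e * norm (x - y)" using e mult_right_mono[of 1 e "norm (x - y)"] by simp
        also have "\<dots> = norm (e *\<^sub>R x + (- e) *\<^sub>R y)" using e by (simp flip: scaleR_diff_right)
        finally show ?thesis unfolding \<psi>_def by (rule R)
      qed
      then have "\<psi> \<in> test_functions"
        unfolding test_functions_iff using smooth_affine[OF test_functions_smooth[OF \<rho>]] unfolding \<psi>_def by blast
      then have "(LINT y|lborel. h y * \<psi> y) = 0" by (rule zero)
      also have "(\<lambda>y. h y * \<psi> y) = (\<lambda>y. ?f x y)"
        using z True by (force simp: H_def \<psi>_def indicator_def scaleR_diff_right)
      finally show ?thesis .
    qed simp
    have "0 = (LINT x|lborel. LINT y|lborel. ?f x y)" unfolding inner0 by simp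
    also have "\<dots> = (LINT y|lborel. LINT x|lborel. ?f x y)" using lborel_pair.Fubini_integral[OF int] by simp
    also have "(\<lambda>y. LINT x|lborel. ?f x y) = (\<lambda>y. (1 / e) ^ CARD('n) *\<^sub>R (H y * G m y))"
    proof
      fix y
      have "(LINT x|lborel. ?f x y) = \<bar>1 / e\<bar> ^ DIM(real^'n) *\<^sub>R (LINT z|lborel. ?f (y + (1 / e) *\<^sub>R z) y)"
        using e by (intro lborel_integral_affine(1)) auto
      also have "(LINT z|lborel. ?f (y + (1 / e) *\<^sub>R z) y) = (LINT z|lborel. H y * (indicator (box a b) (y + (1 / e) *\<^sub>R z) *\<^sub>R \<rho> z))"
        using e by (intro Bochner_Integration.integral_cong) auto
      also have "\<dots> = H y * G m y" unfolding G_def e_def by (rule integral_mult_right_zero)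
      finally show "(LINT x|lborel. ?f x y) = (1 / e) ^ CARD('n) *\<^sub>R (H y * G m y)" using e by simp
    qed
    finally show ?thesis using e by simp
  qed
  have lim: "(\<lambda>m. LINT y|lborel. H y * G m y) \<longlonglongrightarrow> (LINT y|lborel. H y * (indicator (box a b) y *\<^sub>R (LINT z|lborel. \<rho> z)))"
  proof (rule integral_dominated_convergence[where w = "\<lambda>y. norm (H y) * (LINT z|lborel. norm (\<rho> z))"])
    show "integrable lborel (\<lambda>y. norm (H y) * (LINT z|lborel. norm (\<rho> z)))" using iH by auto
    have Gb: "norm (G m y) \<le> (LINT z|lborel. norm (\<rho> z))" for m y
      unfolding G_def
    proof (rule Bochner_Integration.integral_norm_bound_integral)
      show "integrable lborel (\<lambda>z. indicator (box a b) (y + (1 / real (Suc m)) *\<^sub>R z) *\<^sub>R \<rho> z)"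
        by (rule Bochner_Integration.integrable_bound[OF i\<rho>]) (measurable, auto simp: indicator_def)
    qed (use i\<rho> in \<open>auto simp: indicator_def\<close>)
    show "AE y in lborel. norm (H y * G m y) \<le> norm (H y) * (LINT z|lborel. norm (\<rho> z))" for m
      using Gb by (intro always_eventually allI) (auto simp: norm_mult intro!: mult_left_mono)
    show "AE y in lborel. (\<lambda>m. H y * G m y) \<longlonglongrightarrow> H y * (indicator (box a b) y *\<^sub>R (LINT z|lborel. \<rho> z))"
      using AE_notin_frontier_box[of a b]
    proof eventually_elim
      case (elim y)
      have "(\<lambda>m. G m y) \<longlonglongrightarrow> (LINT z|lborel. indicator (box a b) y *\<^sub>R \<rho> z)"
        unfolding G_def
      proof (rule integral_dominated_convergence[where w = "\<lambda>z. norm (\<rho> z)"])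
        show "AE z in lborel. (\<lambda>m. indicator (box a b) (y + (1 / real (Suc m)) *\<^sub>R z) *\<^sub>R \<rho> z) \<longlonglongrightarrow> indicator (box a b) y *\<^sub>R \<rho> z"
        proof (intro always_eventually allI)
          fix z :: "real^'n"
          have "(\<lambda>m. y + (1 / real (Suc m)) *\<^sub>R z) \<longlonglongrightarrow> y + 0 *\<^sub>R z"
            by (intro tendsto_add tendsto_const tendsto_scaleR LIMSEQ_Suc[OF lim_1_over_n])
          then have "(\<lambda>m. indicator (box a b) (y + (1 / real (Suc m)) *\<^sub>R z) :: real) \<longlonglongrightarrow> indicator (box a b) y"
            using elim isCont_indicator[of y "box a b"] isCont_tendsto_compose[of y "indicator (box a b) :: _ \<Rightarrow> real"] by simp
          then show "(\<lambda>m. indicator (box a b) (y + (1 / real (Suc m)) *\<^sub>R z) *\<^sub>R \<rho> z) \<longlonglongrightarrow> indicator (box a b) y *\<^sub>R \<rho> z"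
            by (intro tendsto_scaleR tendsto_const)
        qed
        show "AE z in lborel. norm (indicator (box a b) (y + (1 / real (Suc m)) *\<^sub>R z) *\<^sub>R \<rho> z) \<le> norm (\<rho> z)" for m
          by (auto simp: indicator_def)
      qed (use i\<rho> in \<open>auto\<close>)
      then show ?case by (intro tendsto_mult tendsto_const) simp
    qed
  qed measurable
  have "0 = (LINT y|lborel. H y * (indicator (box a b) y *\<^sub>R (LINT z|lborel. \<rho> z)))"
    using LIMSEQ_unique[OF lim] unfolding GH by auto
  also have "\<dots> = (LINT y|lborel. (indicator (box a b) y *\<^sub>R h y) * (LINT z|lborel. \<rho> z))"
    using L R(1) by (intro Bochner_Integration.integral_cong) (force simp: H_def indicator_def)+
  finally show "(LINT x|lborel. indicator (box a b) x *\<^sub>R h x) = 0"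
    using c0 by (simp only: integral_mult_left_zero) simp
qed

section \<open>Borel versions and uniqueness for Lebesgue measurable functions\<close>

lemma locally_integrable_measurable:
  fixes f :: "real^'n::finite \<Rightarrow> 'b::{banach, second_countable_topology}"
  assumes "locally_integrable f"
  shows "f \<in> borel_measurable lebesgue"
proof (rule borel_measurable_LIMSEQ_metric)
  fix i :: nat
  show "(\<lambda>x. indicator (cball 0 (real i)) x *\<^sub>R f x) \<in> borel_measurable lebesgue"
    using assms unfolding locally_integrable_def set_integrable_def by (intro borel_measurable_integrable) auto
next
  fix x :: "real^'n"
  obtain N :: nat where "norm x < N" using reals_Archimedean2 by blast
  then have "\<forall>i\<ge>N. indicator (cball 0 (real i)) x *\<^sub>R f x = f x" by auto
  then show "(\<lambda>i. indicator (cball 0 (real i)) x *\<^sub>R f x) \<longlonglongrightarrow> f x"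
    by (intro tendsto_eventually) (auto simp: eventually_sequentially)
qed

lemma borel_version_real:
  fixes f :: "real^'n::finite \<Rightarrow> real"
  assumes "f \<in> borel_measurable lebesgue"
  obtains f' where "f' \<in> borel_measurable borel" "AE x in lebesgue. f x = f' x"
  using completion_ex_borel_measurable_real[OF assms] by (auto simp: AE_completion_iff)

lemma borel_version_complex:
  fixes f :: "real^'n::finite \<Rightarrow> complex"
  assumes [measurable]: "f \<in> borel_measurable lebesgue"
  obtains f' where "f' \<in> borel_measurable borel" "AE x in lebesgue. f x = f' x"
proof -
  obtain a where a[measurable]: "a \<in> borel_measurable borel" "AE x in lebesgue. Re (f x) = a x"
    using borel_version_real[of "\<lambda>x. Re (f x)"] by auto
  obtain b where b[measurable]: "b \<in> borel_measurable borel" "AE x in lebesgue. Im (f x) = b x"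
    using borel_version_real[of "\<lambda>x. Im (f x)"] by auto
  have "AE x in lebesgue. f x = complex_of_real (a x) + \<i> * complex_of_real (b x)"
    using a(2) b(2) by eventually_elim (metis complex_eq)
  moreover have "(\<lambda>x. complex_of_real (a x) + \<i> * complex_of_real (b x)) \<in> borel_measurable borel" by measurable
  ultimately show ?thesis using that by blast
qed

text \<open>A Borel version of h carries the hypotheses over to \<open>lborel\<close>, where Fubini
  and the change of variables have been carried out.\<close>

lemma AE_eq_0_if_test_integrals_eq_0:
  fixes h \<kappa> :: "real^'n::finite \<Rightarrow> complex"
  assumes li: "locally_integrable h"
    and zero: "\<And>\<psi>. \<psi> \<in> test_functions \<Longrightarrow> (LINT x|lebesgue. h x * \<psi> x) = 0"
    and \<kappa>: "\<kappa> \<in> test_functions" "\<kappa> 0 = 1"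
  shows "AE x in lebesgue. h x = 0"
proof -
  have hm[measurable]: "h \<in> borel_measurable lebesgue" using locally_integrable_measurable[OF li] .
  obtain h' where h'[measurable]: "h' \<in> borel_measurable borel" and ae: "AE x in lebesgue. h x = h' x"
    using borel_version_complex[OF hm] by blast
  have h'l[measurable]: "h' \<in> borel_measurable lebesgue" by (rule measurable_completion) simp
  have "AE x in lborel. h' x = 0"
  proof (rule AE_eq_0_if_test_integrals_eq_0_borel[OF h' _ _ \<kappa>])
    fix K :: "(real^'n) set" assume K: "compact K"
    then have [measurable]: "K \<in> sets borel" by (simp add: borel_compact)
    have [measurable]: "K \<in> sets lebesgue" by (rule sets_completionI_sets) simp
    have "integrable lebesgue (\<lambda>x. indicator K x *\<^sub>R h x)"
      using li K unfolding locally_integrable_def set_integrable_def by blast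
    then have "integrable lebesgue (\<lambda>x. indicator K x *\<^sub>R h' x)"
      by (rule integrable_cong_AE_imp) (use ae in \<open>auto\<close>)
    then show "integrable lborel (\<lambda>x. indicator K x *\<^sub>R h' x)" by (subst (asm) integrable_completion) measurable
  next
    fix \<psi> :: "real^'n \<Rightarrow> complex" assume \<psi>: "\<psi> \<in> test_functions"
    have [measurable]: "\<psi> \<in> borel_measurable borel" using \<psi> schwartz_borel_measurable test_functions_subset_schwartz by blast
    have [measurable]: "\<psi> \<in> borel_measurable lebesgue" by (rule measurable_completion) simp
    have "(LINT x|lborel. h' x * \<psi> x) = (LINT x|lebesgue. h' x * \<psi> x)" by (subst integral_completion) auto
    also have "\<dots> = (LINT x|lebesgue. h x * \<psi> x)" by (rule integral_cong_AE) (use ae in \<open>auto\<close>)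
    finally show "(LINT x|lborel. h' x * \<psi> x) = 0" using zero[OF \<psi>] by simp
  qed
  then have "AE x in lebesgue. h' x = 0" by (rule AE_completion)
  then show ?thesis using ae by eventually_elim simp
qed

lemma locally_integrable_mult_test:
  fixes g \<psi> :: "real^'n::finite \<Rightarrow> complex"
  assumes g: "locally_integrable g" and \<psi>: "\<psi> \<in> test_functions"
  shows "integrable lebesgue (\<lambda>x. g x * \<psi> x)"
proof -
  obtain R where R: "\<And>x. norm x > R \<Longrightarrow> \<psi> x = 0" using test_functionsE[OF \<psi>] by blast
  obtain M where M: "\<And>x. norm (\<psi> x) \<le> M" using test_functions_bounded[OF \<psi>, of "\<lambda>_. 1"] by auto
  have [measurable]: "g \<in> borel_measurable lebesgue" using locally_integrable_measurable[OF g] .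
  have "\<psi> \<in> borel_measurable borel" using \<psi> schwartz_borel_measurable test_functions_subset_schwartz by blast
  then have [measurable]: "\<psi> \<in> borel_measurable lebesgue" by (intro measurable_completion) simp
  have "integrable lebesgue (\<lambda>x. M *\<^sub>R indicator (cball 0 R) x *\<^sub>R g x)"
    using g unfolding locally_integrable_def set_integrable_def by (intro integrable_scaleR_right) simp
  then show ?thesis
  proof (rule Bochner_Integration.integrable_bound)
    show "AE x in lebesgue. norm (g x * \<psi> x) \<le> norm (M *\<^sub>R indicator (cball 0 R) x *\<^sub>R g x)"
    proof (intro always_eventually allI)
      fix x
      show "norm (g x * \<psi> x) \<le> norm (M *\<^sub>R indicator (cball 0 R) x *\<^sub>R g x)"
        using R[of x] order_trans[OF M abs_ge_self]
        by (cases "norm x \<le> R") (auto simp: norm_mult mult.commute[of _ "norm (g x)"] intro!: mult_left_mono)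
    qed
  qed measurable
qed

text \<open>This is what makes \<open>distr_Lp_norm\<close> computable: any single representing
  function, such as an explicit convolution, gives its value. \<kappa> feeds the mollification and
  is later taken to be \<open>\<phi> 0\<close>.\<close>

lemma represents_AE_unique:
  fixes g h \<kappa> :: "real^'n::finite \<Rightarrow> complex"
  assumes g: "represents g u" and h: "represents h u"
    and \<kappa>: "\<kappa> \<in> test_functions" "\<kappa> 0 = 1"
  shows "AE x in lebesgue. g x = h x"
proof -
  have l: "locally_integrable g" "locally_integrable h" using g h unfolding represents_def by auto
  have "AE x in lebesgue. g x - h x = 0"
  proof (rule AE_eq_0_if_test_integrals_eq_0[OF _ _ \<kappa>])
    show "locally_integrable (\<lambda>x. g x - h x)"
      using l unfolding locally_integrable_def by (auto intro: set_integral_diff(1))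
    fix \<psi> :: "real^'n \<Rightarrow> complex" assume \<psi>: "\<psi> \<in> test_functions"
    have "(LINT x|lebesgue. (g x - h x) * \<psi> x) = (LINT x|lebesgue. g x * \<psi> x) - (LINT x|lebesgue. h x * \<psi> x)"
      unfolding left_diff_distrib
      by (rule Bochner_Integration.integral_diff[OF locally_integrable_mult_test[OF l(1) \<psi>] locally_integrable_mult_test[OF l(2) \<psi>]])
    moreover have "u \<psi> = (LINT x|lebesgue. g x * \<psi> x)" "u \<psi> = (LINT x|lebesgue. h x * \<psi> x)"
      using g h \<psi> unfolding represents_def by blast+
    ultimately show "(LINT x|lebesgue. (g x - h x) * \<psi> x) = 0" by simp
  qed
  then show ?thesis by simp
qed

section \<open>Values of tempered distributions on Schwartz functions\<close>

lemma cutoff_test_function: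
  fixes \<kappa> \<psi> :: "real^'n::finite \<Rightarrow> complex"
  assumes \<kappa>: "\<kappa> \<in> test_functions" and \<psi>: "smooth \<psi>"
  shows "(\<lambda>x. \<kappa> ((1 / Suc n) *\<^sub>R x) * \<psi> x) \<in> test_functions"
proof -
  obtain R where R: "\<And>x. norm x > R \<Longrightarrow> \<kappa> x = 0" using test_functionsE[OF \<kappa>] by blast
  have "smooth (\<lambda>x. \<kappa> ((1 / Suc n) *\<^sub>R x))" using smooth_affine[OF test_functions_smooth[OF \<kappa>], of 0 "1 / Suc n"] by simp
  moreover have "\<kappa> ((1 / Suc n) *\<^sub>R x) = 0" if "norm x > R * Suc n" for x
    using that by (intro R) (simp add: field_simps)
  ultimately have "(\<lambda>x. \<kappa> ((1 / Suc n) *\<^sub>R x)) \<in> test_functions" unfolding test_functions_iff by blast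
  then show ?thesis using \<psi> by (rule test_functions_mult)
qed

lemma tempered_tendsto_cutoff:
  fixes \<kappa> \<psi> :: "real^'n::finite \<Rightarrow> complex"
  assumes \<kappa>: "\<kappa> \<in> test_functions" "\<And>x. norm x < 1 \<Longrightarrow> \<kappa> x = 1" and \<psi>: "\<psi> \<in> schwartz" and u: "tempered u"
  shows "(\<lambda>n. u (\<lambda>x. \<kappa> ((1 / Suc n) *\<^sub>R x) * \<psi> x)) \<longlonglongrightarrow> u \<psi>"
  using u cutoff_schwartz_tendsto[OF \<kappa> \<psi>] \<psi>
    test_functions_subset_schwartz[OF cutoff_test_function[OF \<kappa>(1) schwartz_smooth[OF \<psi>]]]
  unfolding tempered_def by (simp add: image_subset_iff)

text \<open>Both functionals agree on the cutoffs of \<psi>, which are test functions, and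
  continuity passes this on to \<psi>. It makes \<open>besov_norm\<close> independent of the
  distribution chosen for f.\<close>

lemma tempered_eq_on_schwartz:
  fixes \<kappa> \<psi> :: "real^'n::finite \<Rightarrow> complex"
  assumes \<kappa>: "\<kappa> \<in> test_functions" "\<And>x. norm x < 1 \<Longrightarrow> \<kappa> x = 1" and u: "tempered u" and v: "tempered v"
    and g: "represents g u" "represents g v" and \<psi>: "\<psi> \<in> schwartz"
  shows "u \<psi> = v \<psi>"
proof -
  have "u (\<lambda>x. \<kappa> ((1 / Suc n) *\<^sub>R x) * \<psi> x) = v (\<lambda>x. \<kappa> ((1 / Suc n) *\<^sub>R x) * \<psi> x)" for n
    using g cutoff_test_function[OF \<kappa>(1) schwartz_smooth[OF \<psi>], of n] unfolding represents_def by simp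
  then show ?thesis
    using tempered_tendsto_cutoff[OF \<kappa> \<psi> u] tempered_tendsto_cutoff[OF \<kappa> \<psi> v] LIMSEQ_unique by simp
qed

text \<open>Continuity of u along the cutoffs is matched with dominated convergence of the
  integrals, with majorant M |f \<psi>|. In this way u can be evaluated at the Schwartz functions
  that arise from the dyadic multipliers.\<close>

lemma tempered_represented_on_schwartz:
  fixes \<kappa> \<psi> f :: "real^'n::finite \<Rightarrow> complex"
  assumes \<kappa>: "\<kappa> \<in> test_functions" "\<And>x. norm x < 1 \<Longrightarrow> \<kappa> x = 1" and u: "tempered u"
    and f: "represents f u" and \<psi>: "\<psi> \<in> schwartz" and int: "integrable lebesgue (\<lambda>x. f x * \<psi> x)"
  shows "u \<psi> = (LINT x|lebesgue. f x * \<psi> x)"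
proof -
  let ?k = "\<lambda>n x. \<kappa> ((1 / real (Suc n)) *\<^sub>R x) * \<psi> x"
  have [measurable]: "f \<in> borel_measurable lebesgue"
    using f locally_integrable_measurable unfolding represents_def by blast
  have t: "?k n \<in> test_functions" for n by (rule cutoff_test_function[OF \<kappa>(1) schwartz_smooth[OF \<psi>]])
  have "?k n \<in> borel_measurable borel" for n using t schwartz_borel_measurable test_functions_subset_schwartz by blast
  then have [measurable]: "?k n \<in> borel_measurable lebesgue" for n by (intro measurable_completion) simp
  have [measurable]: "\<psi> \<in> borel_measurable lebesgue"
    using schwartz_borel_measurable[OF \<psi>] by (intro measurable_completion) simp
  obtain M where M: "\<And>x. norm (\<kappa> x) \<le> M" using test_functions_bounded[OF \<kappa>(1), of "\<lambda>_. 1"] by auto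
  have "(\<lambda>n. LINT x|lebesgue. f x * ?k n x) \<longlonglongrightarrow> (LINT x|lebesgue. f x * \<psi> x)"
  proof (rule integral_dominated_convergence[where w = "\<lambda>x. M * norm (f x * \<psi> x)"])
    show "integrable lebesgue (\<lambda>x. M * norm (f x * \<psi> x))" using int by auto
    show "AE x in lebesgue. (\<lambda>n. f x * ?k n x) \<longlonglongrightarrow> f x * \<psi> x"
    proof (rule always_eventually, rule allI, rule tendsto_eventually)
      fix x :: "real^'n"
      obtain N :: nat where N: "norm x < N" using reals_Archimedean2 by blast
      have "\<kappa> ((1 / real (Suc n)) *\<^sub>R x) = 1" if "n \<ge> N" for n
        using N that by (intro \<kappa>(2)) (simp add: field_simps)
      then show "\<forall>\<^sub>F n in sequentially. f x * ?k n x = f x * \<psi> x"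
        unfolding eventually_sequentially by (intro exI[of _ N]) simp
    qed
    show "AE x in lebesgue. norm (f x * ?k n x) \<le> M * norm (f x * \<psi> x)" for n
    proof (intro always_eventually allI)
      fix x
      have "norm (f x * ?k n x) = norm (\<kappa> ((1 / real (Suc n)) *\<^sub>R x)) * norm (f x * \<psi> x)" by (simp add: norm_mult)
      also have "\<dots> \<le> M * norm (f x * \<psi> x)" by (intro mult_right_mono M) auto
      finally show "norm (f x * ?k n x) \<le> M * norm (f x * \<psi> x)" .
    qed
  qed measurable
  moreover have "u (?k n) = (LINT x|lebesgue. f x * ?k n x)" for n
    using f t unfolding represents_def by blast
  ultimately show ?thesis using tempered_tendsto_cutoff[OF \<kappa> \<psi> u] LIMSEQ_unique by simp
qed

text \<open>The convolution theorem in the form that Fubini gives directly: the two exponentials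
  combine to e^(-i x.(\<xi> - y)), whose integral against \<phi> is
  \<open>fourier \<phi> (\<xi> - y)\<close>. Of the two normalising factors one is absorbed in that
  transform and the other remains.\<close>

lemma fourier_mult_inv_fourier:
  fixes \<phi> \<psi> :: "real^'n::finite \<Rightarrow> complex"
  assumes \<phi>: "\<phi> \<in> test_functions" and \<psi>: "\<psi> \<in> test_functions"
  shows "fourier (\<lambda>x. \<phi> x * inv_fourier \<psi> x) \<xi> =
    complex_of_real ((2 * pi) powr (- real CARD('n) / 2)) * (LINT y|lborel. fourier \<phi> (\<xi> - y) * \<psi> y)"
proof -
  define c where "c = complex_of_real ((2 * pi) powr (- real CARD('n) / 2))"
  let ?e = "\<lambda>x y::real^'n. exp (- \<i> * complex_of_real (x \<bullet> y))"
  let ?f = "\<lambda>x y. ?e x (\<xi> - y) * \<phi> x * \<psi> y"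
  have [measurable]: "\<psi> \<in> borel_measurable borel" "\<phi> \<in> borel_measurable borel"
    using \<psi> \<phi> schwartz_borel_measurable test_functions_subset_schwartz by blast+
  have i: "integrable lborel \<psi>" "integrable lborel \<phi>"
    using \<psi> \<phi> schwartz_integrable test_functions_subset_schwartz by blast+
  have int: "integrable (lborel \<Otimes>\<^sub>M lborel) (\<lambda>(x, y). ?f x y)"
  proof (rule lborel_pair.Fubini_integrable)
    show "(\<lambda>(x, y). ?f x y) \<in> borel_measurable (lborel \<Otimes>\<^sub>M lborel)" by measurable
    show "integrable lborel (\<lambda>x. LINT y|lborel. norm (case (x, y) of (x, y) \<Rightarrow> ?f x y))"
      using i by (simp add: norm_mult)
    have "integrable lborel (\<lambda>y. ?f x y)" for x
      using integrable_test_function[OF \<psi>, of "\<lambda>y. ?e x (\<xi> - y) * \<phi> x"] by (simp add: continuous_intros)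
    then show "AE x in lborel. integrable lborel (\<lambda>y. case (x, y) of (x, y) \<Rightarrow> ?f x y)" by simp
  qed
  have ee: "?e x \<xi> * exp (\<i> * complex_of_real (x \<bullet> y)) = ?e x (\<xi> - y)" for x y
    by (simp add: inner_diff_right exp_add[symmetric] algebra_simps)
  have "fourier (\<lambda>x. \<phi> x * inv_fourier \<psi> x) \<xi> = c * (c * (LINT x|lborel. LINT y|lborel. ?f x y))"
  proof -
    have "?e x \<xi> * (\<phi> x * (c * (LINT y|lborel. exp (\<i> * complex_of_real (x \<bullet> y)) * \<psi> y))) = c * (LINT y|lborel. ?f x y)" for x
      unfolding ee[symmetric] by (simp add: mult_ac flip: integral_mult_right_zero)
    then show ?thesis unfolding fourier_def inv_fourier_def c_def[symmetric] by (simp only: integral_mult_right_zero)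
  qed
  also have "(LINT x|lborel. LINT y|lborel. ?f x y) = (LINT y|lborel. LINT x|lborel. ?f x y)"
    using lborel_pair.Fubini_integral[OF int] by simp
  also have "c * \<dots> = (LINT y|lborel. fourier \<phi> (\<xi> - y) * \<psi> y)"
    unfolding fourier_def c_def by (simp only: mult.assoc flip: integral_mult_left_zero integral_mult_right_zero)
  finally show ?thesis unfolding c_def .
qed


section \<open>Functions of bounded mean oscillation\<close>


lemma ennreal_mult3: "0 \<le> a \<Longrightarrow> 0 \<le> b \<Longrightarrow> 0 \<le> c \<Longrightarrow> ennreal (a * (b * c)) = ennreal a * (ennreal b * ennreal c)"
  by (simp add: ennreal_mult)

lemma average_lborel:
  fixes f :: "real^'n::finite \<Rightarrow> real"
  assumes [measurable]: "f \<in> borel_measurable borel" "Q \<in> sets borel"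
  shows "average Q f = (LINT x|lborel. indicator Q x * f x) / measure lborel Q"
  unfolding average_def set_lebesgue_integral_def
  by (subst integral_completion) (auto simp: measure_completion)

lemma locally_integrable_lborel:
  fixes f :: "real^'n::finite \<Rightarrow> 'b::{banach, second_countable_topology}"
  assumes f[measurable]: "f \<in> borel_measurable borel" and li: "locally_integrable f" and K: "compact K"
  shows "integrable lborel (\<lambda>x. indicator K x *\<^sub>R f x)"
proof -
  have [measurable]: "K \<in> sets borel" using K by (simp add: borel_compact)
  have "integrable lebesgue (\<lambda>x. indicator K x *\<^sub>R f x)"
    using li K unfolding locally_integrable_def set_integrable_def by blast
  then show ?thesis by (subst (asm) integrable_completion) measurable
qed

lemma cubeE:
  fixes Q :: "(real^'n::finite) set"
  assumes "cube Q"
  shows "compact Q" "Q \<in> sets borel" "measure lborel Q > 0" "integrable lborel (indicator Q :: _ \<Rightarrow> real)"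
    "measure lebesgue Q = measure lborel Q"
proof -
  obtain a l where l: "l > 0" "Q = cbox a (\<chi> i. a $ i + l)" using assms unfolding cube_def by blast
  show c: "compact Q" and b: "Q \<in> sets borel" using l by auto
  show "measure lborel Q > 0" using l measure_cbox_side[of l a] by simp
  show "integrable lborel (indicator Q :: _ \<Rightarrow> real)"
    using l by (intro integrable_real_indicator) (auto simp: emeasure_lborel_cbox_eq)
  show "measure lebesgue Q = measure lborel Q" using b by (simp add: measure_completion)
qed

context
  fixes f :: "real^'n::finite \<Rightarrow> real" and N :: real
  assumes f[measurable]: "f \<in> borel_measurable borel" and li: "locally_integrable f"
    and N: "bmo_norm f = ennreal N" "N \<ge> 0"
begin

lemma integrable_cube_diff:
  assumes "cube Q"
  shows "integrable lborel (\<lambda>x. indicator Q x * (f x - c))" "integrable lborel (\<lambda>x. indicator Q x * \<bar>f x - c\<bar>)"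
proof -
  show 1: "integrable lborel (\<lambda>x. indicator Q x * (f x - c))"
    using locally_integrable_lborel[OF f li cubeE(1)[OF assms]] integrable_mult_left[OF cubeE(4)[OF assms], of c]
    by (simp add: right_diff_distrib)
  have "\<bar>indicator Q x * (f x - c)\<bar> = indicator Q x * \<bar>f x - c\<bar>" for x by (simp add: abs_mult)
  then show "integrable lborel (\<lambda>x. indicator Q x * \<bar>f x - c\<bar>)" using integrable_abs[OF 1] by simp
qed

lemma large_cube_integral_abs:
  assumes "cube Q" "measure lborel Q > 1"
  shows "(LINT x|lborel. indicator Q x * \<bar>f x\<bar>) \<le> N * measure lborel Q"
proof -
  have "ennreal (average Q (\<lambda>x. \<bar>f x\<bar>)) \<le> (SUP Q\<in>{Q. cube Q \<and> measure lebesgue Q > 1}. ennreal (average Q (\<lambda>x. \<bar>f x\<bar>)))"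
    using assms cubeE(5)[OF assms(1)] by (intro SUP_upper) auto
  also have "\<dots> \<le> bmo_norm f" unfolding bmo_norm_def using li by (simp add: le_iff_add add.commute)
  finally have "average Q (\<lambda>x. \<bar>f x\<bar>) \<le> N" using N by simp
  then show ?thesis using cubeE(2,3)[OF assms(1)] by (simp add: average_lborel pos_divide_le_eq)
qed

text \<open>For volume at most 1 the norm bounds the mean oscillation by N. For larger cubes it
  bounds the mean of |f|; the average is then at most N as well and the triangle inequality gives
  2N. One bound for all sizes lets the dyadic dilates pass through volume 1.\<close>

lemma cube_integral_oscillation:
  assumes "cube Q"
  shows "(LINT x|lborel. indicator Q x * \<bar>f x - average Q f\<bar>) \<le> 2 * N * measure lborel Q"
proof (cases "measure lborel Q \<le> 1")
  case True
  have "ennreal (average Q (\<lambda>x. \<bar>f x - average Q f\<bar>)) \<le>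
    (SUP Q\<in>{Q. cube Q \<and> measure lebesgue Q \<le> 1}. ennreal (average Q (\<lambda>x. \<bar>f x - average Q f\<bar>)))"
    using assms True cubeE(5)[OF assms(1)] by (intro SUP_upper) auto
  also have "\<dots> \<le> bmo_norm f" unfolding bmo_norm_def using li by (simp add: le_iff_add)
  finally have "average Q (\<lambda>x. \<bar>f x - average Q f\<bar>) \<le> N" using N by simp
  then have "(LINT x|lborel. indicator Q x * \<bar>f x - average Q f\<bar>) \<le> N * measure lborel Q"
    using cubeE(2,3)[OF assms(1)] by (simp add: average_lborel[of "\<lambda>x. \<bar>f x - average Q f\<bar>"] pos_divide_le_eq)
  also have "\<dots> \<le> 2 * N * measure lborel Q" using N by (intro mult_right_mono) auto
  finally show ?thesis .
next
  case False
  have abs_le: "(LINT x|lborel. indicator Q x * \<bar>f x\<bar>) \<le> N * measure lborel Q"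
    using large_cube_integral_abs[OF assms] False by simp
  have i: "integrable lborel (\<lambda>x. indicator Q x * \<bar>f x\<bar>)" "integrable lborel (\<lambda>x. indicator Q x * f x)"
    using integrable_cube_diff[OF assms, of 0] by simp_all
  have "\<bar>LINT x|lborel. indicator Q x * f x\<bar> \<le> (LINT x|lborel. indicator Q x * \<bar>f x\<bar>)"
    using integral_abs_bound[of lborel "\<lambda>x. indicator Q x * f x"] by (simp add: abs_mult)
  then have "\<bar>average Q f\<bar> * measure lborel Q \<le> N * measure lborel Q"
    using abs_le cubeE(2,3)[OF assms] by (simp add: average_lborel)
  moreover have "(LINT x|lborel. indicator Q x * \<bar>f x - average Q f\<bar>) \<le>
    (LINT x|lborel. indicator Q x * \<bar>f x\<bar> + indicator Q x * \<bar>average Q f\<bar>)"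
    using integrable_cube_diff[OF assms] i cubeE(4)[OF assms]
    by (intro integral_mono Bochner_Integration.integrable_add integrable_mult_left) (auto split: split_indicator)
  moreover have "\<dots> = (LINT x|lborel. indicator Q x * \<bar>f x\<bar>) + measure lborel Q * \<bar>average Q f\<bar>"
    using i cubeE(2,4)[OF assms] by (subst Bochner_Integration.integral_add) auto
  ultimately show ?thesis using abs_le unfolding mult.commute[of "measure lborel Q"] by linarith
qed

text \<open>The mean of |f - f_Q| over the smaller cube P is at most the volume ratio, 2^d in
  dimension d, times its mean over Q.\<close>

lemma average_doubling:
  assumes "r > 0"
  shows "\<bar>average (centered_cube y r) f - average (centered_cube y (2 * r)) f\<bar> \<le> 2 ^ CARD('n) * (2 * N)"
proof -
  define P Q where "P = centered_cube y r" and "Q = centered_cube y (2 * r)"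
  have c: "cube P" "cube Q" unfolding P_def Q_def using assms by (auto intro: cube_centered_cube)
  have PQ: "P \<subseteq> Q" unfolding P_def Q_def centered_cube_def using assms
    by (auto simp: mem_box_cart) (smt (verit) field_sum_of_halves)+
  have m: "measure lborel Q = 2 ^ CARD('n) * measure lborel P" "measure lborel P > 0"
    unfolding P_def Q_def using assms by (simp_all add: measure_centered_cube power_mult_distrib)
  let ?a = "average Q f"
  have "(LINT x|lborel. indicator P x * (f x - ?a)) = (LINT x|lborel. indicator P x * f x) - ?a * measure lborel P"
    using integrable_cube_diff(1)[OF c(1), of 0] cubeE(2,4)[OF c(1)] by (simp add: right_diff_distrib mult.commute)
  then have "(average P f - ?a) * measure lborel P = (LINT x|lborel. indicator P x * (f x - ?a))"
    using m cubeE(2)[OF c(1)] by (simp add: average_lborel[of f P] left_diff_distrib)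
  then have "\<bar>average P f - ?a\<bar> * measure lborel P = \<bar>LINT x|lborel. indicator P x * (f x - ?a)\<bar>"
    using m by (metis abs_mult abs_of_pos)
  also have "\<dots> \<le> (LINT x|lborel. indicator P x * \<bar>f x - ?a\<bar>)"
    using integral_abs_bound[of lborel "\<lambda>x. indicator P x * (f x - ?a)"] by (simp add: abs_mult)
  also have "\<dots> \<le> (LINT x|lborel. indicator Q x * \<bar>f x - ?a\<bar>)"
    using PQ integrable_cube_diff[OF c(1)] integrable_cube_diff[OF c(2)]
    by (intro integral_mono mult_right_mono) (auto simp: indicator_def)
  also have "\<dots> \<le> 2 * N * (2 ^ CARD('n) * measure lborel P)"
    using cube_integral_oscillation[OF c(2)] m by simp
  finally have "\<bar>average P f - ?a\<bar> \<le> 2 * N * 2 ^ CARD('n)" using m(2) by (simp flip: mult.assoc)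
  then show ?thesis unfolding P_def Q_def by (simp add: mult.commute)
qed

lemma average_dyadic:
  assumes "r > 0"
  shows "\<bar>average (centered_cube y (2 ^ k * r)) f - average (centered_cube y r) f\<bar> \<le> real k * (2 ^ CARD('n) * (2 * N))"
proof (induction k)
  case (Suc k)
  have "\<bar>average (centered_cube y (2 ^ k * r)) f - average (centered_cube y (2 * (2 ^ k * r))) f\<bar> \<le> 2 ^ CARD('n) * (2 * N)"
    using assms by (intro average_doubling) simp
  then show ?case using Suc by (simp add: algebra_simps abs_le_iff)
qed simp

lemma oscillation_decay_weight:
  assumes r: "r > 0"
  shows "(\<integral>\<^sup>+x. ennreal \<bar>f x - average (centered_cube y r) f\<bar> * ennreal (1 / (1 + norm (x - y) / r) ^ (CARD('n) + 1)) \<partial>lborel) \<le>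
    ennreal (4 ^ (CARD('n) + 2) * (2 ^ (CARD('n) + 1) * N) * r ^ CARD('n))"
proof (rule nn_integral_decay_weight[OF _ r])
  let ?a = "average (centered_cube y r) f"
  fix k
  define Q where "Q = centered_cube y (2 ^ k * r)"
  have Q: "cube Q" unfolding Q_def using r by (intro cube_centered_cube) simp
  have mQ: "measure lborel Q = (2 ^ k * r) ^ CARD('n)" unfolding Q_def using r by (intro measure_centered_cube) simp
  have "(\<integral>\<^sup>+x. ennreal \<bar>f x - ?a\<bar> * indicator Q x \<partial>lborel) = (\<integral>\<^sup>+x. ennreal (indicator Q x * \<bar>f x - ?a\<bar>) \<partial>lborel)"
    by (intro nn_integral_cong) (auto simp: indicator_def)
  also have "\<dots> = ennreal (LINT x|lborel. indicator Q x * \<bar>f x - ?a\<bar>)"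
    using integrable_cube_diff(2)[OF Q] by (intro nn_integral_eq_integral) auto
  also have "\<dots> \<le> ennreal (2 ^ (CARD('n) + 1) * N * real (Suc k) * (2 ^ k * r) ^ CARD('n))"
  proof (rule ennreal_leI)
    let ?b = "average Q f"
    have "(LINT x|lborel. indicator Q x * \<bar>f x - ?a\<bar>) \<le> (LINT x|lborel. indicator Q x * \<bar>f x - ?b\<bar> + indicator Q x * \<bar>?b - ?a\<bar>)"
      using integrable_cube_diff[OF Q] cubeE(4)[OF Q]
      by (intro integral_mono Bochner_Integration.integrable_add integrable_mult_left) (auto split: split_indicator)
    also have "\<dots> = (LINT x|lborel. indicator Q x * \<bar>f x - ?b\<bar>) + measure lborel Q * \<bar>?b - ?a\<bar>"
      using integrable_cube_diff[OF Q] cubeE(2,4)[OF Q] by (subst Bochner_Integration.integral_add) auto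
    also have "\<dots> \<le> 2 * N * measure lborel Q + measure lborel Q * (real k * (2 ^ CARD('n) * (2 * N)))"
      using average_dyadic[OF r, of y k] unfolding Q_def[symmetric]
      by (intro add_mono cube_integral_oscillation Q mult_left_mono) auto
    \<comment> \<open>Enlarging the first term makes both terms multiples of the same constant and
      produces the factor k + 1 that \<open>nn_integral_decay_weight\<close> expects.\<close>
    also have "\<dots> \<le> 2 ^ CARD('n) * (2 * N) * measure lborel Q + measure lborel Q * (real k * (2 ^ CARD('n) * (2 * N)))"
    proof -
      have "1 * (2 * N) \<le> 2 ^ CARD('n) * (2 * N)" using N by (intro mult_right_mono) auto
      then show ?thesis by (intro add_right_mono mult_right_mono) auto
    qed
    also have "\<dots> = 2 ^ (CARD('n) + 1) * N * real (Suc k) * (2 ^ k * r) ^ CARD('n)"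
      unfolding mQ by (simp add: algebra_simps)
    finally show "(LINT x|lborel. indicator Q x * \<bar>f x - ?a\<bar>) \<le> 2 ^ (CARD('n) + 1) * N * real (Suc k) * (2 ^ k * r) ^ CARD('n)" .
  qed
  finally show "(\<integral>\<^sup>+x. ennreal \<bar>f x - ?a\<bar> * indicator (centered_cube y (2 ^ k * r)) x \<partial>lborel) \<le>
    ennreal (2 ^ (CARD('n) + 1) * N * real (Suc k) * (2 ^ k * r) ^ CARD('n))" unfolding Q_def .
qed (use N in auto)

text \<open>The base side 2 gives every dilate volume strictly above 1, the range in which
  \<open>bmo_norm\<close> controls |f| itself; a unit cube would fall under the oscillation
  term.\<close>

lemma abs_decay_weight:
  "(\<integral>\<^sup>+x. ennreal \<bar>f x\<bar> * ennreal (1 / (1 + norm (x - y) / 2) ^ (CARD('n) + 1)) \<partial>lborel) \<le>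
    ennreal (4 ^ (CARD('n) + 2) * N * 2 ^ CARD('n))"
proof (rule nn_integral_decay_weight)
  fix k
  define Q where "Q = centered_cube y (2 ^ k * 2)"
  have Q: "cube Q" unfolding Q_def by (intro cube_centered_cube) simp
  have mQ: "measure lborel Q = (2 ^ k * 2) ^ CARD('n)" unfolding Q_def by (intro measure_centered_cube) simp
  have "(1::real) < 2 ^ k * 2" using one_le_power[of "2::real" k] by linarith
  then have large: "measure lborel Q > 1" unfolding mQ by (intro one_less_power) auto
  have "(\<integral>\<^sup>+x. ennreal \<bar>f x\<bar> * indicator Q x \<partial>lborel) = (\<integral>\<^sup>+x. ennreal (indicator Q x * \<bar>f x\<bar>) \<partial>lborel)"
    by (intro nn_integral_cong) (auto simp: indicator_def)
  also have "\<dots> = ennreal (LINT x|lborel. indicator Q x * \<bar>f x\<bar>)"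
    using integrable_cube_diff(2)[OF Q, of 0] by (intro nn_integral_eq_integral) auto
  also have "\<dots> \<le> ennreal (N * real (Suc k) * (2 ^ k * 2) ^ CARD('n))"
  proof (rule ennreal_leI)
    have "(LINT x|lborel. indicator Q x * \<bar>f x\<bar>) \<le> N * 1 * measure lborel Q"
      using large_cube_integral_abs[OF Q large] by simp
    also have "\<dots> \<le> N * real (Suc k) * measure lborel Q" using N by (intro mult_right_mono mult_left_mono) auto
    finally show "(LINT x|lborel. indicator Q x * \<bar>f x\<bar>) \<le> N * real (Suc k) * (2 ^ k * 2) ^ CARD('n)" unfolding mQ .
  qed
  finally show "(\<integral>\<^sup>+x. ennreal \<bar>f x\<bar> * indicator (centered_cube y (2 ^ k * 2)) x \<partial>lborel) \<le>
    ennreal (N * real (Suc k) * (2 ^ k * 2) ^ CARD('n))" unfolding Q_def .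
qed (use N in auto)

text \<open>A kernel concentrated at scale 1/R decays at least as fast as the weight at any coarser
  scale r, because |x - y| / r \<le> R |x - y|.\<close>

lemma kernel_weight:
  fixes L :: "real^'n \<Rightarrow> complex"
  assumes R: "R > 0" and L: "\<And>z. (1 + R * norm z) ^ (CARD('n) + 1) * norm (L z) \<le> D" and r: "1 / R \<le> r"
  shows "norm (L (x - y)) \<le> D * (1 / (1 + norm (x - y) / r) ^ (CARD('n) + 1))"
proof -
  have r0: "r > 0" using R r by (meson divide_pos_pos less_le_trans zero_less_one)
  have "1 \<le> R * r" using R r by (simp add: divide_le_eq mult.commute)
  have "norm (x - y) / r \<le> R * norm (x - y)"
    using mult_right_mono[OF \<open>1 \<le> R * r\<close>, of "norm (x - y)"] r0 by (simp add: divide_le_eq mult_ac)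
  then have "(1 + norm (x - y) / r) ^ (CARD('n) + 1) * norm (L (x - y)) \<le> (1 + R * norm (x - y)) ^ (CARD('n) + 1) * norm (L (x - y))"
    using r0 by (intro mult_right_mono power_mono) auto
  also have "\<dots> \<le> D" by (rule L)
  finally have 1: "(1 + norm (x - y) / r) ^ (CARD('n) + 1) * norm (L (x - y)) \<le> D" .
  have "(1 + norm (x - y) / r) ^ (CARD('n) + 1) > 0" using r0 by (intro zero_less_power add_pos_nonneg) auto
  then show ?thesis using 1 by (simp only: times_divide_eq_right mult_1_right pos_le_divide_eq mult.commute)
qed

text \<open>For R \<ge> 1/2 the kernel is dominated by the weight at scale 2. The bound is
  proportional to D, which for the dyadic kernels is taken of order R^d in dimension d: it gives
  integrability at every scale, but a bound free of R only together with cancellation or at a fixed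
  scale.\<close>

lemma bmo_kernel_nn_integral:
  fixes L :: "real^'n \<Rightarrow> complex"
  assumes [measurable]: "L \<in> borel_measurable borel"
    and R: "R \<ge> 1 / 2" and L: "\<And>z. (1 + R * norm z) ^ (CARD('n) + 1) * norm (L z) \<le> D"
  shows "(\<integral>\<^sup>+x. ennreal (norm (complex_of_real (f x) * L (x - y))) \<partial>lborel) \<le> ennreal (D * (4 ^ (CARD('n) + 2) * N * 2 ^ CARD('n)))"
proof -
  have D: "D \<ge> 0" using order_trans[OF _ L[of 0]] by simp
  have "(\<integral>\<^sup>+x. ennreal (norm (complex_of_real (f x) * L (x - y))) \<partial>lborel) \<le>
    (\<integral>\<^sup>+x. ennreal D * (ennreal \<bar>f x\<bar> * ennreal (1 / (1 + norm (x - y) / 2) ^ (CARD('n) + 1))) \<partial>lborel)"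
  proof (intro nn_integral_mono)
    fix x
    have "norm (complex_of_real (f x) * L (x - y)) \<le> D * (\<bar>f x\<bar> * (1 / (1 + norm (x - y) / 2) ^ (CARD('n) + 1)))"
      using mult_left_mono[OF kernel_weight[of R L D 2 x y, OF _ L] abs_ge_zero[of "f x"]] R
      by (simp add: norm_mult mult_ac divide_le_eq)
    then have "ennreal (norm (complex_of_real (f x) * L (x - y))) \<le> ennreal (D * (\<bar>f x\<bar> * (1 / (1 + norm (x - y) / 2) ^ (CARD('n) + 1))))"
      by (rule ennreal_leI)
    then show "ennreal (norm (complex_of_real (f x) * L (x - y))) \<le> ennreal D * (ennreal \<bar>f x\<bar> * ennreal (1 / (1 + norm (x - y) / 2) ^ (CARD('n) + 1)))"
      using D by (simp only: ennreal_mult3 abs_ge_zero zero_le_divide_1_iff zero_le_power add_nonneg_nonneg zero_le_one divide_nonneg_nonneg norm_ge_zero zero_le_numeral)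
  qed
  also have "\<dots> = ennreal D * (\<integral>\<^sup>+x. ennreal \<bar>f x\<bar> * ennreal (1 / (1 + norm (x - y) / 2) ^ (CARD('n) + 1)) \<partial>lborel)"
    by (intro nn_integral_cmult) measurable
  also have "\<dots> \<le> ennreal D * ennreal (4 ^ (CARD('n) + 2) * N * 2 ^ CARD('n))"
    by (intro mult_left_mono abs_decay_weight) auto
  also have "\<dots> = ennreal (D * (4 ^ (CARD('n) + 2) * N * 2 ^ CARD('n)))" using D N by (subst ennreal_mult) auto
  finally show ?thesis .
qed

lemma bmo_kernel_integrable:
  fixes L :: "real^'n \<Rightarrow> complex"
  assumes [measurable]: "L \<in> borel_measurable borel"
    and R: "R \<ge> 1 / 2" and L: "\<And>z. (1 + R * norm z) ^ (CARD('n) + 1) * norm (L z) \<le> D"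
  shows "integrable lborel (\<lambda>x. complex_of_real (f x) * L (x - y))"
    and "(LINT x|lborel. norm (complex_of_real (f x) * L (x - y))) \<le> D * (4 ^ (CARD('n) + 2) * N * 2 ^ CARD('n))"
proof -
  note b = bmo_kernel_nn_integral[OF assms, of y]
  have D: "D \<ge> 0" using order_trans[OF _ L[of 0]] by simp
  show i: "integrable lborel (\<lambda>x. complex_of_real (f x) * L (x - y))"
    using b by (intro integrableI_bounded) (auto intro: le_less_trans)
  show "(LINT x|lborel. norm (complex_of_real (f x) * L (x - y))) \<le> D * (4 ^ (CARD('n) + 2) * N * 2 ^ CARD('n))"
    using b D N by (intro integral_real_bounded) auto
qed

text \<open>Mean zero lets f be replaced by f - a, whose weighted integral at scale 1/R carries the
  factor (1/R)^d in dimension d. For D of order R^d the two cancel, which makes the bound uniform in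
  the scale.\<close>

lemma bmo_mean_zero_kernel_bound:
  fixes L :: "real^'n \<Rightarrow> complex"
  assumes [measurable]: "L \<in> borel_measurable borel"
    and R: "R \<ge> 1 / 2" and L: "\<And>z. (1 + R * norm z) ^ (CARD('n) + 1) * norm (L z) \<le> D"
    and zero: "(LINT z|lborel. L z) = 0"
  shows "norm (LINT x|lborel. complex_of_real (f x) * L (x - y)) \<le> D * (4 ^ (CARD('n) + 2) * (2 ^ (CARD('n) + 1) * N) * (1 / R) ^ CARD('n))"
proof -
  have D: "D \<ge> 0" using order_trans[OF _ L[of 0]] by simp
  have R0: "R > 0" using R by simp
  define a where "a = average (centered_cube y (1 / R)) f"
  have iL: "integrable lborel L" by (rule integrable_decay[OF _ R0 L]) simp
  have L': "integrable lborel (\<lambda>x. L (x - y))" "(LINT x|lborel. L (x - y)) = 0"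
    using lborel_integral_affine(2)[of 1 L "- y"] lborel_integral_affine(1)[of 1 L "- y"] iL zero by simp_all
  have eq: "(LINT x|lborel. complex_of_real (f x) * L (x - y)) = (LINT x|lborel. complex_of_real (f x - a) * L (x - y))"
    using L' bmo_kernel_integrable(1)[OF _ R L, of y] by (simp add: left_diff_distrib)
  have "(\<integral>\<^sup>+x. ennreal (norm (complex_of_real (f x - a) * L (x - y))) \<partial>lborel) \<le>
    (\<integral>\<^sup>+x. ennreal D * (ennreal \<bar>f x - a\<bar> * ennreal (1 / (1 + norm (x - y) / (1 / R)) ^ (CARD('n) + 1))) \<partial>lborel)"
  proof (intro nn_integral_mono)
    fix x
    have "norm (complex_of_real (f x - a) * L (x - y)) \<le> D * (\<bar>f x - a\<bar> * (1 / (1 + norm (x - y) / (1 / R)) ^ (CARD('n) + 1)))"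
      using mult_left_mono[OF kernel_weight[of R L D "1 / R" x y, OF R0 L order_refl] abs_ge_zero[of "f x - a"]]
      by (simp add: norm_mult mult_ac flip: of_real_diff)
    then have "ennreal (norm (complex_of_real (f x - a) * L (x - y))) \<le> ennreal (D * (\<bar>f x - a\<bar> * (1 / (1 + norm (x - y) / (1 / R)) ^ (CARD('n) + 1))))"
      by (rule ennreal_leI)
    then show "ennreal (norm (complex_of_real (f x - a) * L (x - y))) \<le> ennreal D * (ennreal \<bar>f x - a\<bar> * ennreal (1 / (1 + norm (x - y) / (1 / R)) ^ (CARD('n) + 1)))"
      using D less_imp_le[OF R0] by (simp only: ennreal_mult3 abs_ge_zero zero_le_divide_1_iff zero_le_power add_nonneg_nonneg zero_le_one divide_nonneg_nonneg norm_ge_zero)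
  qed
  also have "\<dots> = ennreal D * (\<integral>\<^sup>+x. ennreal \<bar>f x - a\<bar> * ennreal (1 / (1 + norm (x - y) / (1 / R)) ^ (CARD('n) + 1)) \<partial>lborel)"
    by (intro nn_integral_cmult) measurable
  also have "\<dots> \<le> ennreal D * ennreal (4 ^ (CARD('n) + 2) * (2 ^ (CARD('n) + 1) * N) * (1 / R) ^ CARD('n))"
    unfolding a_def using R0 by (intro mult_left_mono oscillation_decay_weight) auto
  also have "\<dots> = ennreal (D * (4 ^ (CARD('n) + 2) * (2 ^ (CARD('n) + 1) * N) * (1 / R) ^ CARD('n)))"
    using D N R0 by (subst ennreal_mult) auto
  finally have "(LINT x|lborel. norm (complex_of_real (f x - a) * L (x - y))) \<le> D * (4 ^ (CARD('n) + 2) * (2 ^ (CARD('n) + 1) * N) * (1 / R) ^ CARD('n))"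
    using D N R0 by (intro integral_real_bounded) auto
  then show ?thesis unfolding eq by (rule order_trans[OF integral_norm_bound])
qed

end


section \<open>Dyadic blocks\<close>


context
  fixes \<phi> :: "nat \<Rightarrow> real^'n::finite \<Rightarrow> complex"
  assumes dy: "dyadic_resolution \<phi>"
begin

lemma dyadic_eq_0_far: "norm x > 2 * 2 ^ j \<Longrightarrow> \<phi> j x = 0"
proof (rule ccontr)
  assume x: "norm x > 2 * 2 ^ j" and "\<phi> j x \<noteq> 0"
  then have "x \<in> supp (\<phi> j)" unfolding supp_def using closure_subset[of "{x. \<phi> j x \<noteq> 0}"] by auto
  moreover have "supp (\<phi> j) \<subseteq> {x. norm x \<le> 2 * 2 ^ j}"
  proof (cases j)
    case (Suc i)
    have *: "2 powr (real j + 1) = 2 * 2 ^ j" by (simp add: powr_add powr_realpow)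
    have "j \<ge> 1" using Suc by simp
    then have "supp (\<phi> j) \<subseteq> {x. 2 powr (real j - 1) \<le> norm x \<and> norm x \<le> 2 powr (real j + 1)}"
      using dy unfolding dyadic_resolution_def by blast
    then show ?thesis unfolding * by blast
  qed (use dy in \<open>auto simp: dyadic_resolution_def\<close>)
  ultimately show False using x by auto
qed

lemma dyadic_eq_0_near: "j \<ge> 1 \<Longrightarrow> norm x < 1 \<Longrightarrow> \<phi> j x = 0"
proof (rule ccontr)
  assume j: "j \<ge> 1" and x: "norm x < 1" and "\<phi> j x \<noteq> 0"
  then have "x \<in> supp (\<phi> j)" unfolding supp_def using closure_subset[of "{x. \<phi> j x \<noteq> 0}"] by auto
  then have "2 powr (real j - 1) \<le> norm x" using dy j unfolding dyadic_resolution_def by blast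
  moreover have "2 powr (real j - 1) \<ge> 2 powr 0" using j by (intro powr_mono) auto
  ultimately show False using x by simp
qed

lemma dyadic_0_eq_1: "norm x < 1 \<Longrightarrow> \<phi> 0 x = 1"
proof -
  assume x: "norm x < 1"
  have "(\<lambda>j. \<phi> j x) sums (\<Sum>j\<in>{0}. \<phi> j x)" using dyadic_eq_0_near[OF _ x] by (intro sums_finite) auto
  moreover have "(\<lambda>j. \<phi> j x) sums 1" using dy unfolding dyadic_resolution_def by blast
  ultimately show ?thesis using sums_unique2 by fastforce
qed

lemma dyadic_test_function: "\<phi> j \<in> test_functions"
  using dy dyadic_eq_0_far[of j] unfolding test_functions_iff dyadic_resolution_def schwartz_def by blast

text \<open>With R = 2 * 2^j, a radius containing the support, the assumed bounds on 2^(j|\<alpha>|)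
  D^\<alpha> \<phi> j become scale-invariant bounds 2^|\<alpha>| c \<alpha>, the same for every
  j.\<close>

lemma dyadic_kernel_decay:
  "\<exists>C\<ge>0. \<forall>j z. (1 + (2 * 2 ^ j) * norm z) ^ (CARD('n) + 1) * norm (fourier (\<phi> j) z) \<le> C * (2 * 2 ^ j) ^ CARD('n)"
proof -
  obtain c where c: "\<And>\<alpha> j x. 2 ^ (j * length \<alpha>) * norm (Dpart \<alpha> (\<phi> j) x) \<le> c \<alpha>"
    using dy unfolding dyadic_resolution_def by metis
  obtain C where C: "C \<ge> 0" "\<forall>\<psi>\<in>test_functions. \<forall>R\<ge>0. (\<forall>x. norm x > R \<longrightarrow> \<psi> x = 0) \<longrightarrow>
    (\<forall>\<alpha> x. R ^ length \<alpha> * norm (Dpart \<alpha> \<psi> x) \<le> 2 ^ length \<alpha> * c \<alpha>) \<longrightarrow>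
    (\<forall>z. (1 + R * norm z) ^ (CARD('n) + 1) * norm (fourier \<psi> z) \<le> C * R ^ CARD('n))"
    using fourier_scaled_decay[of "\<lambda>\<alpha>. 2 ^ length \<alpha> * c \<alpha>" "CARD('n) + 1"] by blast
  have "(2 * 2 ^ j) ^ length \<alpha> * norm (Dpart \<alpha> (\<phi> j) x) \<le> 2 ^ length \<alpha> * c \<alpha>" for j \<alpha> x
    using mult_left_mono[OF c[of j \<alpha> x], of "2 ^ length \<alpha>"] by (simp add: power_mult_distrib power_mult mult.assoc)
  then have "(1 + (2 * 2 ^ j) * norm z) ^ (CARD('n) + 1) * norm (fourier (\<phi> j) z) \<le> C * (2 * 2 ^ j) ^ CARD('n)" for j z
    using C(2)[rule_format, OF dyadic_test_function[of j], of "2 * 2 ^ j" z] dyadic_eq_0_far[of j] by auto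
  then show ?thesis using C(1) by blast
qed

text \<open>For j \<ge> 1 the function \<open>\<phi> j\<close> vanishes on the unit ball, so
  inversion at the origin applies with \<delta> = 1 and \<open>\<phi> 0\<close> as \<kappa>.\<close>

lemma dyadic_kernel_mean_zero:
  assumes "j \<ge> 1" shows "(LINT z|lborel. fourier (\<phi> j) z) = 0"
  using integral_fourier_eq_0[OF dyadic_test_function zero_less_one dyadic_eq_0_near[OF assms] dyadic_test_function[of 0]]
    dyadic_0_eq_1[of 0] by simp

end

text \<open>The block sends \<psi> to u at
  \<open>fourier (\<lambda>x. \<phi> x * inv_fourier \<psi> x)\<close>, a multiple of the
  convolution of \<open>fourier \<phi>\<close> with \<psi>; Fubini then frees \<psi>. The kernel
  estimates for \<open>bmo\<close> supply both the absolute convergence and the bound that makes the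
  resulting function locally integrable.\<close>

lemma convolution_represents_multiplier:
  fixes f :: "real^'n::finite \<Rightarrow> real" and \<phi> \<kappa> :: "real^'n \<Rightarrow> complex"
  assumes f[measurable]: "f \<in> borel_measurable borel" and li: "locally_integrable f"
    and N: "bmo_norm f = ennreal N" "N \<ge> 0"
    and \<kappa>: "\<kappa> \<in> test_functions" "\<And>x. norm x < 1 \<Longrightarrow> \<kappa> x = 1"
    and u: "tempered u" "represents (\<lambda>x. complex_of_real (f x)) u"
    and \<phi>: "\<phi> \<in> test_functions" and R: "R \<ge> 1 / 2"
    and L: "\<And>z. (1 + R * norm z) ^ (CARD('n) + 1) * norm (fourier \<phi> z) \<le> D"
  shows "represents (\<lambda>y. complex_of_real ((2 * pi) powr (- real CARD('n) / 2)) *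
      (LINT x|lborel. complex_of_real (f x) * fourier \<phi> (x - y)))
    (distr_inv_fourier (distr_mult \<phi> (distr_fourier u)))"
proof -
  define c where "c = complex_of_real ((2 * pi) powr (- real CARD('n) / 2))"
  define g where "g y = c * (LINT x|lborel. complex_of_real (f x) * fourier \<phi> (x - y))" for y
  define M where "M = D * (4 ^ (CARD('n) + 2) * N * 2 ^ CARD('n))"
  have Lm[measurable]: "fourier \<phi> \<in> borel_measurable borel"
    using schwartz_borel_measurable[OF fourier_schwartz[OF \<phi>]] .
  note ki = bmo_kernel_integrable[OF f li N Lm R L]
  have gm[measurable]: "g \<in> borel_measurable borel" unfolding g_def by measurable
  have gb: "norm (g y) \<le> norm c * M" for y
    unfolding g_def norm_mult M_def by (intro mult_left_mono order_trans[OF integral_norm_bound ki(2)]) simp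
  have "integrable lborel (\<lambda>x. indicator K x *\<^sub>R g x)" if K: "compact K" for K
  proof -
    have [measurable]: "K \<in> sets borel" using K by (simp add: borel_compact)
    have "integrable lborel (\<lambda>x. indicator K x * (norm c * M))"
      using K emeasure_compact_finite[OF K] by (intro integrable_mult_left integrable_real_indicator) auto
    then show ?thesis
      by (rule Bochner_Integration.integrable_bound) (measurable, use order_trans[OF gb abs_ge_self] in \<open>auto simp: indicator_def\<close>)
  qed
  then have lg: "locally_integrable g"
    unfolding locally_integrable_def set_integrable_def
    by (auto simp: integrable_completion borel_compact)
  have "u (fourier (\<lambda>x. \<phi> x * inv_fourier \<psi> x)) = (LINT y|lebesgue. g y * \<psi> y)" if \<psi>: "\<psi> \<in> test_functions" for \<psi>
  proof -
    define \<eta> where "\<eta> = fourier (\<lambda>x. \<phi> x * inv_fourier \<psi> x)"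
    have \<eta>: "\<eta> \<in> schwartz"
      unfolding \<eta>_def by (intro fourier_schwartz test_functions_mult(1)[OF \<phi>] smooth_inv_fourier[OF \<psi>])
    have \<eta>m[measurable]: "\<eta> \<in> borel_measurable borel" using schwartz_borel_measurable[OF \<eta>] .
    have \<psi>m[measurable]: "\<psi> \<in> borel_measurable borel" using schwartz_borel_measurable[OF test_functions_subset_schwartz[OF \<psi>]] .
    have \<psi>i: "integrable lborel \<psi>" using schwartz_integrable[OF test_functions_subset_schwartz[OF \<psi>]] .
    \<comment> \<open>As a Schwartz function \<eta> satisfies the kernel hypothesis with R = 1;
      taking y = 0 there makes f \<eta> integrable, so u at \<eta> is an integral.\<close>
    obtain B where B: "\<And>x. (1 + 1 * norm x) ^ (CARD('n) + 1) * norm (\<eta> x) \<le> B" using schwartz_bound[OF \<eta>, of "CARD('n) + 1"] by auto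
    have i1: "integrable lborel (\<lambda>x. complex_of_real (f x) * \<eta> x)"
      using bmo_kernel_integrable(1)[OF f li N \<eta>m _ B, of 0] by simp
    then have i2: "integrable lebesgue (\<lambda>x. complex_of_real (f x) * \<eta> x)" by (subst integrable_completion) auto
    let ?F = "\<lambda>y x. complex_of_real (f x) * fourier \<phi> (x - y) * \<psi> y"
    have int: "integrable (lborel \<Otimes>\<^sub>M lborel) (\<lambda>(y, x). ?F y x)"
    proof (rule lborel_pair.Fubini_integrable)
      show "(\<lambda>(y, x). ?F y x) \<in> borel_measurable (lborel \<Otimes>\<^sub>M lborel)" by measurable
      have "integrable lborel (\<lambda>y. M * norm (\<psi> y))" using \<psi>i by auto
      then have "integrable lborel (\<lambda>y. LINT x|lborel. norm (?F y x))"
      proof (rule Bochner_Integration.integrable_bound)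
        show "AE y in lborel. norm (LINT x|lborel. norm (?F y x)) \<le> norm (M * norm (\<psi> y))"
        proof (intro always_eventually allI)
          fix y
          have "norm (LINT x|lborel. norm (?F y x)) = (LINT x|lborel. norm (complex_of_real (f x) * fourier \<phi> (x - y))) * norm (\<psi> y)"
            by (simp add: norm_mult abs_mult)
          also have "\<dots> \<le> M * norm (\<psi> y)" unfolding M_def by (intro mult_right_mono ki(2)) auto
          finally show "norm (LINT x|lborel. norm (?F y x)) \<le> norm (M * norm (\<psi> y))" by simp
        qed
      qed measurable
      then show "integrable lborel (\<lambda>y. LINT x|lborel. norm (case (y, x) of (y, x) \<Rightarrow> ?F y x))" by simp
      show "AE y in lborel. integrable lborel (\<lambda>x. case (y, x) of (y, x) \<Rightarrow> ?F y x)"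
        using ki(1) by (simp add: integrable_mult_left)
    qed
    have "u \<eta> = (LINT x|lebesgue. complex_of_real (f x) * \<eta> x)"
      by (rule tempered_represented_on_schwartz[OF \<kappa> u \<eta> i2])
    also have "\<dots> = (LINT x|lborel. complex_of_real (f x) * \<eta> x)" by (subst integral_completion) auto
    also have "\<dots> = c * (LINT x|lborel. LINT y|lborel. ?F y x)"
    proof -
      have "complex_of_real (f x) * \<eta> x = c * (LINT y|lborel. ?F y x)" for x
        unfolding \<eta>_def fourier_mult_inv_fourier[OF \<phi> \<psi>] c_def[symmetric] mult.assoc integral_mult_right_zero
        by (rule mult.left_commute)
      then show ?thesis by (simp only: integral_mult_right_zero)
    qed
    also have "(LINT x|lborel. LINT y|lborel. ?F y x) = (LINT y|lborel. LINT x|lborel. ?F y x)"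
      using lborel_pair.Fubini_integral[OF int] by simp
    also have "c * \<dots> = (LINT y|lborel. g y * \<psi> y)"
    proof -
      have "g y * \<psi> y = c * (LINT x|lborel. ?F y x)" for y
        unfolding g_def integral_mult_left_zero by (rule mult.assoc)
      then show ?thesis by (simp only: integral_mult_right_zero)
    qed
    also have "\<dots> = (LINT y|lebesgue. g y * \<psi> y)" by (subst integral_completion) auto
    finally show ?thesis unfolding \<eta>_def .
  qed
  then have "represents g (distr_inv_fourier (distr_mult \<phi> (distr_fourier u)))"
    using lg unfolding represents_def distr_inv_fourier_def distr_mult_def distr_fourier_def by blast
  then show ?thesis unfolding g_def c_def .
qed

text \<open>K is chosen before f, u and j. The block j = 0 uses the bound by |f| at the fixed scale
  R = 2; the blocks j \<ge> 1 use cancellation, where the powers of R drop out. The bound on g holds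
  at every point, ready for pointwise interpolation.\<close>

lemma dyadic_block_bounded_by_bmo:
  fixes \<phi> :: "nat \<Rightarrow> real^'n::finite \<Rightarrow> complex"
  assumes dy: "dyadic_resolution \<phi>"
  shows "\<exists>K>0. \<forall>f N u j. f \<in> borel_measurable borel \<longrightarrow> locally_integrable f \<longrightarrow> bmo_norm f = ennreal N \<longrightarrow> N \<ge> 0 \<longrightarrow>
    tempered u \<longrightarrow> represents (\<lambda>x. complex_of_real (f x)) u \<longrightarrow>
    (\<exists>g. represents g (distr_inv_fourier (distr_mult (\<phi> j) (distr_fourier u))) \<and> (\<forall>y. norm (g y) \<le> K * N))"
proof -
  obtain C where C: "C \<ge> 0" "\<And>j z. (1 + (2 * 2 ^ j) * norm z) ^ (CARD('n) + 1) * norm (fourier (\<phi> j) z) \<le> C * (2 * 2 ^ j) ^ CARD('n)"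
    using dyadic_kernel_decay[OF dy] by blast
  define c where "c = (2 * pi) powr (- real CARD('n) / 2)"
  \<comment> \<open>\<open>K1\<close> belongs to j = 0, where D = C 2^d in dimension d;
    \<open>K2\<close> to j \<ge> 1, after R^d and (1/R)^d cancel. The factor c is the normalisation
    of the transform.\<close>
  define K1 K2 where "K1 = c * (C * 2 ^ CARD('n) * (4 ^ (CARD('n) + 2) * 2 ^ CARD('n)))"
    and "K2 = c * (C * (4 ^ (CARD('n) + 2) * 2 ^ (CARD('n) + 1)))"
  have K: "K1 \<ge> 0" "K2 \<ge> 0" unfolding K1_def K2_def c_def using C by auto
  show ?thesis
  \<comment> \<open>The summand 1 makes the constant positive even if C = 0.\<close>
  proof (intro exI[of _ "K1 + K2 + 1"] conjI allI impI)
    show "K1 + K2 + 1 > 0" using K by simp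
    fix f :: "real^'n \<Rightarrow> real" and N :: real and u and j :: nat
    assume f: "f \<in> borel_measurable borel" and li: "locally_integrable f" and N: "bmo_norm f = ennreal N" "N \<ge> 0"
      and u: "tempered u" "represents (\<lambda>x. complex_of_real (f x)) u"
    define R :: real where "R = 2 * 2 ^ j"
    have R: "R \<ge> 1 / 2" unfolding R_def using one_le_power[of "2::real" j] by linarith
    have L: "(1 + R * norm z) ^ (CARD('n) + 1) * norm (fourier (\<phi> j) z) \<le> C * R ^ CARD('n)" for z
      unfolding R_def by (rule C)
    define g where "g y = complex_of_real c * (LINT x|lborel. complex_of_real (f x) * fourier (\<phi> j) (x - y))" for y
    have t: "\<phi> j \<in> test_functions" by (rule dyadic_test_function[OF dy])
    have Lm: "fourier (\<phi> j) \<in> borel_measurable borel" using schwartz_borel_measurable[OF fourier_schwartz[OF t]] .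
    have "norm (LINT x|lborel. complex_of_real (f x) * fourier (\<phi> j) (x - y)) * c \<le> (K1 + K2) * N" for y
    proof (cases "j \<ge> 1")
      case True
      have "norm (LINT x|lborel. complex_of_real (f x) * fourier (\<phi> j) (x - y)) \<le>
        C * R ^ CARD('n) * (4 ^ (CARD('n) + 2) * (2 ^ (CARD('n) + 1) * N) * (1 / R) ^ CARD('n))"
        by (rule bmo_mean_zero_kernel_bound[OF f li N Lm R L dyadic_kernel_mean_zero[OF dy True]])
      also have "\<dots> = C * (4 ^ (CARD('n) + 2) * 2 ^ (CARD('n) + 1)) * N"
        using R by (simp add: power_divide)
      finally have "norm (LINT x|lborel. complex_of_real (f x) * fourier (\<phi> j) (x - y)) * c \<le> K2 * N"
        unfolding K2_def using mult_right_mono[of _ _ c] by (simp add: c_def mult_ac)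
      also have "\<dots> \<le> (K1 + K2) * N" using K N by (intro mult_right_mono) auto
      finally show ?thesis .
    next
      case False
      then have "j = 0" by simp
      then have R2: "R = 2" unfolding R_def by simp
      have "norm (LINT x|lborel. complex_of_real (f x) * fourier (\<phi> j) (x - y)) \<le>
        C * R ^ CARD('n) * (4 ^ (CARD('n) + 2) * N * 2 ^ CARD('n))"
        by (rule order_trans[OF integral_norm_bound bmo_kernel_integrable(2)[OF f li N Lm R L]])
      then have "norm (LINT x|lborel. complex_of_real (f x) * fourier (\<phi> j) (x - y)) * c \<le> K1 * N"
        unfolding K1_def R2 using mult_right_mono[of _ _ c] by (simp add: c_def mult_ac)
      also have "\<dots> \<le> (K1 + K2) * N" using K N by (intro mult_right_mono) auto
      finally show ?thesis .
    qed
    note kb = this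
    have "norm (g y) \<le> (K1 + K2 + 1) * N" for y
    proof -
      have "norm (g y) = norm (LINT x|lborel. complex_of_real (f x) * fourier (\<phi> j) (x - y)) * c"
        unfolding g_def norm_mult c_def by simp
      also have "\<dots> \<le> (K1 + K2) * N" by (rule kb)
      also have "\<dots> \<le> (K1 + K2 + 1) * N" using N by (intro mult_right_mono) auto
      finally show ?thesis .
    qed
    moreover have "represents g (distr_inv_fourier (distr_mult (\<phi> j) (distr_fourier u)))"
      unfolding g_def c_def
      by (rule convolution_represents_multiplier[OF f li N dyadic_test_function[OF dy] dyadic_0_eq_1[OF dy] u t R L])
    ultimately show "\<exists>g. represents g (distr_inv_fourier (distr_mult (\<phi> j) (distr_fourier u))) \<and> (\<forall>y. norm (g y) \<le> (K1 + K2 + 1) * N)"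
      by blast
  qed
qed


section \<open>Interpolation\<close>


lemma epowr_0_left: "a > 0 \<Longrightarrow> epowr 0 a = 0"
  by (simp add: epowr_def)

lemma epowr_ennreal: "a > 0 \<Longrightarrow> x \<ge> 0 \<Longrightarrow> epowr (ennreal x) a = ennreal (x powr a)"
  by (simp add: epowr_def)

lemma epowr_eq_0_iff: "a > 0 \<Longrightarrow> epowr x a = 0 \<longleftrightarrow> x = 0"
  by (cases x) (auto simp: epowr_def ennreal_eq_0_iff)

lemma epowr_mono: "a \<ge> 0 \<Longrightarrow> x \<le> y \<Longrightarrow> epowr x a \<le> epowr y a"
  by (cases x; cases y) (auto simp: epowr_def top_unique intro!: ennreal_leI powr_mono2)

text \<open>For a > 0 the power fixes 0 and \<infinity> and sends positive values to positive
  values, so both sides follow the convention 0 * \<infinity> = 0 alike.\<close>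

lemma epowr_mult:
  assumes "a > 0"
  shows "epowr (x * y) a = epowr x a * epowr y a"
proof (cases "x = \<infinity> \<or> y = \<infinity>")
  case True
  have e: "epowr top a = top" using assms by (simp add: epowr_def)
  show ?thesis
  proof (cases "x = 0 \<or> y = 0")
    case True
    then show ?thesis using epowr_0_left[OF assms] by auto
  next
    case nz: False
    then have "epowr x a \<noteq> 0" "epowr y a \<noteq> 0" using epowr_eq_0_iff[OF assms] by auto
    then show ?thesis using True nz e by (auto simp: ennreal_mult_top ennreal_top_mult)
  qed
next
  case False
  then obtain s t where "x = ennreal s" "y = ennreal t" "s \<ge> 0" "t \<ge> 0" by (metis ennreal_cases infinity_ennreal_def)
  then show ?thesis using assms by (simp add: epowr_ennreal powr_mult flip: ennreal_mult)
qed

lemma epowr_epowr: "a > 0 \<Longrightarrow> b > 0 \<Longrightarrow> epowr (epowr x a) b = epowr x (a * b)"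
  by (cases x) (auto simp: epowr_def powr_powr)

lemma epowr_1: "epowr x 1 = x"
  by (cases x) (auto simp: epowr_def)

lemma Lp_norm_ennreal: "p \<ge> 0 \<Longrightarrow> Lp_norm (ennreal p) g = epowr (\<integral>\<^sup>+x. ennreal (norm (g x) powr p) \<partial>lebesgue) (1 / p)"
  by (simp add: Lp_norm_def)

text \<open>Pointwise |g|^p \<le> B^(p-w) |g|^w, then the p-th root. The computation stays in
  [0,\<infinity>], so an infinite L^w norm is covered.\<close>

lemma Lp_norm_interpolation:
  fixes g :: "real^'n::finite \<Rightarrow> complex"
  assumes wp: "0 < w" "w < p" and [measurable]: "g \<in> borel_measurable lebesgue"
    and B: "B \<ge> 0" "\<And>x. norm (g x) \<le> B"
  shows "Lp_norm (ennreal p) g \<le> ennreal (B powr (1 - w / p)) * epowr (Lp_norm (ennreal w) g) (w / p)"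
proof -
  have "(\<integral>\<^sup>+x. ennreal (norm (g x) powr p) \<partial>lebesgue) \<le> (\<integral>\<^sup>+x. ennreal (B powr (p - w)) * ennreal (norm (g x) powr w) \<partial>lebesgue)"
  proof (intro nn_integral_mono)
    fix x
    have "norm (g x) powr p = norm (g x) powr (p - w) * norm (g x) powr w" by (simp flip: powr_add)
    also have "\<dots> \<le> B powr (p - w) * norm (g x) powr w" using wp B by (intro mult_right_mono powr_mono2) auto
    finally show "ennreal (norm (g x) powr p) \<le> ennreal (B powr (p - w)) * ennreal (norm (g x) powr w)"
      by (simp add: ennreal_leI flip: ennreal_mult)
  qed
  also have "\<dots> = ennreal (B powr (p - w)) * (\<integral>\<^sup>+x. ennreal (norm (g x) powr w) \<partial>lebesgue)"
    by (intro nn_integral_cmult) measurable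
  finally have "Lp_norm (ennreal p) g \<le> epowr (ennreal (B powr (p - w)) * (\<integral>\<^sup>+x. ennreal (norm (g x) powr w) \<partial>lebesgue)) (1 / p)"
    using wp by (simp add: Lp_norm_ennreal epowr_mono)
  also have "\<dots> = ennreal (B powr (1 - w / p)) * epowr (Lp_norm (ennreal w) g) (w / p)"
    using wp by (simp add: epowr_mult epowr_ennreal powr_powr Lp_norm_ennreal epowr_epowr diff_divide_distrib)
  finally show ?thesis .
qed

lemma distr_Lp_norm_represents:
  fixes g \<kappa> :: "real^'n::finite \<Rightarrow> complex"
  assumes p: "p > 0" and g: "represents g u" and \<kappa>: "\<kappa> \<in> test_functions" "\<kappa> 0 = 1"
  shows "distr_Lp_norm (ennreal p) u = Lp_norm (ennreal p) g"
proof -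
  have "Lp_norm (ennreal p) h = Lp_norm (ennreal p) g" if "represents h u" for h
  proof -
    have "(\<integral>\<^sup>+x. ennreal (norm (h x) powr p) \<partial>lebesgue) = (\<integral>\<^sup>+x. ennreal (norm (g x) powr p) \<partial>lebesgue)"
      by (rule nn_integral_cong_AE) (use represents_AE_unique[OF that g \<kappa>] in eventually_elim, simp)
    then show ?thesis using p by (simp add: Lp_norm_ennreal)
  qed
  then show ?thesis unfolding distr_Lp_norm_def using g by (metis (mono_tags, lifting) INF_eq_const empty_iff mem_Collect_eq)
qed

text \<open>With q' = q w / p the weights match term by term, since s (w/p) q = s q', and the root
  1/q equals (w/p) / q'; the inequality on blocks is simply raised to the power q and summed. K lies
  in [0,\<infinity>] and may be 0, the value used when all blocks vanish.\<close>

lemma distr_besov_norm_interpolation: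
  fixes \<phi> :: "nat \<Rightarrow> real^'n::finite \<Rightarrow> complex" and K :: ennreal
  assumes q: "0 < q" and wp: "0 < w" "w < p"
    and K: "\<And>j. distr_Lp_norm (ennreal p) (distr_inv_fourier (distr_mult (\<phi> j) (distr_fourier u))) \<le>
      K * epowr (distr_Lp_norm (ennreal w) (distr_inv_fourier (distr_mult (\<phi> j) (distr_fourier u)))) (w / p)"
  shows "distr_besov_norm \<phi> (s * (w / p)) (ennreal p) q u \<le>
    K * epowr (distr_besov_norm \<phi> s (ennreal w) (if q = \<infinity> then \<infinity> else ennreal w * (q / ennreal p)) u) (w / p)"
proof -
  define a where "a p j = distr_Lp_norm (ennreal p) (distr_inv_fourier (distr_mult (\<phi> j) (distr_fourier u)))" for p j
  define t where "t = w / p"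
  have t: "t > 0" unfolding t_def using wp by simp
  have Ka: "a p j \<le> K * epowr (a w j) t" for j unfolding a_def t_def by (rule K)
  show ?thesis
  proof (cases "q = \<infinity>")
    case True
    have "ennreal (2 powr (real j * (s * t))) * a p j \<le> K * epowr (SUP j. ennreal (2 powr (real j * s)) * a w j) t" for j
    proof -
      have "ennreal (2 powr (real j * (s * t))) * a p j \<le> ennreal (2 powr (real j * (s * t))) * (K * epowr (a w j) t)"
        by (intro mult_left_mono Ka) simp
      also have "\<dots> = K * epowr (ennreal (2 powr (real j * s)) * a w j) t"
        using t by (simp add: epowr_mult epowr_ennreal powr_powr mult_ac)
      also have "\<dots> \<le> K * epowr (SUP j. ennreal (2 powr (real j * s)) * a w j) t"
        using t by (intro mult_left_mono epowr_mono SUP_upper) auto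
      finally show ?thesis .
    qed
    then show ?thesis using True unfolding distr_besov_norm_def a_def[symmetric] t_def[symmetric] Let_def
      by (simp add: SUP_le_iff)
  next
    case False
    then obtain Q where Q: "q = ennreal Q" "Q > 0" using q by (cases q) auto
    have q': "ennreal w * (q / ennreal p) = ennreal (t * Q)"
      using wp Q unfolding t_def by (simp add: divide_ennreal flip: ennreal_mult)
    define S where "S = (\<Sum>j. ennreal (2 powr (real j * s * (t * Q))) * epowr (a w j) (t * Q))"
    have "(\<Sum>j. ennreal (2 powr (real j * (s * t) * Q)) * epowr (a p j) Q) \<le> (\<Sum>j. epowr K Q * (ennreal (2 powr (real j * s * (t * Q))) * epowr (a w j) (t * Q)))"
    proof (intro suminf_le summableI)
      fix j
      have "epowr (a p j) Q \<le> epowr K Q * epowr (a w j) (t * Q)"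
        using epowr_mono[OF less_imp_le[OF Q(2)] Ka[of j]] Q t by (simp add: epowr_mult epowr_epowr)
      then have "ennreal (2 powr (real j * (s * t) * Q)) * epowr (a p j) Q \<le> ennreal (2 powr (real j * (s * t) * Q)) * (epowr K Q * epowr (a w j) (t * Q))"
        by (intro mult_left_mono) auto
      then show "ennreal (2 powr (real j * (s * t) * Q)) * epowr (a p j) Q \<le> epowr K Q * (ennreal (2 powr (real j * s * (t * Q))) * epowr (a w j) (t * Q))"
        by (simp add: mult_ac)
    qed
    also have "\<dots> = epowr K Q * S" unfolding S_def by (rule ennreal_suminf_cmult)
    finally have "epowr (\<Sum>j. ennreal (2 powr (real j * (s * t) * Q)) * epowr (a p j) Q) (1 / Q) \<le> epowr (epowr K Q * S) (1 / Q)"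
      using Q by (intro epowr_mono) auto
    also have "\<dots> = K * epowr (epowr S (1 / (t * Q))) t"
      using Q t by (simp add: epowr_mult epowr_epowr epowr_1)
    finally show ?thesis
      using False Q t unfolding distr_besov_norm_def a_def[symmetric] t_def[symmetric] Let_def q' S_def by simp
  qed
qed

lemma distr_besov_norm_eq_0D:
  fixes \<phi> :: "nat \<Rightarrow> real^'n::finite \<Rightarrow> complex"
  assumes "distr_besov_norm \<phi> s p q u = 0" "0 < q"
  shows "distr_Lp_norm p (distr_inv_fourier (distr_mult (\<phi> j) (distr_fourier u))) = 0"
proof -
  define a where "a j = distr_Lp_norm p (distr_inv_fourier (distr_mult (\<phi> j) (distr_fourier u)))" for j
  have "a j = 0"
  proof (cases "q = \<infinity>")
    case True
    have "ennreal (2 powr (real j * s)) * a j \<le> (SUP j. ennreal (2 powr (real j * s)) * a j)" by (rule SUP_upper) simp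
    also have "\<dots> = 0" using assms True unfolding distr_besov_norm_def a_def[symmetric] Let_def by simp
    finally show ?thesis by (simp add: ennreal_eq_0_iff)
  next
    case False
    then obtain Q where Q: "q = ennreal Q" "Q > 0" using assms(2) by (cases q) auto
    have "(\<Sum>j. ennreal (2 powr (real j * s * Q)) * epowr (a j) Q) = 0"
      using assms(1) Q unfolding distr_besov_norm_def a_def[symmetric] Let_def by (simp add: epowr_eq_0_iff)
    then have "ennreal (2 powr (real j * s * Q)) * epowr (a j) Q = 0"
      by (subst (asm) suminf_eq_zero_iff) auto
    then show ?thesis using Q by (simp add: ennreal_eq_0_iff epowr_eq_0_iff)
  qed
  then show ?thesis unfolding a_def .
qed

text \<open>A block evaluates u only at Fourier transforms of test functions, hence on the Schwartz
  space. Outside that space a \<open>distr\<close> takes arbitrary values, so two functionals for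
  one distribution may differ there.\<close>

lemma distr_besov_norm_cong:
  fixes \<phi> :: "nat \<Rightarrow> real^'n::finite \<Rightarrow> complex"
  assumes dy: "dyadic_resolution \<phi>" and uv: "\<And>\<psi>. \<psi> \<in> schwartz \<Longrightarrow> u \<psi> = v \<psi>"
  shows "distr_besov_norm \<phi> s p q u = distr_besov_norm \<phi> s p q v"
proof -
  have "represents g (distr_inv_fourier (distr_mult (\<phi> j) (distr_fourier u))) =
    represents g (distr_inv_fourier (distr_mult (\<phi> j) (distr_fourier v)))" for g j
  proof -
    have "u (fourier (\<lambda>x. \<phi> j x * inv_fourier \<psi> x)) = v (fourier (\<lambda>x. \<phi> j x * inv_fourier \<psi> x))" if "\<psi> \<in> test_functions" for \<psi>
      by (intro uv fourier_schwartz test_functions_mult(1)[OF dyadic_test_function[OF dy]] smooth_inv_fourier[OF that])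
    then show ?thesis unfolding represents_def distr_inv_fourier_def distr_mult_def distr_fourier_def by simp
  qed
  then show ?thesis unfolding distr_besov_norm_def distr_Lp_norm_def by simp
qed

lemma besov_norm_represented:
  fixes \<phi> :: "nat \<Rightarrow> real^'n::finite \<Rightarrow> complex"
  assumes dy: "dyadic_resolution \<phi>" and u: "tempered u" "represents (\<lambda>x. complex_of_real (f x)) u"
  shows "besov_norm \<phi> s p q f = distr_besov_norm \<phi> s p q u"
proof -
  have "distr_besov_norm \<phi> s p q v = distr_besov_norm \<phi> s p q u"
    if "tempered v" "represents (\<lambda>x. complex_of_real (f x)) v" for v
    using tempered_eq_on_schwartz[OF dyadic_test_function[OF dy] dyadic_0_eq_1[OF dy] that(1) u(1) that(2) u(2)]
    by (intro distr_besov_norm_cong dy)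
  note * = this
  show ?thesis
    unfolding besov_norm_def
  proof (rule INF_eq_const)
    show "{u. tempered u \<and> represents (\<lambda>x. complex_of_real (f x)) u} \<noteq> {}" using u by blast
  qed (use * in blast)
qed

section \<open>Invariance under changes on null sets\<close>

lemma locally_integrable_cong_AE:
  fixes f g :: "real^'n::finite \<Rightarrow> 'b::{banach, second_countable_topology}"
  assumes "AE x in lebesgue. f x = g x" "locally_integrable f" "g \<in> borel_measurable lebesgue"
  shows "locally_integrable g"
  unfolding locally_integrable_def
proof (intro allI impI)
  fix K :: "(real^'n) set" assume K: "compact K"
  note [measurable] = assms(3) locally_integrable_measurable[OF assms(2)]
  have [measurable]: "K \<in> sets lebesgue" using K by (intro sets_completionI_sets) (simp add: borel_compact)
  have "integrable lebesgue (\<lambda>x. indicator K x *\<^sub>R f x)"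
    using K assms(2) unfolding locally_integrable_def set_integrable_def by blast
  then show "set_integrable lebesgue K g"
    unfolding set_integrable_def by (rule integrable_cong_AE_imp) (use assms(1) in auto)
qed

lemma average_cong_AE:
  fixes f g :: "real^'n::finite \<Rightarrow> real"
  assumes "AE x in lebesgue. f x = g x" "Q \<in> sets lebesgue"
    and [measurable]: "f \<in> borel_measurable lebesgue" "g \<in> borel_measurable lebesgue"
  shows "average Q f = average Q g"
proof -
  note [measurable] = assms(2)
  have "(LINT x|lebesgue. indicator Q x *\<^sub>R f x) = (LINT x|lebesgue. indicator Q x *\<^sub>R g x)"
    by (rule integral_cong_AE) (use assms(1) in auto)
  then show ?thesis unfolding average_def set_lebesgue_integral_def by simp
qed

lemma bmo_norm_cong_AE:
  fixes f g :: "real^'n::finite \<Rightarrow> real"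
  assumes fg: "AE x in lebesgue. f x = g x" and f[measurable]: "f \<in> borel_measurable lebesgue"
    and g[measurable]: "g \<in> borel_measurable lebesgue"
  shows "bmo_norm f = bmo_norm g"
proof -
  have gf: "AE x in lebesgue. g x = f x" using fg by eventually_elim simp
  have li: "locally_integrable f = locally_integrable g"
    using locally_integrable_cong_AE[OF fg _ g] locally_integrable_cong_AE[OF gf _ f] by blast
  have Q: "Q \<in> sets lebesgue" if "cube Q" for Q :: "(real^'n) set" using that unfolding cube_def by auto
  have "average Q (\<lambda>x. \<bar>f x - c\<bar>) = average Q (\<lambda>x. \<bar>g x - c\<bar>)" if "cube Q" for Q c
    by (rule average_cong_AE[OF _ Q[OF that]]) (use fg in auto)
  moreover have "average Q (\<lambda>x. \<bar>f x\<bar>) = average Q (\<lambda>x. \<bar>g x\<bar>)" if "cube Q" for Q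
    by (rule average_cong_AE[OF _ Q[OF that]]) (use fg in auto)
  moreover have "average Q f = average Q g" if "cube Q" for Q by (rule average_cong_AE[OF fg Q[OF that] f g])
  ultimately show ?thesis
    unfolding bmo_norm_def li by (intro if_cong refl arg_cong2[where f = "(+)"] SUP_cong) auto
qed

lemma represents_cong_AE:
  fixes f g :: "real^'n::finite \<Rightarrow> complex"
  assumes fg: "AE x in lebesgue. f x = g x" and g[measurable]: "g \<in> borel_measurable lebesgue" and f: "represents f u"
  shows "represents g u"
proof -
  have li: "locally_integrable f" using f unfolding represents_def by blast
  note [measurable] = locally_integrable_measurable[OF li]
  have "(LINT x|lebesgue. f x * \<psi> x) = (LINT x|lebesgue. g x * \<psi> x)" if \<psi>: "\<psi> \<in> test_functions" for \<psi>
  proof -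
    have [measurable]: "\<psi> \<in> borel_measurable lebesgue"
      using schwartz_borel_measurable[OF test_functions_subset_schwartz[OF \<psi>]] by (intro measurable_completion) simp
    show ?thesis by (rule integral_cong_AE) (use fg in auto)
  qed
  then show ?thesis using f locally_integrable_cong_AE[OF fg li g] unfolding represents_def by simp
qed

text \<open>The bound \<open>abs_decay_weight\<close> with N = 0 makes a weighted integral of |f|
  vanish, and its weight is strictly positive.\<close>

lemma bmo_norm_eq_0_AE:
  fixes f :: "real^'n::finite \<Rightarrow> real"
  assumes f[measurable]: "f \<in> borel_measurable borel" and bmo: "bmo_norm f = 0"
  shows "AE x in lebesgue. f x = 0"
proof -
  have li: "locally_integrable f" using bmo unfolding bmo_norm_def by (auto split: if_splits)
  have "(\<integral>\<^sup>+x. ennreal \<bar>f x\<bar> * ennreal (1 / (1 + norm (x - (0::real^'n)) / 2) ^ (CARD('n) + 1)) \<partial>lborel) \<le> 0"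
    using abs_decay_weight[OF f li, of 0 0] bmo by simp
  then have "AE x in lborel. ennreal \<bar>f x\<bar> * ennreal (1 / (1 + norm (x - (0::real^'n)) / 2) ^ (CARD('n) + 1)) = 0"
    by (subst (asm) le_zero_eq, subst (asm) nn_integral_0_iff_AE) auto
  then have "AE x in lborel. f x = 0"
  proof eventually_elim
    case (elim x)
    have "(1 + norm (x - 0) / 2) ^ (CARD('n) + 1) > 0" by (intro zero_less_power add_pos_nonneg) auto
    then show ?case using elim by (simp only: mult_eq_0_iff ennreal_eq_0_iff) (auto simp: divide_le_0_iff not_le)
  qed
  then show ?thesis by (rule AE_completion)
qed

lemma tempered_zero: "tempered (\<lambda>_. 0)"
  unfolding tempered_def by simp

lemma represents_zero:
  fixes f :: "real^'n::finite \<Rightarrow> complex"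
  assumes "AE x in lebesgue. f x = 0" "f \<in> borel_measurable lebesgue"
  shows "represents f (\<lambda>_. 0)"
proof (rule represents_cong_AE)
  show "AE x in lebesgue. 0 = f x" using assms(1) by eventually_elim simp
  show "represents (\<lambda>_::real^'n. 0::complex) (\<lambda>_. 0)" unfolding represents_def locally_integrable_def set_integrable_def by simp
qed fact

text \<open>Covers the two degenerate cases in which either norm on the right-hand side is infinite
  and the other factor is nonzero: the estimate is then trivial.\<close>

lemma ennreal_mult_epowr_top:
  assumes "C > 0" "a > 0" "y \<noteq> 0"
  shows "ennreal C * epowr top a * y = top" "ennreal C * y * epowr top a = top"
  using assms by (auto simp: epowr_def ennreal_mult_top ennreal_top_mult)

theorem theorem8p23:
  fixes \<phi> :: "nat \<Rightarrow> real^'n::finite \<Rightarrow> complex"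
    and s p w :: real and q :: ennreal
  assumes "dyadic_resolution \<phi>"
    and "0 < q"
    and "1 \<le> w" and "w \<le> p"
  shows "\<exists>C>0. \<forall>f :: real^'n \<Rightarrow> real. f \<in> borel_measurable lebesgue \<longrightarrow>
    besov_norm \<phi> (s * (w / p)) (ennreal p) q f
      \<le> ennreal C * epowr (besov_norm \<phi> s (ennreal w) (if q = \<infinity> then \<infinity> else ennreal w * (q / ennreal p)) f) (w / p)
          * epowr (bmo_norm f) (1 - w / p)"
proof (cases "w = p")
  case True
  have "p \<noteq> 0" using assms by simp
  have "(if q = \<infinity> then \<infinity> else ennreal p * (q / ennreal p)) = q"
  proof (cases q)
    case (real r)
    then show ?thesis using assms by (simp add: divide_ennreal flip: ennreal_mult)
  qed simp
  \<comment> \<open>The exponent of \<open>bmo_norm f\<close> is 0 and \<open>epowr\<close> returns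
    1 there, even at \<infinity>; both sides coincide, so C = 1.\<close>
  then have "\<forall>f. besov_norm \<phi> (s * (w / p)) (ennreal p) q f
      \<le> ennreal 1 * epowr (besov_norm \<phi> s (ennreal w) (if q = \<infinity> then \<infinity> else ennreal w * (q / ennreal p)) f) (w / p)
          * epowr (bmo_norm f) (1 - w / p)"
    using True \<open>p \<noteq> 0\<close> by (simp only:) (simp add: epowr_1 epowr_def[of _ 0])
  then show ?thesis using zero_less_one by blast
next
  case False
  note dy = assms(1)
  have wp: "0 < w" "w < p" using assms False by auto
  define t where "t = w / p"
  have t: "t > 0" "1 - t > 0" unfolding t_def using wp by auto
  define q' where "q' = (if q = \<infinity> then \<infinity> else ennreal w * (q / ennreal p))"
  have q': "q' > 0" unfolding q'_def using assms(2) wp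
    by (auto simp: zero_less_iff_neq_zero ennreal_divide_eq_0_iff)
  obtain K where K: "K > 0" "\<And>f N u j. f \<in> borel_measurable borel \<Longrightarrow> locally_integrable f \<Longrightarrow> bmo_norm f = ennreal N \<Longrightarrow> N \<ge> 0 \<Longrightarrow>
    tempered u \<Longrightarrow> represents (\<lambda>x. complex_of_real (f x)) u \<Longrightarrow>
    (\<exists>g. represents g (distr_inv_fourier (distr_mult (\<phi> j) (distr_fourier u))) \<and> (\<forall>y. norm (g y) \<le> K * N))"
    using dyadic_block_bounded_by_bmo[OF dy] by blast
  have \<kappa>: "\<phi> 0 \<in> test_functions" "\<phi> 0 0 = 1" using dyadic_test_function[OF dy] dyadic_0_eq_1[OF dy, of 0] by auto
  \<comment> \<open>The share of the block bound K N that remains after the power 1 - t, once the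
    power of N is separated.\<close>
  define C where "C = K powr (1 - t)"
  have C: "C > 0" unfolding C_def using K by simp
  have "besov_norm \<phi> (s * t) (ennreal p) q f \<le> ennreal C * epowr (besov_norm \<phi> s (ennreal w) q' f) t * epowr (bmo_norm f) (1 - t)"
    if f: "f \<in> borel_measurable lebesgue" for f
  proof -
    \<comment> \<open>The kernel estimates work with Borel functions. A Borel version has the same
      \<open>bmo_norm\<close> and represents every distribution that f represents, so the estimates
      transfer to f.\<close>
    obtain f' where f'[measurable]: "f' \<in> borel_measurable borel" and ff': "AE x in lebesgue. f x = f' x"
      using borel_version_real[OF f] by blast
    have f'l: "f' \<in> borel_measurable lebesgue" by (rule measurable_completion) simp
    have bmo: "bmo_norm f' = bmo_norm f" using bmo_norm_cong_AE[OF ff' f f'l] by simp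
    have rep: "represents (\<lambda>x. complex_of_real (f' x)) u" if "represents (\<lambda>x. complex_of_real (f x)) u" for u
      by (rule represents_cong_AE[OF _ _ that]) (use ff' f'l in auto)
    show ?thesis
    proof (cases "\<exists>u. tempered u \<and> represents (\<lambda>x. complex_of_real (f x)) u")
      case False
      then have "besov_norm \<phi> s (ennreal w) q' f = \<infinity>" unfolding besov_norm_def by auto
      \<comment> \<open>The infinite factor could still be cancelled by
        \<open>bmo_norm f = 0\<close>; but then f vanishes almost everywhere and represents the zero
        distribution, against the case assumption.\<close>
      moreover have "bmo_norm f \<noteq> 0"
      proof
        assume "bmo_norm f = 0"
        then have "AE x in lebesgue. f' x = 0" using bmo_norm_eq_0_AE[OF f'] bmo by simp
        then have "AE x in lebesgue. complex_of_real (f x) = 0" using ff' by eventually_elim simp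
        moreover have "(\<lambda>x. complex_of_real (f x)) \<in> borel_measurable lebesgue" using f by measurable
        ultimately have "represents (\<lambda>x. complex_of_real (f x)) (\<lambda>_. 0)" by (rule represents_zero)
        moreover have "tempered (\<lambda>_::real^'n \<Rightarrow> complex. 0)" by (rule tempered_zero)
        ultimately show False using False by blast
      qed
      ultimately show ?thesis using C t by (simp add: ennreal_mult_epowr_top epowr_eq_0_iff)
    next
      case True
      then obtain u where u: "tempered u" "represents (\<lambda>x. complex_of_real (f x)) u" by blast
      note bu = besov_norm_represented[OF dy u]
      let ?T = "\<lambda>j. distr_inv_fourier (distr_mult (\<phi> j) (distr_fourier u))"
      show ?thesis
      proof (cases "bmo_norm f = \<infinity>")
        case True
        show ?thesis
        proof (cases "besov_norm \<phi> s (ennreal w) q' f = 0")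
          case True
          \<comment> \<open>Here the right-hand side is 0 * \<infinity> = 0, so the left one must be
            shown to vanish: each block is zero in L^w, hence almost everywhere, hence in L^p. The
            interpolation then applies with constant 0.\<close>
          have z: "distr_Lp_norm (ennreal w) (?T j) = 0" for j
            using distr_besov_norm_eq_0D[OF _ q'] True bu by simp
          have "distr_Lp_norm (ennreal p) (?T j) \<le> 0 * epowr (distr_Lp_norm (ennreal w) (?T j)) (w / p)" for j
          proof -
            \<comment> \<open>An infimum over the empty set is \<infinity>, so the value 0 provides
              a representing function.\<close>
            obtain g where g: "represents g (?T j)" using z[of j] unfolding distr_Lp_norm_def by fastforce
            then have [measurable]: "g \<in> borel_measurable lebesgue" using locally_integrable_measurable unfolding represents_def by blast
            have "Lp_norm (ennreal w) g = 0" using z[of j] distr_Lp_norm_represents[OF wp(1) g \<kappa>] by simp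
            then have "(\<integral>\<^sup>+x. ennreal (norm (g x) powr w) \<partial>lebesgue) = 0" using wp by (simp add: Lp_norm_ennreal epowr_eq_0_iff)
            then have "AE x in lebesgue. ennreal (norm (g x) powr w) = 0" by (subst (asm) nn_integral_0_iff_AE) auto
            then have "AE x in lebesgue. ennreal (norm (g x) powr p) = 0" by eventually_elim (simp add: ennreal_eq_0_iff)
            then have "(\<integral>\<^sup>+x. ennreal (norm (g x) powr p) \<partial>lebesgue) = 0" by (subst nn_integral_0_iff_AE) auto
            then show ?thesis using wp distr_Lp_norm_represents[OF _ g \<kappa>, of p] by (simp add: Lp_norm_ennreal epowr_0_left)
          qed
          from distr_besov_norm_interpolation[OF assms(2) wp this, where s = s] show ?thesis
            unfolding bu t_def by simp
        next
          case F: False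
          then show ?thesis using True C t by (simp add: ennreal_mult_epowr_top epowr_eq_0_iff)
        qed
      next
        case False
        then obtain N where N: "bmo_norm f = ennreal N" "N \<ge> 0" by (cases "bmo_norm f") auto
        then have li: "locally_integrable f'" using bmo unfolding bmo_norm_def by (auto split: if_splits)
        \<comment> \<open>The same g computes both block norms, in L^p and in L^w. N = 0 is
          included, the power of K N being 0 because 1 - t > 0.\<close>
        have "distr_Lp_norm (ennreal p) (?T j) \<le> ennreal ((K * N) powr (1 - t)) * epowr (distr_Lp_norm (ennreal w) (?T j)) (w / p)" for j
        proof -
          obtain g where g: "represents g (?T j)" "\<And>y. norm (g y) \<le> K * N"
            using K(2)[OF f' li _ N(2) u(1) rep[OF u(2)], of j] bmo N(1) by auto
          have "g \<in> borel_measurable lebesgue" using g(1) locally_integrable_measurable unfolding represents_def by blast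
          from Lp_norm_interpolation[OF wp this _ g(2)] show ?thesis
            using K(1) N(2) distr_Lp_norm_represents[OF _ g(1) \<kappa>, of p] distr_Lp_norm_represents[OF wp(1) g(1) \<kappa>] wp
            unfolding t_def by simp
        qed
        from distr_besov_norm_interpolation[OF assms(2) wp this, where s = s]
        have "besov_norm \<phi> (s * t) (ennreal p) q f \<le> ennreal ((K * N) powr (1 - t)) * epowr (besov_norm \<phi> s (ennreal w) q' f) t"
          unfolding bu t_def q'_def .
        also have "ennreal ((K * N) powr (1 - t)) = ennreal C * epowr (bmo_norm f) (1 - t)"
          unfolding N(1) C_def using K(1) N(2) t by (simp add: epowr_ennreal powr_mult ennreal_mult)
        finally show ?thesis by (simp add: mult_ac)
      qed
    qed
  qed
  then show ?thesis using C unfolding t_def q'_def by blast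
qed

end
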